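(* Let $\theta>0$, $\beta\in\mathbb{R}$ be fixed, and for each $n$ let $G$ be a random graph on $n$ vertices drawn from the two-star model $\mathbb{P}_n$ with parameters $(\theta,\beta)$. Then, as $n\to\infty$, $$\sqrt{n}\left[\frac{4}{n^2}\sum_{i=1}^n(d_i(G)-\bar d(G))^2-\tau\right]\stackrel{d}{\longrightarrow}N(0,2\tau^2),$$ where $\bar d(G):=\frac1n\sum_{i=1}^n d_i(G)$ and $\tau:=\frac{1-t^2}{1-\theta(1-t^2)}$.
   Context: Let $\mathcal{G}_n$ be the set of simple labeled graphs on $[n]=\{1,\dots,n\}$, identified with their symmetric $0/1$ adjacency matrices $G=(G_{ij})$ with $G_{ii}=0$. Let $d_i(G)=\sum_j G_{ij}$, $E(G)=\sum_{i<j}G_{ij}$, $T(G)=\sum_{i=1}^n\binom{d_i(G)}{2}$. Given $\omega_1>0,\omega_2\in\mathbb{R}$, the two-star model is the probability mass function on $\mathcal{G}_n$ $$\mathbb{P}_n(G=g)=\frac{1}{Z_n(\omega_1,\omega_2)}\exp\Big\{\Big(\omega_2+\frac{\omega_1}{n-1}\Big)E(g)+\frac{\omega_1}{n-1}T(g)\Big\},$$ with $Z_n$ the normalizing constant. The parameters are rewritten as $\theta:=\omega_1/4>0$, $\beta:=(\omega_1+\omega_2)/2\in\mathbb{R}$. Definition of $t=t(\theta,\beta)$: if $\beta\ne0$, $t$ is the unique root of $x=\tanh(2\theta x+\beta)$ having the same sign as $\beta$; if $\beta=0$ and $\theta\le 1/2$, $t=0$; if $\beta=0$ and $\theta>1/2$,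 $t$ is the unique positive root of $x=\tanh(2\theta x)$. *)

theory Defs
  imports "HOL-Probability.Probability"
begin

text \<open>
  A simple labeled graph on \<open>{1..n}\<close> is its symmetric \<open>0/1\<close> adjacency matrix with zero diagonal.
  Entries outside \<open>{1..n} \<times> {1..n}\<close> are forced to be \<open>0\<close>, so that every graph
  is represented by exactly one function.
\<close>

definition graphs :: "nat \<Rightarrow> (nat \<Rightarrow> nat \<Rightarrow> nat) set" where
  "graphs n = {g. (\<forall>i j. g i j \<in> {0, 1}) \<and> (\<forall>i j. g i j = g j i) \<and> (\<forall>i. g i i = 0) \<and>
                  (\<forall>i j. i \<notin> {1..n} \<or> j \<notin> {1..n} \<longrightarrow> g i j = 0)}"

definition vdeg :: "nat \<Rightarrow> (nat \<Rightarrow> nat \<Rightarrow> nat) \<Rightarrow> nat \<Rightarrow> nat" where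
  "vdeg n g i = (\<Sum>j=1..n. g i j)"

definition edge_count :: "nat \<Rightarrow> (nat \<Rightarrow> nat \<Rightarrow> nat) \<Rightarrow> nat" where
  "edge_count n g = (\<Sum>(i, j) \<in> {(i, j). i \<in> {1..n} \<and> j \<in> {1..n} \<and> i < j}. g i j)"

definition two_star_count :: "nat \<Rightarrow> (nat \<Rightarrow> nat \<Rightarrow> nat) \<Rightarrow> nat" where
  "two_star_count n g = (\<Sum>i=1..n. vdeg n g i choose 2)"

definition avg_deg :: "nat \<Rightarrow> (nat \<Rightarrow> nat \<Rightarrow> nat) \<Rightarrow> real" where
  "avg_deg n g = 1 / real n * (\<Sum>i=1..n. real (vdeg n g i))"

definition two_star_weight :: "real \<Rightarrow> real \<Rightarrow> nat \<Rightarrow> (nat \<Rightarrow> nat \<Rightarrow> nat) \<Rightarrow> real" where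
  "two_star_weight \<omega>1 \<omega>2 n g =
     exp ((\<omega>2 + \<omega>1 / (real n - 1)) * real (edge_count n g)
          + \<omega>1 / (real n - 1) * real (two_star_count n g))"

definition two_star_Z :: "real \<Rightarrow> real \<Rightarrow> nat \<Rightarrow> real" where
  "two_star_Z \<omega>1 \<omega>2 n = (\<Sum>g\<in>graphs n. two_star_weight \<omega>1 \<omega>2 n g)"

definition two_star_pmf :: "real \<Rightarrow> real \<Rightarrow> nat \<Rightarrow> (nat \<Rightarrow> nat \<Rightarrow> nat) pmf" where
  "two_star_pmf \<omega>1 \<omega>2 n =
     embed_pmf (\<lambda>g. if g \<in> graphs n
                    then two_star_weight \<omega>1 \<omega>2 n g / two_star_Z \<omega>1 \<omega>2 n else 0)"

definition two_star_t :: "real \<Rightarrow> real \<Rightarrow> real" where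
  "two_star_t \<theta> \<beta> =
     (if \<beta> \<noteq> 0 then (THE x. x = tanh (2 * \<theta> * x + \<beta>) \<and> sgn x = sgn \<beta>)
      else if \<theta> \<le> 1/2 then 0
      else (THE x. x = tanh (2 * \<theta> * x) \<and> x > 0))"

definition two_star_tau :: "real \<Rightarrow> real \<Rightarrow> real" where
  "two_star_tau \<theta> \<beta> =
     (1 - (two_star_t \<theta> \<beta>)\<^sup>2) / (1 - \<theta> * (1 - (two_star_t \<theta> \<beta>)\<^sup>2))"

lemma finite_graphs: "finite (graphs n)"
proof -
  let ?A = "{1..n} \<times> {1..n}"
  let ?f = "\<lambda>S i j. if (i, j) \<in> S then 1 else (0::nat)"
  have "graphs n \<subseteq> ?f ` Pow ?A"
  proof
    fix g assume g: "g \<in> graphs n"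
    define S where "S = {(i, j). g i j = 1}"
    have "g i j = ?f S i j" for i j
    proof -
      have "g i j \<in> {0, 1}" using g unfolding graphs_def by blast
      thus ?thesis unfolding S_def by force
    qed
    hence "g = ?f S" by (intro ext)
    moreover have "S \<subseteq> ?A"
    proof
      fix p assume "p \<in> S"
      then obtain i j where p: "p = (i, j)" "g i j = 1" unfolding S_def by blast
      have "i \<notin> {1..n} \<or> j \<notin> {1..n} \<longrightarrow> g i j = 0" using g unfolding graphs_def by blast
      with p show "p \<in> ?A" by simp
    qed
    ultimately show "g \<in> ?f ` Pow ?A" by blast
  qed
  thus ?thesis by (rule finite_subset) simp
qed

lemma two_star_Z_pos: "two_star_Z \<omega>1 \<omega>2 n > 0"
proof -
  have "(\<lambda>i j. 0) \<in> graphs n" by (simp add: graphs_def)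
  hence "graphs n \<noteq> {}" by blast
  thus ?thesis
    unfolding two_star_Z_def two_star_weight_def
    by (rule sum_pos[OF finite_graphs _ exp_gt_zero])
qed

lemma pmf_two_star:
  "pmf (two_star_pmf \<omega>1 \<omega>2 n) g =
     (if g \<in> graphs n then two_star_weight \<omega>1 \<omega>2 n g / two_star_Z \<omega>1 \<omega>2 n else 0)"
  unfolding two_star_pmf_def
proof (rule pmf_embed_pmf)
  let ?f = "\<lambda>g. if g \<in> graphs n then two_star_weight \<omega>1 \<omega>2 n g / two_star_Z \<omega>1 \<omega>2 n else 0"
  show nonneg: "0 \<le> ?f g" for g
    using two_star_Z_pos[of \<omega>1 \<omega>2 n] by (simp add: two_star_weight_def)
  have "(\<integral>\<^sup>+ g. ennreal (?f g) \<partial>count_space UNIV) = (\<Sum>g\<in>graphs n. ennreal (?f g))"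
    by (rule nn_integral_count_space') (auto simp: finite_graphs)
  also have "\<dots> = ennreal (\<Sum>g\<in>graphs n. ?f g)"
    by (rule sum_ennreal) (rule nonneg)
  also have "(\<Sum>g\<in>graphs n. ?f g) = two_star_Z \<omega>1 \<omega>2 n / two_star_Z \<omega>1 \<omega>2 n"
    unfolding two_star_Z_def sum_divide_distrib by (rule sum.cong) simp_all
  also have "\<dots> = 1"
    using two_star_Z_pos[of \<omega>1 \<omega>2 n] by simp
  finally show "(\<integral>\<^sup>+ g. ennreal (?f g) \<partial>count_space UNIV) = 1" by simp
qed

end

theory Submission
  imports Defs
begin

text \<open>
  In terms of the spins \<open>Y i j = 2 G i j - 1\<close> and the rescaled degrees
  \<open>z i = (\<Sum>j\<noteq>i. Y i j) / (n - 1)\<close> the weight is proportional to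
  \<open>exp ((n - 1) (\<theta>/2 \<Sum> z i ^ 2 + \<beta>/2 \<Sum> z i))\<close>. Linearizing the square with independent Gaussians
  (Hubbard-Stratonovich) turns this into the density \<open>exp (- (\<Sum>i<j. h (\<phi> i) (\<phi> j)))\<close> on \<open>\<real>^n\<close>, with
  \<open>h x y = \<theta>/4 (x - y)^2 + q ((x + y)/2) - q t\<close> and \<open>q x = \<theta> x^2 - ln cosh (2 \<theta> x + \<beta>)\<close>, which is
  minimal at \<open>t\<close> (and at \<open>- t\<close> if \<open>\<beta> = 0\<close>). Since \<open>h \<ge> 0\<close> does not depend on \<open>n\<close>, comparing the partition
  functions of \<open>n\<close> and \<open>n + 1\<close> coordinates bounds an exponential moment of \<open>\<Sum>j. h (\<phi> i) (\<phi> j)\<close> uniformly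
  in \<open>n\<close>, at all temperatures including the critical one. Hence \<open>z i - m\<close> is of order \<open>n ^ (-1/2)\<close>,
  where \<open>m\<close> is the average of the \<open>z i\<close>.

  The limit law then comes from Stein's method: given the other edges, \<open>Y i j\<close> has mean
  \<open>tanh (\<theta> (z i + z j) + \<beta>)\<close> up to a self-interaction. For
  \<open>W = sqrt n ((\<Sum> (z i - m)^2) - \<tau>)\<close>, Taylor expansion of \<open>tanh\<close> around \<open>2 \<theta> m + \<beta>\<close> gives
  \<open>E (W f(W)) = 2 \<tau>^2 E (f'(W)) + o(1)\<close>, provided that \<open>\<Sum> (z i - m)^3\<close>, \<open>m - tanh (2 \<theta> m + \<beta>)\<close> and
  \<open>tanh (2 \<theta> m + \<beta>)^2 - t^2\<close> are negligible, which follows from the same identity with other test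
  functions. Taking trigonometric \<open>f\<close> yields a differential equation for the characteristic
  function of \<open>W\<close>.
\<close>

section \<open>The effective potential and its minimizer\<close>

text \<open>Two features decide what must be estimated. For \<beta> = 0 and \<theta> > 1/2 the mean
  m may sit near t or near - t, and at the critical point the mean field equation is degenerate, so
  m is never compared with t. This is harmless because \<tau> depends on t^2 only: the quantity that
  matters is \<open>tanh (2 \<theta> m + \<beta>)^2 - t^2\<close>, whose third absolute moment is
  O(n^(-2)). Multiplied by sqrt n this leaves n^(-1/6), the \<open>rate\<close> of the later errors.
  The fluctuations z i - m only meet the factor 1 - \<theta> (1 - t^2), and stability of t, 2
  \<theta> (1 - t^2) \<le> 1, keeps it at least 1/2 even at criticality.

  The comparison of partition functions must be sharp up to a constant. Both directions have order
  n^(-1/2): the quadratic part of h bounds the integral over a new coordinate by a Gaussian of that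
  width, and conversely a new coordinate may be placed within n^(-1/2) of an existing one with small
  interaction energy, at cost O(1). Neither argument needs to know which minimizer is
  selected.\<close>

definition lncosh :: "real \<Rightarrow> real" where
  "lncosh x = ln (cosh x)"

lemma lncosh_deriv: "(lncosh has_real_derivative tanh x) (at x)"
  unfolding lncosh_def by (auto intro!: derivative_eq_intros simp: tanh_def cosh_real_pos)

lemma lncosh_deriv' [derivative_intros]:
  "(f has_real_derivative f') (at x) \<Longrightarrow> ((\<lambda>x. lncosh (f x)) has_real_derivative tanh (f x) * f') (at x)"
  using DERIV_chain2[OF lncosh_deriv] by blast

lemma tanh_square_less: "(tanh (x::real))\<^sup>2 < 1"
  using tanh_real_abs[of x] tanh_real_bounds[of x] by (simp add: abs_square_less_1 abs_less_iff)

lemma abs_tanh_less: "\<bar>tanh (x::real)\<bar> < 1"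
  using tanh_real_bounds[of x] by auto

lemma lncosh_minus [simp]: "lncosh (- x) = lncosh x"
  by (simp add: lncosh_def)

lemma lncosh_le_abs: "lncosh x \<le> \<bar>x\<bar>"
proof -
  have "cosh x \<le> exp \<bar>x\<bar>"
    unfolding cosh_def by (cases "x \<ge> 0") auto
  thus ?thesis unfolding lncosh_def
    by (metis cosh_real_pos exp_gt_zero ln_exp ln_le_cancel_iff)
qed

lemma exp_lncosh: "exp (lncosh x) = cosh x"
  by (simp add: lncosh_def)

text \<open>Convexity: the second derivative is 1 - tanh^2. Subtracting \<open>lncosh\<close> from a
  parabola therefore leaves a function with a quadratic majorant at every point.\<close>

lemma lncosh_tangent: "lncosh u + tanh u * (v - u) \<le> lncosh v"
proof -
  have "convex_on UNIV lncosh"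
    by (rule f''_ge0_imp_convex[where f' = tanh and f'' = "\<lambda>x. 1 - (tanh x)\<^sup>2"])
       (auto intro!: derivative_eq_intros lncosh_deriv simp: less_imp_le[OF tanh_square_less])
  from convex_on_imp_above_tangent[OF this _ _ _ lncosh_deriv, of u v]
  show ?thesis by (auto simp: algebra_simps)
qed

lemma lncosh_continuous [continuous_intros]:
  "continuous_on S f \<Longrightarrow> continuous_on S (\<lambda>x. lncosh (f x))"
  unfolding lncosh_def by (intro continuous_intros) auto

text \<open>A nonnegative function with second derivative at most \<open>L\<close> satisfies \<open>f'\<^sup>2 \<le> 2 L f\<close>.\<close>
lemma quadratic_lncosh_shift:
  fixes L b c :: real
  defines "f \<equiv> \<lambda>x. L / 2 * x\<^sup>2 - lncosh (L * x + b) - c"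
  assumes L: "L > 0" and nonneg: "\<And>x. f x \<ge> 0"
  shows "f x \<le> 2 * f y + L * (x - y)\<^sup>2"
proof -
  define s where "s = L * (y - tanh (L * y + b))"
  have up: "f (y + d) \<le> f y + s * d + L / 2 * d\<^sup>2" for d
    using lncosh_tangent[of "L * y + b" "L * (y + d) + b"]
    unfolding f_def s_def by (simp add: algebra_simps power2_eq_square)
  \<comment> \<open>The displacement \<open>- s / L\<close> minimizes the majorant
    \<open>up\<close>, so nonnegativity there gives the strongest bound on the slope s.\<close>
  have "0 \<le> f (y + - s / L)" by (rule nonneg)
  also have "\<dots> \<le> f y + s * (- s / L) + L / 2 * (- s / L)\<^sup>2" by (rule up)
  also have "\<dots> = f y - s\<^sup>2 / (2 * L)" using L by (simp add: field_simps power2_eq_square)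
  finally have s2: "s\<^sup>2 / (2 * L) \<le> f y" by simp
  have "s * d \<le> s\<^sup>2 / (2 * L) + L / 2 * d\<^sup>2" for d
  proof -
    have "0 \<le> (s - L * d)\<^sup>2 / (2 * L)" using L by simp
    also have "\<dots> = s\<^sup>2 / (2 * L) + L / 2 * d\<^sup>2 - s * d" using L by (simp add: field_simps power2_eq_square)
    finally show ?thesis by simp
  qed
  from this[of "x - y"] up[of "x - y"] s2 show ?thesis by simp
qed

definition qpot :: "real \<Rightarrow> real \<Rightarrow> real \<Rightarrow> real" where
  "qpot \<theta> \<beta> x = \<theta> * x\<^sup>2 - lncosh (2 * \<theta> * x + \<beta>)"

lemma qpot_deriv: "(qpot \<theta> \<beta> has_real_derivative 2 * \<theta> * (x - tanh (2 * \<theta> * x + \<beta>))) (at x)"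
  unfolding qpot_def [abs_def] by (auto intro!: derivative_eq_intros simp: algebra_simps)

lemma qpot_continuous: "continuous_on S (qpot \<theta> \<beta>)"
  unfolding qpot_def [abs_def] by (intro continuous_intros)

lemma tanh_mono: "x \<le> y \<Longrightarrow> tanh x \<le> tanh (y::real)"
  by simp

text \<open>
  The potential \<open>qpot\<close> is minimal at \<open>t\<close>. The third powers in \<open>K_bound\<close> come from the critical case
  \<open>\<beta> = 0\<close>, \<open>\<theta> = 1/2\<close>, where \<open>x - tanh x\<close> vanishes to third order at \<open>t = 0\<close>; the potential term is needed
  at roots of \<open>x = tanh (2 \<theta> x + \<beta>)\<close> that are not global minimizers.
\<close>
locale two_star =
  fixes \<theta> \<beta> t K :: real
  assumes \<theta>_pos: "\<theta> > 0"
    and t_fix: "tanh (2 * \<theta> * t + \<beta>) = t"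
    and q_min: "qpot \<theta> \<beta> t \<le> qpot \<theta> \<beta> x"
    and t_stable: "2 * \<theta> * (1 - t\<^sup>2) \<le> 1"
    and K_bound: "\<bar>x\<bar> \<le> 1 \<Longrightarrow> \<bar>(tanh (2 * \<theta> * x + \<beta>))\<^sup>2 - t\<^sup>2\<bar> ^ 3
        \<le> K * ((x - tanh (2 * \<theta> * x + \<beta>))\<^sup>2 + (qpot \<theta> \<beta> x - qpot \<theta> \<beta> t) ^ 3)"

text \<open>By concavity on the half line the slope at \<open>t\<close> is less than that of the chord from \<open>0\<close> to \<open>t\<close>.\<close>
lemma fixed_point_slope:
  assumes \<theta>: "\<theta> > 0" and \<beta>: "\<beta> \<ge> 0" and t: "t > 0" "tanh (2 * \<theta> * t + \<beta>) = (t::real)"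
  shows "2 * \<theta> * (1 - t\<^sup>2) < 1"
proof -
  let ?g = "\<lambda>x. tanh (2 * \<theta> * x + \<beta>)"
  have "\<exists>z>0. z < t \<and> ?g t - ?g 0 = (t - 0) * (2 * \<theta> * (1 - (?g z)\<^sup>2))"
    by (rule MVT2) (use t in \<open>auto intro!: derivative_eq_intros simp: algebra_simps\<close>)
  then obtain z where z: "0 < z" "z < t" "?g t - ?g 0 = t * (2 * \<theta> * (1 - (?g z)\<^sup>2))" by auto
  have g0: "?g 0 \<ge> 0" using \<beta> by simp
  have "t * (2 * \<theta> * (1 - (?g z)\<^sup>2)) \<le> t * 1" using z(3) t(2) g0 by linarith
  hence 1: "2 * \<theta> * (1 - (?g z)\<^sup>2) \<le> 1" using t(1) by (rule mult_left_le_imp_le)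
  have "?g z < ?g t" using z \<theta> by simp
  moreover have "0 \<le> ?g z" using z \<theta> \<beta> by simp
  ultimately have "(?g z)\<^sup>2 < t\<^sup>2" using t by (intro power_strict_mono) auto
  hence "2 * \<theta> * (1 - t\<^sup>2) < 2 * \<theta> * (1 - (?g z)\<^sup>2)" using \<theta> by simp
  with 1 show ?thesis by linarith
qed

section \<open>Positive roots of the fixed point equation and the global minimum of the
  potential\<close>

lemma fixed_point_exists:
  assumes \<theta>: "\<theta> > 0" and \<beta>: "\<beta> > 0 \<or> \<beta> = 0 \<and> \<theta> > 1/2"
  shows "\<exists>t>0. tanh (2 * \<theta> * t + \<beta>) = (t::real)"
proof -
  let ?g = "\<lambda>x. tanh (2 * \<theta> * x + \<beta>) - x"
  have "\<exists>a>0. a < 1 \<and> ?g a > 0"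
  proof (cases "\<beta> > 0")
    case True
    \<comment> \<open>The map is at least \<open>tanh \<beta>\<close> on the half line, so half of
      this value lies strictly below the graph; the cap 1/2 keeps the witness in the unit
      interval.\<close>
    let ?a = "min (1/2) (tanh \<beta> / 2)"
    have 1: "tanh \<beta> > 0" using True by simp
    have a: "0 < ?a" "?a < 1" "?a < tanh \<beta>" using 1 by (auto simp: min_def)
    have "tanh (2 * \<theta> * ?a + \<beta>) \<ge> tanh \<beta>" using a \<theta> by (intro tanh_mono) auto
    with a show ?thesis by (intro exI[of _ ?a]) linarith
  next
    case False
    hence b: "\<beta> = 0" "\<theta> > 1/2" using \<beta> by auto
    \<comment> \<open>Now the graph meets the diagonal at 0, and the sign just to the right comes
      from the slope \<open>2 * \<theta> - 1 > 0\<close>.\<close>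
    have "((\<lambda>x. ?g x) has_real_derivative (2 * \<theta> - 1)) (at 0)"
      using b by (auto intro!: derivative_eq_intros)
    from DERIV_pos_inc_right[OF this] b obtain d where d: "d > 0" "\<And>h. 0 < h \<Longrightarrow> h < d \<Longrightarrow> ?g 0 < ?g h"
      by auto
    show ?thesis using d(1) d(2)[of "min (d/2) (1/2)"] b
      by (intro exI[of _ "min (d/2) (1/2)"]) auto
  qed
  then obtain a where a: "0 < a" "a < 1" "?g a > 0" by blast
  have "\<exists>x. a \<le> x \<and> x \<le> 1 \<and> ?g x = 0"
    by (rule IVT2') (use a tanh_real_lt_1[of "2 * \<theta> + \<beta>"] in \<open>auto intro!: continuous_intros\<close>)
  then obtain x where "a \<le> x" "tanh (2 * \<theta> * x + \<beta>) - x = 0" by blast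
  thus ?thesis using a by (intro exI[of _ x]) simp
qed

text \<open>Strict concavity on the half line: by the mean value theorem the slopes of successive
  chords strictly decrease. A point on the wrong side of the diagonal would contradict this for the
  chords through 0, x, t or through 0, t, x, because the map is nonnegative at 0. Uniqueness of the
  positive root is a by-product.\<close>

lemma fixed_point_sign:
  assumes \<theta>: "\<theta> > 0" and \<beta>: "\<beta> > 0 \<or> \<beta> = 0 \<and> \<theta> > 1/2"
    and t: "t > 0" "tanh (2 * \<theta> * t + \<beta>) = (t::real)" and x: "x > 0"
  shows "x < t \<Longrightarrow> tanh (2 * \<theta> * x + \<beta>) > x" "x > t \<Longrightarrow> tanh (2 * \<theta> * x + \<beta>) < x"
proof -
  let ?g = "\<lambda>x. tanh (2 * \<theta> * x + \<beta>)"
  have b0: "\<beta> \<ge> 0" using \<beta> by auto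
  have g0: "?g 0 \<ge> 0" using b0 by simp
  have mono: "(?g u)\<^sup>2 < (?g v)\<^sup>2" if "0 \<le> u" "u < v" for u v
    using that \<theta> b0 by (intro power_strict_mono) auto
  have chord: "(?g v - ?g u) * (w - v) > (?g w - ?g v) * (v - u)" if "0 \<le> u" "u < v" "v < w" for u v w
  proof -
    have "\<exists>z>u. z < v \<and> ?g v - ?g u = (v - u) * (2 * \<theta> * (1 - (?g z)\<^sup>2))"
      by (rule MVT2) (use that in \<open>auto intro!: derivative_eq_intros simp: algebra_simps\<close>)
    then obtain a where a: "u < a" "a < v" "?g v - ?g u = (v - u) * (2 * \<theta> * (1 - (?g a)\<^sup>2))" by auto
    have "\<exists>z>v. z < w \<and> ?g w - ?g v = (w - v) * (2 * \<theta> * (1 - (?g z)\<^sup>2))"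
      by (rule MVT2) (use that in \<open>auto intro!: derivative_eq_intros simp: algebra_simps\<close>)
    then obtain c where c: "v < c" "c < w" "?g w - ?g v = (w - v) * (2 * \<theta> * (1 - (?g c)\<^sup>2))" by auto
    have "2 * \<theta> * (1 - (?g a)\<^sup>2) > 2 * \<theta> * (1 - (?g c)\<^sup>2)"
      using mono[of a c] a c that \<theta> by (intro mult_strict_left_mono) auto
    hence "((w - v) * (v - u)) * (2 * \<theta> * (1 - (?g a)\<^sup>2)) > ((w - v) * (v - u)) * (2 * \<theta> * (1 - (?g c)\<^sup>2))"
      by (rule mult_strict_left_mono) (use that in auto)
    thus ?thesis unfolding a(3) c(3) by (simp only: mult_ac)
  qed
  show "tanh (2 * \<theta> * x + \<beta>) > x" if "x < t"
  proof (rule ccontr)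
    assume "\<not> ?thesis"
    hence gx: "?g x \<le> x" by simp
    have "(?g x - ?g 0) * (t - x) > (?g t - ?g x) * (x - 0)" by (rule chord) (use x that in auto)
    moreover have "(?g x - ?g 0) * (t - x) \<le> x * (t - x)"
      by (rule mult_right_mono) (use gx g0 that in linarith)+
    moreover have "(?g t - ?g x) * (x - 0) \<ge> (t - x) * (x - 0)"
      using gx x by (intro mult_right_mono) (auto simp: t(2))
    ultimately show False by (simp add: mult.commute)
  qed
  show "tanh (2 * \<theta> * x + \<beta>) < x" if "t < x"
  proof (rule ccontr)
    assume "\<not> ?thesis"
    hence gx: "?g x \<ge> x" by simp
    have "(?g t - ?g 0) * (x - t) > (?g x - ?g t) * (t - 0)" by (rule chord) (use t that in auto)
    moreover have "(?g t - ?g 0) * (x - t) \<le> t * (x - t)"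
      by (rule mult_right_mono) (use g0 that t(2) in linarith)+
    moreover have "(?g x - ?g t) * (t - 0) \<ge> (x - t) * (t - 0)"
      using gx t(1) by (intro mult_right_mono) (auto simp: t(2))
    ultimately show False by (simp add: mult.commute)
  qed
qed

text \<open>The derivative of \<open>qpot\<close> is a positive multiple of x - tanh (2 \<theta> x +
  \<beta>), so \<open>fixed_point_sign\<close> makes the potential fall before t and rise after
  it.\<close>

lemma qpot_pos_min:
  assumes \<theta>: "\<theta> > 0" and \<beta>: "\<beta> > 0 \<or> \<beta> = 0 \<and> \<theta> > 1/2"
    and t: "t > 0" "tanh (2 * \<theta> * t + \<beta>) = (t::real)" and x: "x \<ge> 0" "x \<noteq> t"
  shows "qpot \<theta> \<beta> t < qpot \<theta> \<beta> x"
proof (cases "x < t")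
  case True
  show ?thesis
  proof (rule DERIV_neg_imp_decreasing_open[OF True])
    fix y assume y: "x < y" "y < t"
    have "2 * \<theta> * (y - tanh (2 * \<theta> * y + \<beta>)) < 0"
      using fixed_point_sign(1)[OF \<theta> \<beta> t, of y] y x \<theta> by (simp add: mult_less_0_iff)
    thus "\<exists>d. (qpot \<theta> \<beta> has_real_derivative d) (at y) \<and> d < 0" using qpot_deriv by blast
  qed (rule qpot_continuous)
next
  case False
  hence tx: "t < x" using x by simp
  show ?thesis
  proof (rule DERIV_pos_imp_increasing_open[OF tx])
    fix y assume y: "t < y" "y < x"
    have "2 * \<theta> * (y - tanh (2 * \<theta> * y + \<beta>)) > 0"
      using fixed_point_sign(2)[OF \<theta> \<beta> t, of y] y t \<theta> by simp
    thus "\<exists>d. (qpot \<theta> \<beta> has_real_derivative d) (at y) \<and> 0 < d" using qpot_deriv by blast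
  qed (rule qpot_continuous)
qed

lemma lncosh_abs_mono: "\<bar>x\<bar> < \<bar>y\<bar> \<Longrightarrow> lncosh x < lncosh y"
proof -
  assume "\<bar>x\<bar> < \<bar>y\<bar>"
  hence "cosh \<bar>x\<bar> < cosh \<bar>y\<bar>" by (intro cosh_real_strict_mono) auto
  thus ?thesis by (simp add: lncosh_def)
qed

lemma qpot_reflect: "qpot \<theta> (- \<beta>) x = qpot \<theta> \<beta> (- x)"
  using lncosh_minus[of "2 * \<theta> * x - \<beta>"] by (simp add: qpot_def)

text \<open>A negative x is compared with its reflection - x. For \<beta> > 0 the argument of
  \<open>lncosh\<close> has larger modulus at - x while the quadratic term is the same; for \<beta>
  = 0 the reflection is a symmetry, so the mirror point - t has to be excluded.\<close>

lemma qpot_min: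
  assumes \<theta>: "\<theta> > 0" and \<beta>: "\<beta> > 0 \<or> \<beta> = 0 \<and> \<theta> > 1/2"
    and t: "t > 0" "tanh (2 * \<theta> * t + \<beta>) = (t::real)" and x: "x \<noteq> t" "\<not> (\<beta> = 0 \<and> x = - t)"
  shows "qpot \<theta> \<beta> t < qpot \<theta> \<beta> x"
proof (cases "x \<ge> 0")
  case True thus ?thesis using qpot_pos_min[OF \<theta> \<beta> t] x by blast
next
  case False
  show ?thesis
  proof (cases "\<beta> = 0")
    case True
    have "qpot \<theta> \<beta> t < qpot \<theta> \<beta> (- x)" using qpot_pos_min[OF \<theta> \<beta> t, of "-x"] False True x by auto
    thus ?thesis using qpot_reflect[of \<theta> \<beta> x] True by simp
  next
    case b: False
    hence b: "\<beta> > 0" using \<beta> by auto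
    have "\<bar>2 * \<theta> * x + \<beta>\<bar> < \<bar>2 * \<theta> * (- x) + \<beta>\<bar>"
      using mult_pos_neg[OF \<theta>, of x] False b by (simp add: abs_if) 
    hence "qpot \<theta> \<beta> (- x) < qpot \<theta> \<beta> x" using lncosh_abs_mono unfolding qpot_def by force
    moreover have "qpot \<theta> \<beta> t \<le> qpot \<theta> \<beta> (- x)"
      using qpot_pos_min[OF \<theta> \<beta> t, of "-x"] False by (cases "- x = t") auto
    ultimately show ?thesis by simp
  qed
qed


section \<open>Quantitative nondegeneracy and the parameter regimes of the locale\<close>

lemma lncosh_le_square: "lncosh x \<le> x\<^sup>2 / 2"
proof -
  have tanh_le: "tanh y \<le> y" if "0 \<le> y" for y :: real
  proof -
    have "y - tanh y \<ge> 0 - tanh 0"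
      by (rule DERIV_nonneg_imp_nondecreasing[OF that])
         (auto intro!: exI derivative_eq_intros)
    thus ?thesis by simp
  qed
  have "\<bar>x\<bar>\<^sup>2 / 2 - lncosh \<bar>x\<bar> \<ge> 0\<^sup>2 / 2 - lncosh 0"
    by (rule DERIV_nonneg_imp_nondecreasing[of 0 "\<bar>x\<bar>" "\<lambda>x. x\<^sup>2 / 2 - lncosh x"])
       (auto intro!: exI[of _ "_ - tanh _"] derivative_eq_intros simp: tanh_le)
  moreover have "lncosh \<bar>x\<bar> = lncosh x" by (simp add: abs_if)
  ultimately show ?thesis by (simp add: lncosh_def)
qed

text \<open>The constant is 243 = 3 * 81. On the unit interval cosh is at most 3, so the derivative
  of tanh is at least 1/9 and \<open>tanh y \<ge> y / 9\<close>; hence the derivative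
  \<open>(tanh y)\<^sup>2\<close> of y - tanh y is at least y^2 / 81, and integration gives the
  cube.\<close>

lemma minus_tanh_ge_cube:
  assumes "0 \<le> x" "x \<le> 1"
  shows "x ^ 3 / 243 \<le> x - tanh (x::real)"
proof -
  have sech: "1 / 9 \<le> 1 - (tanh y)\<^sup>2" if "0 \<le> y" "y \<le> 1" for y :: real
  proof -
    have "cosh y \<le> cosh 1" using that by (subst cosh_real_nonneg_le_iff) auto
    also have "\<dots> \<le> 3" 
  proof -
    have "cosh (1::real) = (exp 1 + exp (- 1)) / 2" by (simp add: cosh_def)
    also have "\<dots> \<le> (3 + 3) / 2"
      by (intro divide_right_mono add_mono exp_le order.trans[OF _ exp_le]) auto
    finally show ?thesis by simp
  qed
    finally have "(cosh y)\<^sup>2 \<le> 3\<^sup>2" by (intro power_mono) auto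
    hence "1 / 9 \<le> 1 / (cosh y)\<^sup>2" by (intro divide_left_mono) auto
    also have "1 / (cosh y)\<^sup>2 = ((cosh y)\<^sup>2 - (sinh y)\<^sup>2) / (cosh y)\<^sup>2"
      by (simp only: hyperbolic_pythagoras)
    also have "\<dots> = 1 - (tanh y)\<^sup>2"
      by (simp add: tanh_def power_divide diff_divide_distrib)
    finally show ?thesis .
  qed
  have tanh_ge: "y / 9 \<le> tanh y" if "0 \<le> y" "y \<le> 1" for y :: real
  proof -
    have "tanh y - y / 9 \<ge> tanh 0 - 0 / 9"
      by (rule DERIV_nonneg_imp_nondecreasing[OF that(1), of "\<lambda>y. tanh y - y / 9"])
         (use that sech in \<open>auto intro!: exI[of _ "1 - (tanh _)\<^sup>2 - 1 / 9"] derivative_eq_intros\<close>)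
    thus ?thesis by simp
  qed
  have "x - tanh x - x ^ 3 / 243 \<ge> 0 - tanh 0 - 0 ^ 3 / 243"
  proof (rule DERIV_nonneg_imp_nondecreasing[OF assms(1), of "\<lambda>x. x - tanh x - x ^ 3 / 243"])
    fix y :: real assume y: "0 \<le> y" "y \<le> x"
    have "(y / 9)\<^sup>2 \<le> (tanh y)\<^sup>2" using y assms tanh_ge[of y] by (intro power_mono) auto
    thus "\<exists>d. ((\<lambda>x. x - tanh x - x ^ 3 / 243) has_real_derivative d) (at y) \<and> 0 \<le> d"
      by (intro exI[of _ "(tanh y)\<^sup>2 - y\<^sup>2 / 81"])
         (auto intro!: derivative_eq_intros simp: power_divide)
  qed
  thus ?thesis by simp
qed

lemma cube_add_le: "0 \<le> a \<Longrightarrow> 0 \<le> b \<Longrightarrow> (a + b) ^ 3 \<le> 4 * (a ^ 3 + b ^ 3)" for a b :: real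
proof -
  assume "0 \<le> a" "0 \<le> b"
  hence "0 \<le> 3 * (a + b) * (a - b)\<^sup>2" by simp
  also have "\<dots> = 4 * (a ^ 3 + b ^ 3) - (a + b) ^ 3" by (simp add: power2_eq_square power3_eq_cube algebra_simps)
  finally show ?thesis by simp
qed

text \<open>It is easier to bound x^2 - t^2, whereas the spin mean g is what enters the variance
  later. The change costs a term 2 \<bar>x - g\<bar>, whose cube is at most 16 (x - g)^2 because
  \<bar>x - g\<bar> \<le> 2; the factor 4 of \<open>cube_add_le\<close> turns 16 into 64.\<close>

lemma K_bound_from_argument:
  fixes g t x K0 Q :: real
  assumes "\<bar>x\<bar> \<le> 1" "\<bar>g\<bar> \<le> 1" "K0 \<ge> 0" "Q \<ge> 0"
    and *: "\<bar>x\<^sup>2 - t\<^sup>2\<bar> ^ 3 \<le> K0 * ((x - g)\<^sup>2 + Q)"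
  shows "\<bar>g\<^sup>2 - t\<^sup>2\<bar> ^ 3 \<le> (4 * K0 + 64) * ((x - g)\<^sup>2 + Q)"
proof -
  have "g\<^sup>2 - t\<^sup>2 = (x\<^sup>2 - t\<^sup>2) + (g - x) * (g + x)" by (simp add: power2_eq_square algebra_simps)
  hence "\<bar>g\<^sup>2 - t\<^sup>2\<bar> \<le> \<bar>x\<^sup>2 - t\<^sup>2\<bar> + \<bar>g - x\<bar> * \<bar>g + x\<bar>" by (metis abs_mult abs_triangle_ineq)
  also have "\<bar>g - x\<bar> * \<bar>g + x\<bar> \<le> \<bar>g - x\<bar> * 2" using assms by (intro mult_left_mono) auto
  finally have "\<bar>g\<^sup>2 - t\<^sup>2\<bar> ^ 3 \<le> (\<bar>x\<^sup>2 - t\<^sup>2\<bar> + \<bar>x - g\<bar> * 2) ^ 3"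
    by (intro power_mono) (auto simp: abs_minus_commute)
  also have "\<dots> \<le> 4 * (\<bar>x\<^sup>2 - t\<^sup>2\<bar> ^ 3 + (\<bar>x - g\<bar> * 2) ^ 3)" by (rule cube_add_le) auto
  also have "(\<bar>x - g\<bar> * 2) ^ 3 = 8 * ((x - g)\<^sup>2 * \<bar>x - g\<bar>)"
    by (simp add: power3_eq_cube power2_eq_square power_mult_distrib flip: abs_mult)
  also have "(x - g)\<^sup>2 * \<bar>x - g\<bar> \<le> (x - g)\<^sup>2 * 2" using assms by (intro mult_left_mono) auto
  finally have "\<bar>g\<^sup>2 - t\<^sup>2\<bar> ^ 3 \<le> 4 * \<bar>x\<^sup>2 - t\<^sup>2\<bar> ^ 3 + 64 * (x - g)\<^sup>2" by simp
  also have "\<dots> \<le> 4 * (K0 * ((x - g)\<^sup>2 + Q)) + 64 * ((x - g)\<^sup>2 + Q)" using * assms by auto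
  finally show ?thesis by (simp add: algebra_simps)
qed

text \<open>The critical point \<theta> = 1/2 is included. There x - tanh x is only cubic at 0, and
  its square dominates a multiple of x^6 = \<bar>x^2 - 0\<bar>^3, which is where the exponent 3
  comes from. Smaller \<theta> only increases the distance of \<bar>x\<bar> from the tanh
  term.\<close>

lemma two_star_subcritical:
  assumes "\<theta> > 0" "\<theta> \<le> 1/2"
  shows "two_star \<theta> 0 0 (4 * 243\<^sup>2 + 64)"
proof
  have q: "qpot \<theta> 0 0 \<le> qpot \<theta> 0 x" for x
  proof -
    have "lncosh (2 * \<theta> * x) \<le> (2 * \<theta> * x)\<^sup>2 / 2" by (rule lncosh_le_square)
    also have "\<dots> = (\<theta> * x\<^sup>2) * (2 * \<theta>)" by (simp add: power2_eq_square)
    also have "\<dots> \<le> (\<theta> * x\<^sup>2) * 1" using assms by (intro mult_left_mono) auto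
    finally show ?thesis by (simp add: qpot_def lncosh_def)
  qed
  show "qpot \<theta> 0 0 \<le> qpot \<theta> 0 x" for x by (rule q)
  fix x :: real assume x: "\<bar>x\<bar> \<le> 1"
  define g where "g = tanh (2 * \<theta> * x + 0)"
  have "\<bar>x\<bar> ^ 3 / 243 \<le> \<bar>x\<bar> - tanh \<bar>x\<bar>" using x by (intro minus_tanh_ge_cube) auto
  also have "\<dots> \<le> \<bar>x\<bar> - tanh (2 * \<theta> * \<bar>x\<bar>)"
    using assms mult_right_mono[of "2 * \<theta>" 1 "\<bar>x\<bar>"] tanh_mono[of "2 * \<theta> * \<bar>x\<bar>" "\<bar>x\<bar>"] by auto
  also have "tanh (2 * \<theta> * \<bar>x\<bar>) = \<bar>g\<bar>"
    using assms tanh_real_abs[of "2 * \<theta> * x"] by (simp add: g_def abs_mult)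
  also have "\<bar>x\<bar> - \<bar>g\<bar> \<le> \<bar>x - g\<bar>" by linarith
  finally have "(\<bar>x\<bar> ^ 3 / 243)\<^sup>2 \<le> \<bar>x - g\<bar>\<^sup>2" by (intro power_mono) auto
  hence "\<bar>x\<^sup>2 - 0\<^sup>2\<bar> ^ 3 \<le> 243\<^sup>2 * (x - g)\<^sup>2"
    by (simp add: power_divide field_simps flip: power_mult)
  also have "\<dots> \<le> 243\<^sup>2 * ((x - g)\<^sup>2 + (qpot \<theta> 0 x - qpot \<theta> 0 0) ^ 3)" using q[of x] by simp
  finally have *: "\<bar>x\<^sup>2 - 0\<^sup>2\<bar> ^ 3 \<le> 243\<^sup>2 * ((x - g)\<^sup>2 + (qpot \<theta> 0 x - qpot \<theta> 0 0) ^ 3)" .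
  show "\<bar>(tanh (2 * \<theta> * x + 0))\<^sup>2 - 0\<^sup>2\<bar> ^ 3
         \<le> (4 * 243\<^sup>2 + 64) * ((x - tanh (2 * \<theta> * x + 0))\<^sup>2 + (qpot \<theta> 0 x - qpot \<theta> 0 0) ^ 3)"
    using K_bound_from_argument[OF x _ _ _ *] abs_tanh_less[of "2 * \<theta> * x + 0"] q[of x]
    by (simp add: g_def less_imp_le)
qed (use assms in auto)

text \<open>Here x - tanh (2 \<theta> x + \<beta>) has positive derivative D at t, so it vanishes
  linearly there and, by oddness, at - t if \<beta> = 0. The rest of [-1, 1] may contain further
  roots, but none is a global minimizer, so compactness bounds the potential excess below by some c
  > 0.\<close>

lemma two_star_positive:
  assumes \<theta>: "\<theta> > 0" and \<beta>: "\<beta> > 0 \<or> \<beta> = 0 \<and> \<theta> > 1/2"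
    and t: "t > 0" "tanh (2 * \<theta> * t + \<beta>) = (t::real)"
  shows "\<exists>K. two_star \<theta> \<beta> t K"
proof -
  let ?g = "\<lambda>x. tanh (2 * \<theta> * x + \<beta>)"
  let ?q = "\<lambda>x. qpot \<theta> \<beta> x - qpot \<theta> \<beta> t"
  have slope: "2 * \<theta> * (1 - t\<^sup>2) < 1" using fixed_point_slope[OF \<theta> _ t] \<beta> by auto
  have q_pos: "?q x > 0" if "x \<noteq> t" "\<not> (\<beta> = 0 \<and> x = - t)" for x
    using qpot_min[OF \<theta> \<beta> t that] by simp
  have q_nonneg: "?q x \<ge> 0" for x
  proof (cases "x = t \<or> \<beta> = 0 \<and> x = - t")
    case True thus ?thesis using qpot_reflect[of \<theta> \<beta> t] by auto
  next
    case False thus ?thesis using q_pos[of x] by auto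
  qed
  have t1: "t < 1" using t(2) tanh_real_lt_1[of "2 * \<theta> * t + \<beta>"] by simp
  define D where "D = 1 - 2 * \<theta> * (1 - t\<^sup>2)"
  have D: "D > 0" using slope by (simp add: D_def)
  have "((\<lambda>x. x - ?g x) has_real_derivative D) (at t)"
    by (auto intro!: derivative_eq_intros simp: D_def t(2))
  hence "((\<lambda>x. ((x - ?g x) - (t - ?g t)) / (x - t)) \<longlongrightarrow> D) (at t)"
    by (simp add: has_field_derivative_iff)
  hence "eventually (\<lambda>x. ((x - ?g x) - (t - ?g t)) / (x - t) > D / 2) (at t)"
    using D by (intro order_tendstoD(1)) auto
  then obtain \<delta> where \<delta>: "\<delta> > 0"
    "\<And>x. x \<noteq> t \<Longrightarrow> dist x t < \<delta> \<Longrightarrow> ((x - ?g x) - (t - ?g t)) / (x - t) > D / 2"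
    unfolding eventually_at by auto
  have near: "D / 2 * \<bar>x - t\<bar> \<le> \<bar>x - ?g x\<bar>" if "\<bar>x - t\<bar> < \<delta>" for x
  proof (cases "x = t")
    case False
    hence "D / 2 < (x - ?g x) / (x - t)" using \<delta>(2)[of x] that t by (simp add: dist_real_def)
    also have "\<dots> \<le> \<bar>(x - ?g x) / (x - t)\<bar>" by (rule abs_ge_self)
    also have "\<dots> = \<bar>x - ?g x\<bar> / \<bar>x - t\<bar>" by (rule abs_divide)
    finally show ?thesis using False by (simp add: field_simps)
  qed simp
  \<comment> \<open>The mirror point is cut out only for \<beta> = 0; otherwise the potential excess
    at - t is already positive.\<close>
  define S where "S = {x. \<bar>x\<bar> \<le> 1 \<and> \<delta> \<le> \<bar>x - t\<bar> \<and> (\<beta> = 0 \<longrightarrow> \<delta> \<le> \<bar>x + t\<bar>)}"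
  have "\<exists>c>0. \<forall>x\<in>S. c \<le> ?q x"
  proof (cases "S = {}")
    case False
    have S_eq: "S = {-1..1} \<inter> {x. \<delta> \<le> \<bar>x - t\<bar>} \<inter> (if \<beta> = 0 then {x. \<delta> \<le> \<bar>x + t\<bar>} else UNIV)"
      by (auto simp: S_def abs_le_iff)
    have "compact S" unfolding S_eq
      by (intro compact_Int_closed) (auto intro!: closed_Collect_le continuous_intros)
    moreover have "continuous_on S ?q" by (intro continuous_intros qpot_continuous)
    ultimately obtain x where x: "x \<in> S" "\<And>y. y \<in> S \<Longrightarrow> ?q x \<le> ?q y"
      using continuous_attains_inf[of S ?q] False by blast
    have "?q x > 0" using x(1) \<delta>(1) by (intro q_pos) (auto simp: S_def)
    with x(2) show ?thesis by blast
  qed (use zero_less_one in blast)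
  then obtain c where c: "c > 0" "\<And>x. x \<in> S \<Longrightarrow> c \<le> ?q x" by blast
  \<comment> \<open>Near the minimizers \<bar>x + t\<bar>^3 \<bar>x - t\<bar> \<le> 16 and \<bar>x -
    t\<bar> \<le> (2 / D) \<bar>x - g x\<bar>, which gives 16 * 4 = 64. On \<open>S\<close> the left
    side is at most 1, and \<open>1 / c ^ 3\<close> absorbs it.\<close>
  define K0 where "K0 = 64 / D\<^sup>2 + 1 / c ^ 3"
  have K0: "K0 \<ge> 0" using c D by (simp add: K0_def)
  have near': "\<bar>x\<^sup>2 - t\<^sup>2\<bar> ^ 3 \<le> 64 / D\<^sup>2 * (x - ?g x)\<^sup>2" if "\<bar>x\<bar> \<le> 1" "\<bar>x - t\<bar> < \<delta>" for x
  proof -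
    have "\<bar>x\<^sup>2 - t\<^sup>2\<bar> = \<bar>x + t\<bar> * \<bar>x - t\<bar>" by (simp add: power2_eq_square algebra_simps flip: abs_mult)
    hence "\<bar>x\<^sup>2 - t\<^sup>2\<bar> ^ 3 = (\<bar>x + t\<bar> * \<bar>x - t\<bar>) ^ 3" by (simp only:)
    also have "\<dots> = \<bar>x + t\<bar> ^ 3 * \<bar>x - t\<bar> * \<bar>x - t\<bar>\<^sup>2"
      by (simp only: power_mult_distrib power2_eq_square power3_eq_cube mult_ac)
    also have "\<dots> \<le> 2 ^ 3 * 2 * \<bar>x - t\<bar>\<^sup>2"
      using that t t1 by (intro mult_mono power_mono) auto
    also have "\<bar>x - t\<bar>\<^sup>2 \<le> (2 / D * \<bar>x - ?g x\<bar>)\<^sup>2"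
      using near[OF that(2)] D by (intro power_mono) (auto simp: field_simps)
    also have "2 ^ 3 * 2 * (2 / D * \<bar>x - ?g x\<bar>)\<^sup>2 = 64 / D\<^sup>2 * (x - ?g x)\<^sup>2"
      by (simp add: power_mult_distrib power_divide)
    finally show ?thesis by simp
  qed
  have *: "\<bar>x\<^sup>2 - t\<^sup>2\<bar> ^ 3 \<le> K0 * ((x - ?g x)\<^sup>2 + ?q x ^ 3)" if x: "\<bar>x\<bar> \<le> 1" for x
  proof -
    have q3: "?q x ^ 3 \<ge> 0" using q_nonneg[of x] by simp
    consider "\<bar>x - t\<bar> < \<delta>" | "\<beta> = 0" "\<bar>x + t\<bar> < \<delta>" | "x \<in> S" using x by (force simp: S_def)
    thus ?thesis
    proof cases
      case 1
      have "\<bar>x\<^sup>2 - t\<^sup>2\<bar> ^ 3 \<le> 64 / D\<^sup>2 * (x - ?g x)\<^sup>2" using near' x 1 by blast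
      also have "\<dots> \<le> K0 * ((x - ?g x)\<^sup>2 + ?q x ^ 3)"
        using c q3 by (intro mult_mono) (auto simp: K0_def)
      finally show ?thesis .
    next
      case 2
      have "\<bar>(-x)\<^sup>2 - t\<^sup>2\<bar> ^ 3 \<le> 64 / D\<^sup>2 * (-x - ?g (-x))\<^sup>2" using x 2 by (intro near') auto
      also have "(-x - ?g (-x))\<^sup>2 = (x - ?g x)\<^sup>2" using 2 by (simp add: power2_eq_square algebra_simps)
      also have "64 / D\<^sup>2 * (x - ?g x)\<^sup>2 \<le> K0 * ((x - ?g x)\<^sup>2 + ?q x ^ 3)"
        using c q3 by (intro mult_mono) (auto simp: K0_def)
      finally show ?thesis by simp
    next
      case 3
      have "x\<^sup>2 \<le> 1" "t\<^sup>2 \<le> 1" using x t t1 by (auto simp: abs_square_le_1)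
      moreover have "0 \<le> x\<^sup>2" "0 \<le> t\<^sup>2" by simp_all
      ultimately have "\<bar>x\<^sup>2 - t\<^sup>2\<bar> \<le> 1" by linarith
      hence "\<bar>x\<^sup>2 - t\<^sup>2\<bar> ^ 3 \<le> 1" by (intro power_le_one) auto
      also have "1 = 1 / c ^ 3 * c ^ 3" using c by simp
      also have "\<dots> \<le> 1 / c ^ 3 * ?q x ^ 3" using c(1) c(2)[OF 3] by (intro mult_left_mono power_mono) auto
      also have "\<dots> \<le> K0 * ((x - ?g x)\<^sup>2 + ?q x ^ 3)"
        using c D q3 by (intro mult_mono) (auto simp: K0_def)
      finally show ?thesis .
    qed
  qed
  have "two_star \<theta> \<beta> t (4 * K0 + 64)"
  proof
    fix x :: real assume "\<bar>x\<bar> \<le> 1"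
    from K_bound_from_argument[OF this _ K0 _ *[OF this]] abs_tanh_less[of "2 * \<theta> * x + \<beta>"] q_nonneg[of x]
    show "\<bar>(?g x)\<^sup>2 - t\<^sup>2\<bar> ^ 3 \<le> (4 * K0 + 64) * ((x - ?g x)\<^sup>2 + ?q x ^ 3)" by (simp add: less_imp_le)
  qed (use \<theta> t slope q_nonneg in auto)
  thus ?thesis by blast
qed

text \<open>Complementing the graph flips every spin and sends \<beta> to - \<beta> and t to - t.
  The symmetry is used at the level of the potential, to reduce negative \<beta> to
  positive.\<close>

lemma two_star_reflect:
  assumes "two_star \<theta> \<beta> t K"
  shows "two_star \<theta> (- \<beta>) (- t) K"
proof -
  interpret two_star \<theta> \<beta> t K by fact
  have "tanh (2 * \<theta> * (- t) + - \<beta>) = - t"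
    using tanh_minus[of "2 * \<theta> * t + \<beta>"] t_fix by simp
  note t_fix' = this
  show ?thesis
  proof
    fix x :: real assume "\<bar>x\<bar> \<le> 1"
    hence "\<bar>- x\<bar> \<le> 1" by simp
    note * = K_bound[OF this]
    have g: "tanh (2 * \<theta> * (- x) + \<beta>) = - tanh (2 * \<theta> * x + - \<beta>)"
      using tanh_minus[of "2 * \<theta> * x + - \<beta>"] by simp
    show "\<bar>(tanh (2 * \<theta> * x + - \<beta>))\<^sup>2 - (- t)\<^sup>2\<bar> ^ 3
       \<le> K * ((x - tanh (2 * \<theta> * x + - \<beta>))\<^sup>2 + (qpot \<theta> (- \<beta>) x - qpot \<theta> (- \<beta>) (- t)) ^ 3)"
      using * unfolding g qpot_reflect by (simp add: power2_commute add.commute)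
  qed (use \<theta>_pos t_stable q_min t_fix' in \<open>auto simp: qpot_reflect\<close>)
qed

lemma fixed_point_unique:
  assumes \<theta>: "\<theta> > 0" and \<beta>: "\<beta> > 0 \<or> \<beta> = 0 \<and> \<theta> > 1/2"
    and t: "t > 0" "tanh (2 * \<theta> * t + \<beta>) = (t::real)" and x: "x > 0" "tanh (2 * \<theta> * x + \<beta>) = x"
  shows "x = t"
  using fixed_point_sign[OF \<theta> \<beta> t x(1)] x(2) by (cases x t rule: linorder_cases) auto

text \<open>Identifies the root described by \<open>THE\<close> with the one produced by the
  intermediate value theorem; this is where uniqueness is needed.\<close>

lemma two_star_t_locale:
  assumes \<theta>: "\<theta> > 0"
  shows "\<exists>K. two_star \<theta> \<beta> (two_star_t \<theta> \<beta>) K"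
proof -
  consider "\<beta> > 0 \<or> \<beta> = 0 \<and> \<theta> > 1/2" | "\<beta> < 0" | "\<beta> = 0" "\<theta> \<le> 1/2" by linarith
  thus ?thesis
  proof cases
    case 1
    obtain t where t: "t > 0" "tanh (2 * \<theta> * t + \<beta>) = t" using fixed_point_exists[OF \<theta> 1] by blast
    note uniq = fixed_point_unique[OF \<theta> 1 t]
    have "two_star_t \<theta> \<beta> = t"
    proof (cases "\<beta> > 0")
      case True
      have "(THE x. x = tanh (2 * \<theta> * x + \<beta>) \<and> sgn x = sgn \<beta>) = t"
      proof (rule the_equality)
        show "t = tanh (2 * \<theta> * t + \<beta>) \<and> sgn t = sgn \<beta>" using t True by simp
        fix x assume x: "x = tanh (2 * \<theta> * x + \<beta>) \<and> sgn x = sgn \<beta>"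
        have "x > 0" using conjunct2[OF x] True by (simp add: sgn_1_pos)
        thus "x = t" using uniq conjunct1[OF x, symmetric] by blast
      qed
      thus ?thesis using True by (simp add: two_star_t_def)
    next
      case False
      have "(THE x. x = tanh (2 * \<theta> * x) \<and> x > 0) = t"
      proof (rule the_equality)
        show "t = tanh (2 * \<theta> * t) \<and> t > 0" using t 1 False by simp
        fix x assume x: "x = tanh (2 * \<theta> * x) \<and> x > 0"
        have "tanh (2 * \<theta> * x + \<beta>) = x" using conjunct1[OF x, symmetric] 1 False by simp
        thus "x = t" using uniq conjunct2[OF x] by blast
      qed
      thus ?thesis using 1 False by (simp add: two_star_t_def)
    qed
    with two_star_positive[OF \<theta> 1 t] show ?thesis by simp
  next
    case 2
    hence b: "- \<beta> > 0 \<or> - \<beta> = 0 \<and> \<theta> > 1/2" by simp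
    obtain t where t: "t > 0" "tanh (2 * \<theta> * t + - \<beta>) = t" using fixed_point_exists[OF \<theta> b] by blast
    note uniq = fixed_point_unique[OF \<theta> b t]
    have t': "tanh (\<beta> - 2 * \<theta> * t) = - t" using t(2) tanh_minus[of "2 * \<theta> * t + - \<beta>"] by simp
    have "(THE x. x = tanh (2 * \<theta> * x + \<beta>) \<and> sgn x = sgn \<beta>) = - t"
    proof (rule the_equality)
      show "- t = tanh (2 * \<theta> * - t + \<beta>) \<and> sgn (- t) = sgn \<beta>" using t t' 2 by (simp add: algebra_simps)
      fix x assume x: "x = tanh (2 * \<theta> * x + \<beta>) \<and> sgn x = sgn \<beta>"
      have "- x > 0" using conjunct2[OF x] 2 by (simp add: sgn_1_neg)
      moreover have "tanh (2 * \<theta> * (- x) + - \<beta>) = - x"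
        using conjunct1[OF x, symmetric] tanh_minus[of "2 * \<theta> * x + \<beta>"] by simp
      ultimately have "- x = t" by (rule uniq)
      thus "x = - t" by simp
    qed
    hence "two_star_t \<theta> \<beta> = - t" using 2 by (simp add: two_star_t_def)
    with two_star_positive[OF \<theta> b t] two_star_reflect[of \<theta> "- \<beta>" t] show ?thesis by fastforce
  next
    case 3
    hence "two_star_t \<theta> \<beta> = 0" by (simp add: two_star_t_def)
    with two_star_subcritical[OF \<theta>] 3 show ?thesis by auto
  qed
qed

section \<open>The Gaussian mixture measure\<close>

lemma ennreal_gauss_integral:
  fixes a \<mu> :: real assumes a: "a > 0"
  shows "(\<integral>\<^sup>+x. ennreal (exp (- (a * (x - \<mu>)\<^sup>2))) \<partial>lborel) = ennreal (sqrt (pi / a))"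
proof -
  define \<sigma> where "\<sigma> = sqrt (1 / (2 * a))"
  have s2: "\<sigma>\<^sup>2 = 1 / (2 * a)" using a by (simp add: \<sigma>_def)
  have "(\<integral>\<^sup>+x. ennreal (exp (- (a * (x - \<mu>)\<^sup>2))) \<partial>lborel)
      = (\<integral>\<^sup>+x. ennreal (sqrt (pi / a)) * ennreal (normal_density \<mu> \<sigma> x) \<partial>lborel)"
  proof (rule nn_integral_cong)
    fix x
    have "exp (- (a * (x - \<mu>)\<^sup>2)) = sqrt (pi / a) * normal_density \<mu> \<sigma> x"
      using a by (simp add: normal_density_def s2 field_simps)
    thus "ennreal (exp (- (a * (x - \<mu>)\<^sup>2))) = ennreal (sqrt (pi / a)) * ennreal (normal_density \<mu> \<sigma> x)"
      using a by (simp add: ennreal_mult)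
  qed
  also have "\<dots> = ennreal (sqrt (pi / a)) * (\<integral>\<^sup>+x. ennreal (normal_density \<mu> \<sigma> x) \<partial>lborel)"
    by (rule nn_integral_cmult) simp
  also have "(\<integral>\<^sup>+x. ennreal (normal_density \<mu> \<sigma> x) \<partial>lborel) = 1"
  proof -
    have "\<sigma> > 0" using a by (simp add: \<sigma>_def)
    thus ?thesis using nn_integral_eq_integral[of lborel "normal_density \<mu> \<sigma>"] by simp
  qed
  finally show ?thesis by simp
qed

text \<open>m is the average of f, and the bound is Cauchy-Schwarz. It replaces a sum of parabolas
  by a single one, so that the integral over one coordinate becomes Gaussian with a width
  independent of the other coordinates.\<close>

lemma sum_square_shift_ge:
  fixes f :: "'a \<Rightarrow> real"
  assumes "finite I" "I \<noteq> {}"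
  shows "\<exists>m. \<forall>x. real (card I) * (x - m)\<^sup>2 \<le> (\<Sum>j\<in>I. (x - f j)\<^sup>2)"
proof (intro exI allI)
  fix x
  define m where "m = (\<Sum>j\<in>I. f j) / card I"
  have c: "real (card I) > 0" using assms by (simp add: card_gt_0_iff)
  have "(\<Sum>j\<in>I. x - f j) = real (card I) * (x - m)"
    using c by (simp add: sum_subtractf m_def field_simps)
  moreover have "(\<Sum>j\<in>I. x - f j)\<^sup>2 \<le> (\<Sum>j\<in>I. (x - f j)\<^sup>2) * card I"
    using sum_squared_le_sum_of_squares[of "\<lambda>j. x - f j" I] assms by simp
  ultimately have "real (card I) * (real (card I) * (x - m)\<^sup>2) \<le> real (card I) * (\<Sum>j\<in>I. (x - f j)\<^sup>2)"
    by (simp add: power2_eq_square mult_ac)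
  thus "real (card I) * (x - m)\<^sup>2 \<le> (\<Sum>j\<in>I. (x - f j)\<^sup>2)"
    using c by simp
qed

lemma power_le_exp_fact:
  assumes x: "x \<ge> (0::real)"
  shows "x ^ n \<le> exp x * fact n"
proof -
  have "x ^ n / fact n \<le> (\<Sum>k. x ^ k / fact k)"
  proof (rule order.trans[OF _ sum_le_suminf[of _ "{n}"]])
    show "summable (\<lambda>k. x ^ k / fact k)"
      using summable_exp[of x] by (simp add: field_simps)
  qed (use x in auto)
  also have "\<dots> = exp x" unfolding exp_def by (simp add: divide_inverse mult.commute)
  finally show ?thesis by (simp add: field_simps)
qed

text \<open>Finiteness of x is what permits subtracting half of it in
  \<open>ennreal\<close>.\<close>

lemma ennreal_half_absorb:
  fixes x a :: ennreal
  assumes "x \<le> a + ennreal (1/2) * x" "x < top"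
  shows "x \<le> 2 * a"
proof (cases a)
  case (real b)
  obtain r where r: "x = ennreal r" "r \<ge> 0" using assms(2) by (cases x) auto
  have "ennreal r \<le> ennreal b + ennreal (1/2) * ennreal r"
    using assms(1) unfolding r real .
  also have "\<dots> = ennreal (b + 1/2 * r)"
    using r(2) real by (simp only: ennreal_plus ennreal_mult mult_nonneg_nonneg zero_le_divide_1_iff zero_le_numeral)
  finally have "ennreal r \<le> ennreal (b + 1/2 * r)" .
  moreover have "0 \<le> b + 1/2 * r" using real r(2) by simp
  ultimately have "r \<le> b + 1/2 * r" using ennreal_le_iff by blast
  hence "r \<le> 2 * b" by simp
  hence "ennreal r \<le> ennreal (2 * b)" by (rule ennreal_leI)
  thus ?thesis unfolding r real using real by (simp add: ennreal_mult)
qed (simp add: ennreal_mult_top)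

lemma borel_measurable_lncosh [measurable]: "lncosh \<in> borel_measurable borel"
  using lncosh_continuous[OF continuous_on_id, of UNIV] by (intro borel_measurable_continuous_onI)

interpretation PL: product_sigma_finite "\<lambda>_. lborel :: real measure"
  by standard

context two_star
begin

definition Qt :: "real \<Rightarrow> real" where
  "Qt x = qpot \<theta> \<beta> x - qpot \<theta> \<beta> t"

definition h :: "real \<Rightarrow> real \<Rightarrow> real" where
  "h x y = \<theta> / 2 * (x\<^sup>2 + y\<^sup>2) - lncosh (\<theta> * (x + y) + \<beta>) - qpot \<theta> \<beta> t"

lemma Qt_nonneg: "Qt x \<ge> 0"
  using q_min by (simp add: Qt_def)

lemma h_commute: "h x y = h y x"
  by (simp add: h_def add.commute)

text \<open>The parallelogram identity splits the quadratic part into a difference and a midpoint.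
  In this form nonnegativity and the control of x - y are immediate.\<close>

lemma h_eq: "h x y = \<theta> / 4 * (x - y)\<^sup>2 + Qt ((x + y) / 2)"
proof -
  have "2 * \<theta> * ((x + y) / 2) + \<beta> = \<theta> * (x + y) + \<beta>" by simp
  thus ?thesis unfolding h_def Qt_def qpot_def
    by (simp only:) (simp add: power2_eq_square field_simps)
qed

lemma h_ge: "\<theta> / 4 * (x - y)\<^sup>2 \<le> h x y"
  using Qt_nonneg by (simp add: h_eq)

lemma h_nonneg: "h x y \<ge> 0"
  using order.trans[OF _ h_ge] \<theta>_pos by simp

lemma h_self: "h x x = Qt x"
  by (simp add: h_eq)

text \<open>In its first argument h is a nonnegative parabola minus a shifted \<open>lncosh\<close>,
  with curvature at most \<theta>. Moving a coordinate therefore costs a factor 2 and a quadratic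
  term, wherever the coordinate is.\<close>

lemma h_shift: "h x y \<le> 2 * h x' y + \<theta> * (x - x')\<^sup>2"
proof -
  have *: "h x y = \<theta> / 2 * x\<^sup>2 - lncosh (\<theta> * x + (\<theta> * y + \<beta>)) - (qpot \<theta> \<beta> t - \<theta> / 2 * y\<^sup>2)" for x
    by (simp add: h_def algebra_simps)
  show ?thesis
    using quadratic_lncosh_shift[OF \<theta>_pos, of "\<theta> * y + \<beta>" "qpot \<theta> \<beta> t - \<theta> / 2 * y\<^sup>2" x x']
      h_nonneg[of _ y] unfolding * by blast
qed

lemma Qt_shift: "Qt x \<le> 2 * Qt y + 2 * \<theta> * (x - y)\<^sup>2"
proof -
  have *: "Qt x = (2 * \<theta>) / 2 * x\<^sup>2 - lncosh ((2 * \<theta>) * x + \<beta>) - qpot \<theta> \<beta> t" for x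
    by (simp add: Qt_def qpot_def)
  show ?thesis
    using quadratic_lncosh_shift[of "2 * \<theta>" \<beta> "qpot \<theta> \<beta> t" x y] Qt_nonneg \<theta>_pos
    unfolding * by simp
qed

text \<open>Moving y to x by \<open>h_shift\<close> costs a factor 2 plus \<theta> (x - y)^2, and
  the latter is at most 4 h x y by \<open>h_ge\<close>.\<close>

lemma Qt_le_h: "Qt x \<le> 6 * h x y"
  using h_shift[of x x y] h_ge[of x y] by (simp add: h_self h_commute[of y x])

lemma h_shift2: "h x y \<le> 4 * h x' y' + \<theta> * (x - x')\<^sup>2 + 2 * \<theta> * (y - y')\<^sup>2"
  using h_shift[of x y x'] h_shift[of y x' y'] by (simp add: h_commute)

lemma h_box: "\<bar>x - t\<bar> \<le> \<delta> \<Longrightarrow> \<bar>y - t\<bar> \<le> \<delta> \<Longrightarrow> h x y \<le> 3 * \<theta> * \<delta>\<^sup>2"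
proof -
  assume "\<bar>x - t\<bar> \<le> \<delta>" "\<bar>y - t\<bar> \<le> \<delta>"
  hence "(x - t)\<^sup>2 \<le> \<delta>\<^sup>2" "(y - t)\<^sup>2 \<le> \<delta>\<^sup>2" by (simp_all add: abs_le_square_iff[symmetric])
  hence "\<theta> * (x - t)\<^sup>2 \<le> \<theta> * \<delta>\<^sup>2" "\<theta> * (y - t)\<^sup>2 \<le> \<theta> * \<delta>\<^sup>2" using \<theta>_pos by simp_all
  thus ?thesis using h_shift2[of x y t t] by (simp add: h_self Qt_def)
qed

text \<open>Linear growth of \<open>lncosh\<close> against the parabola gives coercivity in both
  variables, whereas \<open>h_ge\<close> says nothing along x = y. This makes the partition function
  of two coordinates finite.\<close>

lemma h_lower: "\<theta> / 4 * (x\<^sup>2 + y\<^sup>2) - (2 * \<theta> + \<bar>\<beta>\<bar> + qpot \<theta> \<beta> t) \<le> h x y"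
proof -
  have *: "\<bar>x\<bar> \<le> x\<^sup>2 / 4 + 1" for x :: real
    using zero_le_power2[of "\<bar>x\<bar> / 2 - 1"] by (simp add: power2_eq_square algebra_simps)
  have "lncosh (\<theta> * (x + y) + \<beta>) \<le> \<bar>\<theta> * (x + y) + \<beta>\<bar>" by (rule lncosh_le_abs)
  also have "\<dots> \<le> \<theta> * \<bar>x + y\<bar> + \<bar>\<beta>\<bar>" using abs_triangle_ineq[of "\<theta> * (x + y)" \<beta>] \<theta>_pos by (simp add: abs_mult)
  also have "\<theta> * \<bar>x + y\<bar> \<le> \<theta> * ((x\<^sup>2 / 4 + 1) + (y\<^sup>2 / 4 + 1))"
    using *[of x] *[of y] \<theta>_pos by (intro mult_left_mono) auto
  finally show ?thesis by (simp add: h_def algebra_simps)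
qed

lemma h_measurable [measurable (raw)]:
  assumes [measurable]: "f \<in> borel_measurable M" "g \<in> borel_measurable M"
  shows "(\<lambda>x. h (f x) (g x)) \<in> borel_measurable M"
  unfolding h_def by measurable

section \<open>Partition functions over varying sets of coordinates\<close>

definition pair_energy :: "nat set \<Rightarrow> (nat \<Rightarrow> real) \<Rightarrow> real" where
  "pair_energy I \<phi> = (\<Sum>i\<in>I. \<Sum>j\<in>I - {i}. h (\<phi> i) (\<phi> j)) / 2"

text \<open>\<open>s\<close> acts as an inverse temperature: 1 is the measure of interest, and 1/2
  yields exponential moments of the energy. Index sets are arbitrary so that coordinates can be
  added one at a time.\<close>

definition Z :: "nat set \<Rightarrow> real \<Rightarrow> ennreal" where
  "Z I s = (\<integral>\<^sup>+\<phi>. ennreal (exp (- (s * pair_energy I \<phi>))) \<partial>PiM I (\<lambda>_. lborel))"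

lemma pair_energy_nonneg: "pair_energy I \<phi> \<ge> 0"
  unfolding pair_energy_def by (intro divide_nonneg_pos sum_nonneg h_nonneg) auto

lemma pair_energy_insert:
  assumes "finite I" "k \<notin> I"
  shows "pair_energy (insert k I) \<phi> = pair_energy I \<phi> + (\<Sum>j\<in>I. h (\<phi> k) (\<phi> j))"
proof -
  have "(\<Sum>i\<in>I. \<Sum>j\<in>insert k I - {i}. h (\<phi> i) (\<phi> j)) = (\<Sum>i\<in>I. h (\<phi> i) (\<phi> k) + (\<Sum>j\<in>I - {i}. h (\<phi> i) (\<phi> j)))"
  proof (rule sum.cong)
    fix i assume "i \<in> I"
    hence "insert k I - {i} = insert k (I - {i})" using assms by auto
    thus "(\<Sum>j\<in>insert k I - {i}. h (\<phi> i) (\<phi> j)) = h (\<phi> i) (\<phi> k) + (\<Sum>j\<in>I - {i}. h (\<phi> i) (\<phi> j))"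
      using assms by simp
  qed simp
  moreover have "insert k I - {k} = I" using assms by auto
  ultimately show ?thesis using assms
    by (simp add: pair_energy_def sum.distrib h_commute[of "\<phi> k"] add_divide_distrib)
qed

lemma pair_energy_upd [simp]: "k \<notin> I \<Longrightarrow> pair_energy I (\<phi>(k := x)) = pair_energy I \<phi>"
  unfolding pair_energy_def by (intro arg_cong[of _ _ "\<lambda>x. x / 2"] sum.cong refl) auto


lemma pair_energy_measurable [measurable]: "I \<subseteq> J \<Longrightarrow> pair_energy I \<in> borel_measurable (PiM J (\<lambda>_. lborel))"
  unfolding pair_energy_def [abs_def]
proof (intro borel_measurable_divide borel_measurable_sum h_measurable borel_measurable_const)
  have *: "(\<lambda>\<phi>. \<phi> i :: real) \<in> borel_measurable (PiM J (\<lambda>_. lborel))" if "i \<in> J" for i :: nat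
    using measurable_component_singleton[OF that, of "\<lambda>_. lborel :: real measure"] by simp
  show "(\<lambda>\<phi>. \<phi> i :: real) \<in> borel_measurable (PiM J (\<lambda>_. lborel))" if "I \<subseteq> J" "i \<in> I" for i :: nat
    using * that by blast
  show "(\<lambda>\<phi>. \<phi> j :: real) \<in> borel_measurable (PiM J (\<lambda>_. lborel))" if "I \<subseteq> J" "j \<in> I - {i}" for i j :: nat
    using * that by blast
qed

lemma star_measurable:
  "k \<in> J \<Longrightarrow> I \<subseteq> J \<Longrightarrow> (\<lambda>\<phi>. \<Sum>j\<in>I. h (\<phi> k) (\<phi> j)) \<in> borel_measurable (PiM J (\<lambda>_. lborel))"
  using measurable_component_singleton[of _ J "\<lambda>_. lborel :: real measure"]
  by (intro borel_measurable_sum h_measurable) auto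

text \<open>The difference part of h alone confines a new coordinate, uniformly in the positions of
  the others, to a Gaussian of width of order \<open>1 / sqrt (card I)\<close>.\<close>

lemma star_integral_le:
  assumes I: "finite I" "I \<noteq> {}" and s: "s > 0"
  shows "(\<integral>\<^sup>+x. ennreal (exp (- (s * (\<Sum>j\<in>I. h x (\<phi> j))))) \<partial>lborel) \<le> ennreal (sqrt (4 * pi / (s * \<theta> * card I)))"
proof -
  from sum_square_shift_ge[OF I, of \<phi>]
  obtain m where m: "\<And>x. real (card I) * (x - m)\<^sup>2 \<le> (\<Sum>j\<in>I. (x - \<phi> j)\<^sup>2)" by blast
  have c: "real (card I) > 0" using I by (simp add: card_gt_0_iff)
  have "(\<integral>\<^sup>+x. ennreal (exp (- (s * (\<Sum>j\<in>I. h x (\<phi> j))))) \<partial>lborel)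
        \<le> (\<integral>\<^sup>+x. ennreal (exp (- ((s * \<theta> * card I / 4) * (x - m)\<^sup>2))) \<partial>lborel)"
  proof (intro nn_integral_mono ennreal_leI, simp only: exp_le_cancel_iff neg_le_iff_le)
    fix x
    have "(s * \<theta> * card I / 4) * (x - m)\<^sup>2 = s * (\<theta> / 4 * (real (card I) * (x - m)\<^sup>2))" by simp
    also have "\<dots> \<le> s * (\<theta> / 4 * (\<Sum>j\<in>I. (x - \<phi> j)\<^sup>2))"
      using m[of x] s \<theta>_pos by (intro mult_left_mono) auto
    also have "\<dots> \<le> s * (\<Sum>j\<in>I. h x (\<phi> j))"
      unfolding sum_distrib_left[of "\<theta> / 4"] using s by (intro mult_left_mono sum_mono h_ge) auto
    finally show "(s * \<theta> * card I / 4) * (x - m)\<^sup>2 \<le> s * (\<Sum>j\<in>I. h x (\<phi> j))" .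
  qed
  also have "\<dots> = ennreal (sqrt (pi / (s * \<theta> * card I / 4)))"
    using s \<theta>_pos c by (intro ennreal_gauss_integral) auto
  finally show ?thesis by (simp add: field_simps)
qed

lemma Z_insert:
  assumes I: "finite I" "k \<notin> I"
  shows "Z (insert k I) s = (\<integral>\<^sup>+\<phi>. ennreal (exp (- (s * pair_energy I \<phi>))) *
     (\<integral>\<^sup>+x. ennreal (exp (- (s * (\<Sum>j\<in>I. h x (\<phi> j))))) \<partial>lborel) \<partial>PiM I (\<lambda>_. lborel))"
proof -
  have "Z (insert k I) s = (\<integral>\<^sup>+\<phi>. (\<integral>\<^sup>+x. ennreal (exp (- (s * pair_energy (insert k I) (\<phi>(k := x))))) \<partial>lborel) \<partial>PiM I (\<lambda>_. lborel))"
    unfolding Z_def by (subst PL.product_nn_integral_insert[OF I]) measurable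
  also have "\<dots> = (\<integral>\<^sup>+\<phi>. ennreal (exp (- (s * pair_energy I \<phi>))) *
     (\<integral>\<^sup>+x. ennreal (exp (- (s * (\<Sum>j\<in>I. h x (\<phi> j))))) \<partial>lborel) \<partial>PiM I (\<lambda>_. lborel))"
  proof (intro nn_integral_cong)
    fix \<phi> :: "nat \<Rightarrow> real"
    have "(\<Sum>j\<in>I. h x ((\<phi>(k := x)) j)) = (\<Sum>j\<in>I. h x (\<phi> j))" for x
      using I by (intro sum.cong) auto
    hence "ennreal (exp (- (s * pair_energy (insert k I) (\<phi>(k := x)))))
      = ennreal (exp (- (s * pair_energy I \<phi>))) * ennreal (exp (- (s * (\<Sum>j\<in>I. h x (\<phi> j)))))" for x
      using I by (simp add: pair_energy_insert distrib_left flip: ennreal_mult exp_add)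
    thus "(\<integral>\<^sup>+x. ennreal (exp (- (s * pair_energy (insert k I) (\<phi>(k := x))))) \<partial>lborel)
      = ennreal (exp (- (s * pair_energy I \<phi>))) * (\<integral>\<^sup>+x. ennreal (exp (- (s * (\<Sum>j\<in>I. h x (\<phi> j))))) \<partial>lborel)"
      by (simp add: nn_integral_cmult)
  qed
  finally show ?thesis .
qed

lemma Z_insert_le:
  assumes I: "finite I" "k \<notin> I" "I \<noteq> {}" and s: "s > 0"
  shows "Z (insert k I) s \<le> ennreal (sqrt (4 * pi / (s * \<theta> * card I))) * Z I s"
proof -
  have "Z (insert k I) s \<le> (\<integral>\<^sup>+\<phi>. ennreal (exp (- (s * pair_energy I \<phi>))) *
          ennreal (sqrt (4 * pi / (s * \<theta> * card I))) \<partial>PiM I (\<lambda>_. lborel))"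
    unfolding Z_insert[OF I(1,2)]
    by (intro nn_integral_mono mult_left_mono star_integral_le I s) auto
  also have "\<dots> = Z I s * ennreal (sqrt (4 * pi / (s * \<theta> * card I)))"
    unfolding Z_def by (rule nn_integral_multc) measurable
  finally show ?thesis by (simp add: mult.commute)
qed

text \<open>Two coordinates are the smallest possible start of an induction: a single one has zero
  energy and an infinite partition function.\<close>

lemma Z_pair_finite:
  assumes s: "s > 0"
  shows "\<exists>B\<ge>0. \<forall>a b. a \<noteq> b \<longrightarrow> Z {a, b} s \<le> ennreal B"
proof -
  define c where "c = 2 * \<theta> + \<bar>\<beta>\<bar> + qpot \<theta> \<beta> t"
  define g where "g = (\<lambda>x::real. ennreal (exp (- ((s * \<theta> / 4) * (x - 0)\<^sup>2))))"
  have g: "integral\<^sup>N lborel g = ennreal (sqrt (pi / (s * \<theta> / 4)))"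
    unfolding g_def using s \<theta>_pos by (intro ennreal_gauss_integral) auto
  have gm: "g \<in> borel_measurable lborel" unfolding g_def by measurable
  have "Z {a, b} s \<le> ennreal (exp (s * c) * (sqrt (pi / (s * \<theta> / 4)))\<^sup>2)" if ab: "a \<noteq> b" for a b
  proof -
    have HI_ab: "pair_energy {a, b} \<phi> = h (\<phi> a) (\<phi> b)" for \<phi>
      using pair_energy_insert[of "{b}" a \<phi>] ab by (simp add: pair_energy_def)
    have "Z {a, b} s \<le> (\<integral>\<^sup>+\<phi>. ennreal (exp (s * c)) * (\<Prod>i\<in>{a, b}. g (\<phi> i)) \<partial>PiM {a, b} (\<lambda>_. lborel))"
      unfolding Z_def
    proof (intro nn_integral_mono)
      fix \<phi> :: "nat \<Rightarrow> real"
      have "s * (\<theta> / 4 * ((\<phi> a)\<^sup>2 + (\<phi> b)\<^sup>2) - c) \<le> s * pair_energy {a, b} \<phi>"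
        unfolding HI_ab c_def using s by (intro mult_left_mono h_lower) auto
      hence "exp (- (s * pair_energy {a, b} \<phi>)) \<le> exp (s * c + (- ((s * \<theta> / 4) * (\<phi> a - 0)\<^sup>2) + - ((s * \<theta> / 4) * (\<phi> b - 0)\<^sup>2)))"
        by (subst exp_le_cancel_iff) (simp add: algebra_simps)
      hence "ennreal (exp (- (s * pair_energy {a, b} \<phi>))) \<le> ennreal (exp (s * c + (- ((s * \<theta> / 4) * (\<phi> a - 0)\<^sup>2) + - ((s * \<theta> / 4) * (\<phi> b - 0)\<^sup>2))))"
        by (rule ennreal_leI)
      also have "\<dots> = ennreal (exp (s * c)) * (\<Prod>i\<in>{a, b}. g (\<phi> i))"
        unfolding exp_add using ab by (simp add: g_def ennreal_mult)
      finally show "ennreal (exp (- (s * pair_energy {a, b} \<phi>))) \<le> ennreal (exp (s * c)) * (\<Prod>i\<in>{a, b}. g (\<phi> i))" .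
    qed
    also have "\<dots> = ennreal (exp (s * c)) * (\<integral>\<^sup>+\<phi>. (\<Prod>i\<in>{a, b}. g (\<phi> i)) \<partial>PiM {a, b} (\<lambda>_. lborel))"
      using gm measurable_component_singleton[of _ "{a, b}" "\<lambda>_. lborel :: real measure"]
      by (intro nn_integral_cmult borel_measurable_prod) (auto intro: measurable_compose)
    also have "(\<integral>\<^sup>+\<phi>. (\<Prod>i\<in>{a, b}. g (\<phi> i)) \<partial>PiM {a, b} (\<lambda>_. lborel)) = (\<Prod>i\<in>{a, b}. integral\<^sup>N lborel g)"
      using gm by (intro PL.product_nn_integral_prod) auto
    also have "(\<Prod>i\<in>{a, b}. integral\<^sup>N lborel g) = ennreal ((sqrt (pi / (s * \<theta> / 4)))\<^sup>2)"
      unfolding g using ab s \<theta>_pos by (simp add: power2_eq_square ennreal_mult del: real_sqrt_mult_self flip: ennreal_mult)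
    finally show ?thesis by (simp only: ennreal_mult'' exp_ge_zero zero_le_power2)
  qed
  moreover have "exp (s * c) * (sqrt (pi / (s * \<theta> / 4)))\<^sup>2 \<ge> 0" by simp
  ultimately show ?thesis by blast
qed

text \<open>Iterating \<open>Z_insert_le\<close> from a pair multiplies the factors
  \<open>G / sqrt j\<close> for j = 2, ..., n - 1, whence the factorial. The constant 8 * pi /
  \<theta> is 4 * pi / (s * \<theta>) at s = 1/2.\<close>

lemma Z_half_le:
  "\<exists>B\<ge>0. \<forall>I. finite I \<and> card I \<ge> 2 \<longrightarrow>
     Z I (1/2) \<le> ennreal (B * sqrt (8 * pi / \<theta>) ^ card I / sqrt (fact (card I - 1)))"
proof -
  define G where "G = sqrt (8 * pi / \<theta>)"
  have G: "G > 0" using \<theta>_pos by (simp add: G_def)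
  obtain B where B: "B \<ge> 0" "\<And>a b. a \<noteq> b \<Longrightarrow> Z {a, b} (1/2) \<le> ennreal B"
    using Z_pair_finite[of "1/2"] by auto
  define B' where "B' = B / G\<^sup>2"
  have "Z I (1/2) \<le> ennreal (B' * G ^ n / sqrt (fact (n - 1)))" if "n \<ge> 2" "finite I" "card I = n" for n I
    using that
  proof (induction n arbitrary: I rule: dec_induct)
    case base
    then obtain a b where "I = {a, b}" "a \<noteq> b" by (auto simp: card_2_iff)
    with B(2)[of a b] G show ?case by (simp add: B'_def)
  next
    case (step n)
    then obtain k J where J: "I = insert k J" "k \<notin> J" "card J = n" "finite J"
      by (metis card_Suc_eq finite_insert)
    have "Z I (1/2) \<le> ennreal (sqrt (4 * pi / (1/2 * \<theta> * card J))) * Z J (1/2)"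
      unfolding J(1) by (rule Z_insert_le) (use J(2-4) step(1) in \<open>auto simp: card_eq_0_iff\<close>)
    also have "4 * pi / (1/2 * \<theta> * card J) = 8 * pi / \<theta> / n" unfolding J(3) by simp
    also have "sqrt \<dots> = G / sqrt n" by (simp add: G_def real_sqrt_divide real_sqrt_mult)
    also have "ennreal (G / sqrt n) * Z J (1/2) \<le> ennreal (G / sqrt n) * ennreal (B' * G ^ n / sqrt (fact (n - 1)))"
      using J step by (intro mult_left_mono) auto
    also have "\<dots> = ennreal ((G / sqrt n) * (B' * G ^ n / sqrt (fact (n - 1))))"
      using G B by (subst ennreal_mult) (auto simp: B'_def)
    also have "(G / sqrt n) * (B' * G ^ n / sqrt (fact (n - 1))) = B' * G ^ Suc n / sqrt (fact (Suc n - 1))"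
    proof -
      have "(fact n :: real) = real n * fact (n - 1)" by (rule fact_reduce) (use step(1) in simp)
      thus ?thesis by (simp add: real_sqrt_mult field_simps)
    qed
    finally show ?case .
  qed
  moreover have "B' \<ge> 0" using B by (simp add: B'_def)
  ultimately show ?thesis unfolding G_def by blast
qed

text \<open>In the box of half-width \<open>1 / sqrt n\<close> around t each of the about n^2 / 2
  pairs has energy O(1 / n), so the total is O(n). The volume n^(-n/2) of the box, up to exponential
  factors, matches the upper bound \<open>Z_half_le\<close>.\<close>

lemma Z_one_ge:
  assumes I: "finite I" "card I = n" "n > 0"
  shows "ennreal (exp (- (2 * \<theta> * n)) * (2 / sqrt n) ^ n) \<le> Z I 1"
proof -
  define A where "A = (\<Pi>\<^sub>E i\<in>I. {t - 1 / sqrt n .. t + 1 / sqrt n})"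
  have A: "A \<in> sets (PiM I (\<lambda>_. lborel))" unfolding A_def using I by (intro sets_PiM_I_finite) auto
  have "emeasure (PiM I (\<lambda>_. lborel)) A = (\<Prod>i\<in>I. emeasure lborel {t - 1 / sqrt n .. t + 1 / sqrt n})"
    unfolding A_def using I by (intro PL.emeasure_PiM) auto
  also have "\<dots> = ennreal (2 / sqrt n) ^ n" using I by simp
  finally have eA: "emeasure (PiM I (\<lambda>_. lborel)) A = ennreal ((2 / sqrt n) ^ n)" by (simp add: ennreal_power)
  have H: "pair_energy I \<phi> \<le> 2 * \<theta> * n" if "\<phi> \<in> A" for \<phi>
  proof -
    have b: "\<bar>\<phi> i - t\<bar> \<le> 1 / sqrt n" if "i \<in> I" for i
      using PiE_mem[OF \<open>\<phi> \<in> A\<close>[unfolded A_def] that] by (auto simp: abs_le_iff)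
    have "(\<Sum>i\<in>I. \<Sum>j\<in>I - {i}. h (\<phi> i) (\<phi> j)) \<le> (\<Sum>i\<in>I. \<Sum>j\<in>I - {i}. 3 * \<theta> * (1 / sqrt n)\<^sup>2)"
      using b by (intro sum_mono h_box) auto
    also have "\<dots> = (\<Sum>i\<in>I. \<Sum>j\<in>I - {i}. 3 * \<theta> / n)" using I by (simp add: power_divide)
    also have "\<dots> \<le> (\<Sum>i\<in>I. \<Sum>j\<in>I. 3 * \<theta> / n)"
      using I \<theta>_pos by (intro sum_mono sum_mono2) auto
    also have "\<dots> = 3 * \<theta> * n" using I by simp
    finally have "pair_energy I \<phi> \<le> 3 / 2 * (\<theta> * n)" by (simp add: pair_energy_def)
    also have "\<dots> \<le> 2 * (\<theta> * n)" using \<theta>_pos by (intro mult_right_mono) auto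
    finally show ?thesis by simp
  qed
  have "ennreal (exp (- (2 * \<theta> * n))) * emeasure (PiM I (\<lambda>_. lborel)) A
     = (\<integral>\<^sup>+\<phi>. ennreal (exp (- (2 * \<theta> * n))) * indicator A \<phi> \<partial>PiM I (\<lambda>_. lborel))"
    using A by (simp add: nn_integral_cmult_indicator)
  also have "\<dots> \<le> Z I 1" unfolding Z_def
    by (intro nn_integral_mono) (use H in \<open>auto split: split_indicator intro!: ennreal_leI\<close>)
  finally show ?thesis unfolding eA by (simp add: ennreal_mult)
qed

text \<open>Both bounds are n^(-n/2) up to exponential factors. Instead of Stirling's formula, n^n
  \<le> e^n n! suffices, and the extra n in n! = n (n - 1)! is absorbed by another e^n.\<close>

lemma Z_half_le_Z_one:
  "\<exists>\<Gamma>\<ge>1. \<forall>I. finite I \<and> card I \<ge> 2 \<longrightarrow> Z I (1/2) \<le> ennreal (\<Gamma> ^ card I) * Z I 1 \<and> Z I 1 < top"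
proof -
  define G where "G = sqrt (8 * pi / \<theta>)"
  have G: "G > 0" using \<theta>_pos by (simp add: G_def)
  obtain B where B: "B \<ge> 0" "\<And>I. finite I \<Longrightarrow> card I \<ge> 2 \<Longrightarrow>
     Z I (1/2) \<le> ennreal (B * G ^ card I / sqrt (fact (card I - 1)))"
    using Z_half_le unfolding G_def by blast
  define \<Gamma> where "\<Gamma> = max 1 (max 1 B * G * exp 1 * exp (2 * \<theta>))"
  have \<Gamma>: "\<Gamma> \<ge> 1" by (simp add: \<Gamma>_def)
  have "Z I (1/2) \<le> ennreal (\<Gamma> ^ n) * Z I 1 \<and> Z I 1 < top" if I: "finite I" "card I = n" "n \<ge> 2" for I n
  proof
    have B1: "Z I (1/2) \<le> ennreal (B * G ^ n / sqrt (fact (n - 1)))" using B(2)[of I] I by simp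
    have "Z I 1 \<le> Z I (1/2)" unfolding Z_def
      using pair_energy_nonneg by (intro nn_integral_mono ennreal_leI) simp
    also have "\<dots> < top" using B1 by (rule order.strict_trans1) simp
    finally show "Z I 1 < top" .
    have fact_pos: "(fact (n - 1) :: real) > 0" by simp
    have "real n ^ n \<le> exp n * (n * fact (n - 1))"
      using power_le_exp_fact[of "real n" n] fact_reduce[of n, where ?'a = real] I by simp
    also have "\<dots> \<le> exp n * (exp n * fact (n - 1))"
      using exp_ge_add_one_self[of "real n"] by (intro mult_left_mono mult_right_mono) (auto simp: add_increasing intro: order.trans[of _ "1 + real n"])
    finally have "real n ^ n \<le> exp n * (exp n * fact (n - 1))" .
    hence "sqrt (real n ^ n) \<le> sqrt ((exp n)\<^sup>2 * fact (n - 1))"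
      by (simp add: power2_eq_square mult_ac)
    hence n1: "sqrt n ^ n \<le> exp n * sqrt (fact (n - 1))"
      by (simp add: real_sqrt_mult real_sqrt_power)
    have "B * G ^ n / sqrt (fact (n - 1)) \<le> max 1 B ^ n * G ^ n * (exp n / sqrt n ^ n)"
    proof -
      have "B \<le> max 1 B ^ 1" by simp
      also have "\<dots> \<le> max 1 B ^ n" using I by (intro power_increasing) auto
      finally have "B * G ^ n \<le> max 1 B ^ n * G ^ n" using G by (intro mult_right_mono) auto
      moreover have "1 / sqrt (fact (n - 1)) \<le> exp n / sqrt n ^ n"
        using n1 I by (simp add: field_simps)
      ultimately have "(B * G ^ n) * (1 / sqrt (fact (n - 1))) \<le> (max 1 B ^ n * G ^ n) * (exp n / sqrt n ^ n)"
        using G by (intro mult_mono) auto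
      thus ?thesis by simp
    qed
    \<comment> \<open>The factor \<open>2 ^ n\<close> is inserted to match the volume
      \<open>(2 / sqrt n) ^ n\<close> in \<open>Z_one_ge\<close>.\<close>
    also have "\<dots> \<le> (max 1 B ^ n * G ^ n) * (exp n / sqrt n ^ n) * 2 ^ n"
      using G mult_left_mono[of 1 "2 ^ n" "(max 1 B ^ n * G ^ n) * (exp n / sqrt n ^ n)"] by simp
    also have "\<dots> = (max 1 B * G * exp 1 * exp (2 * \<theta>)) ^ n * (exp (- (2 * \<theta> * n)) * (2 / sqrt n) ^ n)"
      by (simp add: power_mult_distrib power_divide exp_minus mult_ac flip: exp_of_nat_mult)
    also have "\<dots> \<le> \<Gamma> ^ n * (exp (- (2 * \<theta> * n)) * (2 / sqrt n) ^ n)"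
      using G by (intro mult_right_mono power_mono) (auto simp: \<Gamma>_def)
    finally have "ennreal (B * G ^ n / sqrt (fact (n - 1))) \<le> ennreal (\<Gamma> ^ n) * ennreal (exp (- (2 * \<theta> * n)) * (2 / sqrt n) ^ n)"
      using \<Gamma> by (simp add: ennreal_leI flip: ennreal_mult)
    also have "\<dots> \<le> ennreal (\<Gamma> ^ n) * Z I 1"
      using I by (intro mult_left_mono Z_one_ge) auto
    finally show "Z I (1/2) \<le> ennreal (\<Gamma> ^ n) * Z I 1" using B1 by order
  qed
  thus ?thesis using \<Gamma> by (intro exI[of _ \<Gamma>]) auto
qed


text \<open>A Chernoff bound: where the energy exceeds K n, the weight is at most e^(- K n / 2)
  times the weight at s = 1/2. With K = 2 ln (2 \<Gamma>) this beats the ratio \<Gamma>^n of the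
  partition functions and leaves at most half of the mass.\<close>

lemma pair_energy_tail:
  "\<exists>K>(0::real). \<forall>I. finite I \<and> card I \<ge> 2 \<longrightarrow> Z I 1 \<le> 2 *
     (\<integral>\<^sup>+\<phi>. ennreal (exp (- pair_energy I \<phi>)) * indicator {\<phi>. pair_energy I \<phi> \<le> K * card I} \<phi> \<partial>PiM I (\<lambda>_. lborel))"
proof -
  obtain \<Gamma> where \<Gamma>: "\<Gamma> \<ge> 1"
    "\<And>I. finite I \<Longrightarrow> card I \<ge> 2 \<Longrightarrow> Z I (1/2) \<le> ennreal (\<Gamma> ^ card I) * Z I 1"
    "\<And>I. finite I \<Longrightarrow> card I \<ge> 2 \<Longrightarrow> Z I 1 < top"
    using Z_half_le_Z_one by blast
  define K where "K = 2 * ln (2 * \<Gamma>)"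
  have K: "K > 0" using \<Gamma>(1) by (simp add: K_def ln_gt_zero)
  have "Z I 1 \<le> 2 * (\<integral>\<^sup>+\<phi>. ennreal (exp (- pair_energy I \<phi>)) * indicator {\<phi>. pair_energy I \<phi> \<le> K * card I} \<phi> \<partial>PiM I (\<lambda>_. lborel))"
    if I: "finite I" "card I = n" "n \<ge> 2" for I n
  proof (rule ennreal_half_absorb)
    show "Z I 1 < top" using \<Gamma>(3) I by auto
    have eK: "exp (- (K * n / 2)) = 1 / (2 * \<Gamma>) ^ n"
    proof -
      have "exp (- (K * n / 2)) = inverse (exp (n * ln (2 * \<Gamma>)))" by (simp add: K_def exp_minus mult.commute)
      also have "exp (n * ln (2 * \<Gamma>)) = (2 * \<Gamma>) ^ n" using \<Gamma>(1) by (simp add: exp_of_nat_mult)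
      finally show ?thesis by (simp add: field_simps)
    qed
    have HI_m [measurable]: "pair_energy I \<in> borel_measurable (PiM I (\<lambda>_. lborel))" by (rule pair_energy_measurable) simp
    let ?f = "\<lambda>\<phi>. ennreal (exp (- pair_energy I \<phi>)) * indicator {\<phi>. pair_energy I \<phi> \<le> K * n} \<phi>"
    have "ennreal (exp (- (K * n / 2))) * Z I (1/2) \<le> ennreal (exp (- (K * n / 2))) * (ennreal (\<Gamma> ^ n) * Z I 1)"
      using \<Gamma>(2)[of I] I by (intro mult_left_mono) auto
    also have "\<dots> = ennreal (exp (- (K * n / 2)) * \<Gamma> ^ n) * Z I 1"
      using \<Gamma>(1) by (simp add: ennreal_mult mult.assoc)
    also have "exp (- (K * n / 2)) * \<Gamma> ^ n = 1 / 2 ^ n"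
      unfolding eK using \<Gamma>(1) by (simp add: power_mult_distrib)
    also have "ennreal (1 / 2 ^ n) * Z I 1 \<le> ennreal (1/2) * Z I 1"
    proof (intro mult_right_mono ennreal_leI)
      have "(2::real) ^ 1 \<le> 2 ^ n" using I by (intro power_increasing) auto
      thus "1 / 2 ^ n \<le> (1/2 :: real)" by (simp add: field_simps)
    qed auto
    finally have tail: "ennreal (exp (- (K * n / 2))) * Z I (1/2) \<le> ennreal (1/2) * Z I 1" .
    have "Z I 1 \<le> (\<integral>\<^sup>+\<phi>. ?f \<phi> + ennreal (exp (- (K * n / 2))) * ennreal (exp (- (1/2 * pair_energy I \<phi>))) \<partial>PiM I (\<lambda>_. lborel))"
      unfolding Z_def
    proof (intro nn_integral_mono)
      fix \<phi> :: "nat \<Rightarrow> real"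
      show "ennreal (exp (- (1 * pair_energy I \<phi>))) \<le> ?f \<phi> + ennreal (exp (- (K * n / 2))) * ennreal (exp (- (1/2 * pair_energy I \<phi>)))"
      proof (cases "pair_energy I \<phi> \<le> K * n")
        case False
        hence "exp (- (1 * pair_energy I \<phi>)) \<le> exp (- (K * n / 2)) * exp (- (1/2 * pair_energy I \<phi>))"
          by (simp flip: exp_add)
        hence "ennreal (exp (- (1 * pair_energy I \<phi>))) \<le> ennreal (exp (- (K * n / 2)) * exp (- (1/2 * pair_energy I \<phi>)))"
          by (rule ennreal_leI)
        thus ?thesis using False by (simp add: ennreal_mult)
      qed simp
    qed
    also have "\<dots> = (\<integral>\<^sup>+\<phi>. ?f \<phi> \<partial>PiM I (\<lambda>_. lborel)) + ennreal (exp (- (K * n / 2))) * Z I (1/2)"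
      unfolding Z_def by (subst nn_integral_add) (auto simp: nn_integral_cmult)
    also have "\<dots> \<le> (\<integral>\<^sup>+\<phi>. ?f \<phi> \<partial>PiM I (\<lambda>_. lborel)) + ennreal (1/2) * Z I 1"
      using tail by (rule add_left_mono)
    finally show "Z I 1 \<le> (\<integral>\<^sup>+\<phi>. ennreal (exp (- pair_energy I \<phi>)) * indicator {\<phi>. pair_energy I \<phi> \<le> K * card I} \<phi> \<partial>PiM I (\<lambda>_. lborel))
          + ennreal (1/2) * Z I 1" unfolding I(2) .
  qed
  thus ?thesis using K by (intro exI[of _ K]) auto
qed

text \<open>If the energy is at most L n, some vertex k interacts with the others by at most 2 L in
  total. A new coordinate within \<open>1 / sqrt n\<close> of \<open>\<phi> k\<close> has a
  comparable interaction, wherever \<open>\<phi> k\<close> lies.\<close>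

lemma star_integral_ge:
  assumes I: "finite I" "card I = n" "n \<ge> 2" and H: "pair_energy I \<phi> \<le> L * n"
  shows "ennreal (2 / sqrt n * exp (- (28 * L + \<theta>)))
    \<le> (\<integral>\<^sup>+x. ennreal (exp (- (\<Sum>j\<in>I. h x (\<phi> j)))) \<partial>lborel)"
proof -
  define D where "D k = (\<Sum>j\<in>I - {k}. h (\<phi> k) (\<phi> j))" for k
  have "\<exists>k\<in>I. D k \<le> 2 * L"
  proof (rule ccontr)
    assume "\<not> ?thesis"
    hence "(\<Sum>k\<in>I. 2 * L) < (\<Sum>k\<in>I. D k)" using I by (intro sum_strict_mono) auto
    thus False using H I mult.commute[of "2 * L" "real n"] by (simp add: pair_energy_def D_def)
  qed
  then obtain k where k: "k \<in> I" "D k \<le> 2 * L" by blast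
  have "I - {k} \<noteq> {}"
  proof
    assume "I - {k} = {}"
    hence "I = {k}" using k by auto
    thus False using I by simp
  qed
  then obtain l where l: "l \<in> I - {k}" by blast
  have "h (\<phi> k) (\<phi> l) \<le> D k" unfolding D_def using l I by (intro member_le_sum h_nonneg) auto
  hence self: "h (\<phi> k) (\<phi> k) \<le> 12 * L" using Qt_le_h[of "\<phi> k" "\<phi> l"] k by (simp add: h_self)
  \<comment> \<open>28 = 2 * (12 + 2): the self term is at most 12 L, the rest is
    \<open>D k\<close>, and \<open>h_shift\<close> doubles both; the n displacement terms of size
    \<theta> / n add up to \<theta>.\<close>
  have *: "(\<Sum>j\<in>I. h x (\<phi> j)) \<le> 28 * L + \<theta>" if x: "\<bar>x - \<phi> k\<bar> \<le> 1 / sqrt n" for x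
  proof -
    have "(x - \<phi> k)\<^sup>2 \<le> (1 / sqrt n)\<^sup>2" using x by (simp add: abs_le_square_iff[symmetric])
    hence x2: "(x - \<phi> k)\<^sup>2 \<le> 1 / n" using I by (simp add: power_divide)
    have "(\<Sum>j\<in>I. h x (\<phi> j)) \<le> (\<Sum>j\<in>I. 2 * h (\<phi> k) (\<phi> j) + \<theta> * (1 / n))"
      using x2 \<theta>_pos by (intro sum_mono order.trans[OF h_shift[of x _ "\<phi> k"]] add_left_mono mult_left_mono) auto
    also have "\<dots> = 2 * (\<Sum>j\<in>I. h (\<phi> k) (\<phi> j)) + \<theta>"
      using I by (simp add: sum.distrib sum_distrib_left)
    also have "(\<Sum>j\<in>I. h (\<phi> k) (\<phi> j)) = h (\<phi> k) (\<phi> k) + D k"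
      unfolding D_def using I k by (intro sum.remove) auto
    finally show ?thesis using self k(2) by simp
  qed
  let ?A = "{\<phi> k - 1 / sqrt n .. \<phi> k + 1 / sqrt n}"
  have "ennreal (2 / sqrt n * exp (- (28 * L + \<theta>))) = ennreal (exp (- (28 * L + \<theta>))) * emeasure lborel ?A"
    using I by (simp add: mult.commute flip: ennreal_mult)
  also have "\<dots> = (\<integral>\<^sup>+x. ennreal (exp (- (28 * L + \<theta>))) * indicator ?A x \<partial>lborel)"
    by (simp add: nn_integral_cmult_indicator)
  also have "\<dots> \<le> (\<integral>\<^sup>+x. ennreal (exp (- (\<Sum>j\<in>I. h x (\<phi> j)))) \<partial>lborel)"
  proof (intro nn_integral_mono)
    fix x
    show "ennreal (exp (- (28 * L + \<theta>))) * indicator ?A x \<le> ennreal (exp (- (\<Sum>j\<in>I. h x (\<phi> j))))"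
      using *[of x] by (auto split: split_indicator intro!: ennreal_leI simp: abs_le_iff)
  qed
  finally show ?thesis .
qed

text \<open>The counterpart of \<open>Z_insert_le\<close> with the same order
  \<open>1 / sqrt (card I)\<close>: \<open>star_integral_ge\<close> applies to the configurations of
  energy at most K n, which carry half of the mass.\<close>

lemma Z_insert_ge:
  "\<exists>c>0. \<forall>I k. finite I \<and> card I \<ge> 2 \<and> k \<notin> I \<longrightarrow> ennreal (c / sqrt (card I)) * Z I 1 \<le> Z (insert k I) 1"
proof -
  obtain K :: real where K: "K > 0" "\<forall>I. finite I \<and> card I \<ge> 2 \<longrightarrow> Z I 1 \<le> 2 *
     (\<integral>\<^sup>+\<phi>. ennreal (exp (- pair_energy I \<phi>)) * indicator {\<phi>. pair_energy I \<phi> \<le> K * card I} \<phi> \<partial>PiM I (\<lambda>_. lborel))"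
    using pair_energy_tail by (elim exE conjE) (rule that)
  define c where "c = exp (- (28 * K + \<theta>))"
  have "ennreal (c / sqrt n) * Z I 1 \<le> Z (insert k I) 1"
    if I: "finite I" "card I = n" "n \<ge> 2" "k \<notin> I" for I n k
  proof -
    have HI_m [measurable]: "pair_energy I \<in> borel_measurable (PiM I (\<lambda>_. lborel))" by (rule pair_energy_measurable) simp
    have "ennreal (c / sqrt n) * Z I 1 \<le> ennreal (c / sqrt n) * (2 *
     (\<integral>\<^sup>+\<phi>. ennreal (exp (- pair_energy I \<phi>)) * indicator {\<phi>. pair_energy I \<phi> \<le> K * n} \<phi> \<partial>PiM I (\<lambda>_. lborel)))"
      using K(2)[rule_format, of I] I by (intro mult_left_mono) auto
    also have "\<dots> = ennreal (2 / sqrt n * c) *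
     (\<integral>\<^sup>+\<phi>. ennreal (exp (- pair_energy I \<phi>)) * indicator {\<phi>. pair_energy I \<phi> \<le> K * n} \<phi> \<partial>PiM I (\<lambda>_. lborel))"
    proof -
      have "ennreal (2 / sqrt n * c) = ennreal (c / sqrt n) * 2"
        by (simp add: c_def field_simps flip: ennreal_numeral ennreal_mult)
      thus ?thesis by (simp add: mult.assoc)
    qed
    also have "\<dots> = (\<integral>\<^sup>+\<phi>. ennreal (2 / sqrt n * c) *
       (ennreal (exp (- pair_energy I \<phi>)) * indicator {\<phi>. pair_energy I \<phi> \<le> K * n} \<phi>) \<partial>PiM I (\<lambda>_. lborel))"
      by (rule nn_integral_cmult[symmetric]) measurable
    also have "\<dots> \<le> Z (insert k I) 1"
      unfolding Z_insert[OF I(1,4)]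
    proof (intro nn_integral_mono)
      fix \<phi> :: "nat \<Rightarrow> real"
      show "ennreal (2 / sqrt n * c) * (ennreal (exp (- pair_energy I \<phi>)) * indicator {\<phi>. pair_energy I \<phi> \<le> K * n} \<phi>)
        \<le> ennreal (exp (- (1 * pair_energy I \<phi>))) * (\<integral>\<^sup>+x. ennreal (exp (- (1 * (\<Sum>j\<in>I. h x (\<phi> j))))) \<partial>lborel)"
      proof (cases "pair_energy I \<phi> \<le> K * n")
        case True
        have "ennreal (exp (- pair_energy I \<phi>)) * ennreal (2 / sqrt n * c)
           \<le> ennreal (exp (- pair_energy I \<phi>)) * (\<integral>\<^sup>+x. ennreal (exp (- (\<Sum>j\<in>I. h x (\<phi> j)))) \<partial>lborel)"
          unfolding c_def by (rule mult_left_mono[OF star_integral_ge[OF I(1-3) True]]) simp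
        thus ?thesis using True by (simp add: mult.commute)
      qed simp
    qed
    finally show ?thesis .
  qed
  moreover have "c > 0" by (simp add: c_def)
  ultimately show ?thesis by (intro exI[of _ c]) auto
qed

text \<open>The tilt removes half of the star energy of coordinate k, and the other half still
  integrates to order \<open>1 / sqrt (card I)\<close>. By \<open>Z_insert_ge\<close> the untilted
  partition function is not of smaller order, so the powers of \<open>card I\<close> cancel.\<close>

lemma star_exp_moment:
  "\<exists>C>0. \<forall>I k. finite I \<and> card I \<ge> 2 \<and> k \<notin> I \<longrightarrow>
     (\<integral>\<^sup>+\<phi>. ennreal (exp (- pair_energy (insert k I) \<phi> + 1/2 * (\<Sum>j\<in>I. h (\<phi> k) (\<phi> j)))) \<partial>PiM (insert k I) (\<lambda>_. lborel))
       \<le> ennreal C * Z (insert k I) 1"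
proof -
  obtain c where c: "c > 0" "\<And>I k. finite I \<Longrightarrow> card I \<ge> 2 \<Longrightarrow> k \<notin> I \<Longrightarrow>
      ennreal (c / sqrt (card I)) * Z I 1 \<le> Z (insert k I) 1"
    using Z_insert_ge by blast
  define C where "C = sqrt (8 * pi / \<theta>) / c"
  have C: "C > 0" using c \<theta>_pos by (simp add: C_def)
  have "(\<integral>\<^sup>+\<phi>. ennreal (exp (- pair_energy (insert k I) \<phi> + 1/2 * (\<Sum>j\<in>I. h (\<phi> k) (\<phi> j)))) \<partial>PiM (insert k I) (\<lambda>_. lborel))
       \<le> ennreal C * Z (insert k I) 1" if I: "finite I" "card I = n" "n \<ge> 2" "k \<notin> I" for I n k
  proof -
    have [measurable]: "pair_energy I \<in> borel_measurable (PiM I (\<lambda>_. lborel))"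
      "pair_energy (insert k I) \<in> borel_measurable (PiM (insert k I) (\<lambda>_. lborel))"
      "(\<lambda>\<phi>. \<Sum>j\<in>I. h (\<phi> k) (\<phi> j)) \<in> borel_measurable (PiM (insert k I) (\<lambda>_. lborel))"
      by (rule pair_energy_measurable star_measurable; auto)+
    have "(\<integral>\<^sup>+\<phi>. ennreal (exp (- pair_energy (insert k I) \<phi> + 1/2 * (\<Sum>j\<in>I. h (\<phi> k) (\<phi> j)))) \<partial>PiM (insert k I) (\<lambda>_. lborel))
      = (\<integral>\<^sup>+\<phi>. (\<integral>\<^sup>+x. ennreal (exp (- pair_energy (insert k I) (\<phi>(k := x)) + 1/2 * (\<Sum>j\<in>I. h ((\<phi>(k := x)) k) ((\<phi>(k := x)) j)))) \<partial>lborel) \<partial>PiM I (\<lambda>_. lborel))"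
      using I by (intro PL.product_nn_integral_insert) measurable
    also have "\<dots> = (\<integral>\<^sup>+\<phi>. (\<integral>\<^sup>+x. ennreal (exp (- pair_energy I \<phi>)) * ennreal (exp (- (1/2 * (\<Sum>j\<in>I. h x (\<phi> j))))) \<partial>lborel) \<partial>PiM I (\<lambda>_. lborel))"
    proof (intro nn_integral_cong)
      fix \<phi> :: "nat \<Rightarrow> real" and x :: real
      have "(\<Sum>j\<in>I. h x ((\<phi>(k := x)) j)) = (\<Sum>j\<in>I. h x (\<phi> j))"
        using I by (intro sum.cong) auto
      thus "ennreal (exp (- pair_energy (insert k I) (\<phi>(k := x)) + 1/2 * (\<Sum>j\<in>I. h ((\<phi>(k := x)) k) ((\<phi>(k := x)) j))))
         = ennreal (exp (- pair_energy I \<phi>)) * ennreal (exp (- (1/2 * (\<Sum>j\<in>I. h x (\<phi> j)))))"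
        using I by (simp add: pair_energy_insert flip: ennreal_mult exp_add)
    qed
    also have "\<dots> = (\<integral>\<^sup>+\<phi>. ennreal (exp (- pair_energy I \<phi>)) * (\<integral>\<^sup>+x. ennreal (exp (- (1/2 * (\<Sum>j\<in>I. h x (\<phi> j))))) \<partial>lborel) \<partial>PiM I (\<lambda>_. lborel))"
      by (intro nn_integral_cong nn_integral_cmult) measurable
    also have "\<dots> \<le> (\<integral>\<^sup>+\<phi>. ennreal (exp (- pair_energy I \<phi>)) * ennreal (sqrt (4 * pi / (1/2 * \<theta> * card I))) \<partial>PiM I (\<lambda>_. lborel))"
      using I by (intro nn_integral_mono mult_left_mono star_integral_le) auto
    also have "\<dots> = Z I 1 * ennreal (sqrt (4 * pi / (1/2 * \<theta> * card I)))"
      unfolding Z_def mult_1 by (rule nn_integral_multc) measurable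
    also have "sqrt (4 * pi / (1/2 * \<theta> * card I)) = C * (c / sqrt n)"
      using c I by (simp add: C_def real_sqrt_divide real_sqrt_mult)
    also have "Z I 1 * ennreal (C * (c / sqrt n)) = ennreal C * (ennreal (c / sqrt n) * Z I 1)"
      using C c by (subst ennreal_mult) (auto simp: mult_ac)
    also have "\<dots> \<le> ennreal C * Z (insert k I) 1"
      using c(2)[of I k] I by (intro mult_left_mono) auto
    finally show ?thesis .
  qed
  thus ?thesis using C by (intro exI[of _ C]) auto
qed

end

section \<open>Graphs and the Hubbard-Stratonovich transform\<close>

definition pairs :: "nat \<Rightarrow> (nat \<times> nat) set" where
  "pairs n = {(i, j). i \<in> {1..n} \<and> j \<in> {1..n} \<and> i < j}"

definition spin :: "(nat \<Rightarrow> nat \<Rightarrow> nat) \<Rightarrow> nat \<Rightarrow> nat \<Rightarrow> real" where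
  "spin g i j = 2 * real (g i j) - 1"

definition zdeg :: "nat \<Rightarrow> (nat \<Rightarrow> nat \<Rightarrow> nat) \<Rightarrow> nat \<Rightarrow> real" where
  "zdeg n g i = (2 * real (vdeg n g i) - (real n - 1)) / (real n - 1)"

definition energy :: "real \<Rightarrow> real \<Rightarrow> nat \<Rightarrow> (nat \<Rightarrow> nat \<Rightarrow> nat) \<Rightarrow> real" where
  "energy \<theta> \<beta> n g = (real n - 1) * (\<theta> / 2 * (\<Sum>i=1..n. (zdeg n g i)\<^sup>2) + \<beta> / 2 * (\<Sum>i=1..n. zdeg n g i))"

lemma finite_pairs [simp]: "finite (pairs n)"
  by (rule finite_subset[of _ "{1..n} \<times> {1..n}"]) (auto simp: pairs_def)

lemma sum_offdiag:
  fixes f :: "nat \<Rightarrow> nat \<Rightarrow> real"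
  shows "(\<Sum>i=1..n. \<Sum>j\<in>{1..n} - {i}. f i j) = (\<Sum>(i, j)\<in>pairs n. f i j + f j i)"
proof -
  have "(\<Sum>i=1..n. \<Sum>j\<in>{1..n} - {i}. f i j) = (\<Sum>(i, j)\<in>Sigma {1..n} (\<lambda>i. {1..n} - {i}). f i j)"
    by (rule sum.Sigma) auto
  also have "Sigma {1..n} (\<lambda>i. {1..n} - {i}) = pairs n \<union> prod.swap ` pairs n"
    by (auto simp: pairs_def image_iff)
  also have "(\<Sum>(i, j)\<in>pairs n \<union> prod.swap ` pairs n. f i j)
     = (\<Sum>(i, j)\<in>pairs n. f i j) + (\<Sum>(i, j)\<in>prod.swap ` pairs n. f i j)"
    by (rule sum.union_disjoint[OF finite_pairs finite_imageI[OF finite_pairs]]) (auto simp: pairs_def)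
  also have "(\<Sum>(i, j)\<in>prod.swap ` pairs n. f i j) = (\<Sum>(i, j)\<in>pairs n. f j i)"
    by (subst sum.reindex) (auto simp: o_def case_prod_unfold)
  finally show ?thesis by (simp add: case_prod_unfold sum.distrib)
qed

lemma vdeg_offdiag: "g \<in> graphs n \<Longrightarrow> vdeg n g i = (\<Sum>j\<in>{1..n} - {i}. g i j)"
  unfolding vdeg_def by (rule sum.mono_neutral_right) (auto simp: graphs_def)

lemma zdeg_spin:
  assumes g: "g \<in> graphs n" and i: "i \<in> {1..n}"
  shows "(real n - 1) * zdeg n g i = (\<Sum>j\<in>{1..n} - {i}. spin g i j)"
proof -
  have "(\<Sum>j\<in>{1..n} - {i}. spin g i j) = 2 * real (vdeg n g i) - (real n - 1)"
    using i vdeg_offdiag[OF g, of i]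
    by (simp add: spin_def sum_subtractf flip: sum_distrib_left)
  moreover have "vdeg n g i = 0" if "n = 1"
    using that i vdeg_offdiag[OF g, of i] by simp
  ultimately show ?thesis using i by (cases "n = 1") (auto simp: zdeg_def)
qed

lemma graph_sym: "g \<in> graphs n \<Longrightarrow> g i j = g j i"
  by (auto simp: graphs_def)

text \<open>The extra edge weight \<omega>1 / (n - 1) exactly cancels the linear part of
  \<open>d choose 2\<close>, leaving a linear form in the degrees with coefficient \<omega>2 / 2 and
  a pure square. The prefactor depends on n only and disappears after normalization.\<close>

lemma two_star_weight_energy:
  assumes \<omega>: "\<theta> = \<omega>1 / 4" "\<beta> = (\<omega>1 + \<omega>2) / 2" and n: "n \<ge> 2" and g: "g \<in> graphs n"
  shows "two_star_weight \<omega>1 \<omega>2 n g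
     = exp ((real n - 1) * n * (\<omega>2 / 4 + \<omega>1 / 8)) * exp (energy \<theta> \<beta> n g)"
proof -
  define N where "N = real n - 1"
  have N: "N > 0" using n by (simp add: N_def)
  let ?d = "\<lambda>i. real (vdeg n g i)"
  have "(\<Sum>i=1..n. ?d i) = (\<Sum>i=1..n. \<Sum>j\<in>{1..n} - {i}. real (g i j))"
    using vdeg_offdiag[OF g] by simp
  also have "\<dots> = (\<Sum>(i, j)\<in>pairs n. real (g i j) + real (g j i))" by (rule sum_offdiag)
  also have "\<dots> = (\<Sum>(i, j)\<in>pairs n. 2 * real (g i j))"
    using graph_sym[OF g] by (intro sum.cong) auto
  also have "\<dots> = 2 * real (edge_count n g)"
    by (simp add: edge_count_def pairs_def sum_distrib_left case_prod_unfold)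
  finally have E: "real (edge_count n g) = (\<Sum>i=1..n. ?d i) / 2" by simp
  have "real (d choose 2) = (real d)\<^sup>2 / 2 - real d / 2" for d :: nat
    by (simp add: choose_two power2_eq_square algebra_simps real_of_nat_div even_mult_iff of_nat_diff)
       (cases d; simp add: algebra_simps)
  hence T: "real (two_star_count n g) = (\<Sum>i=1..n. (?d i)\<^sup>2) / 2 - (\<Sum>i=1..n. ?d i) / 2"
    by (simp add: two_star_count_def sum_subtractf sum_divide_distrib)
  have d: "?d i = N / 2 * (1 + zdeg n g i)" for i
    using N by (simp add: zdeg_def N_def field_simps)
  let ?z = "\<Sum>i=1..n. zdeg n g i" and ?z2 = "\<Sum>i=1..n. (zdeg n g i)\<^sup>2"
  have S1: "(\<Sum>i=1..n. ?d i) = N / 2 * (n + ?z)"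
    unfolding d sum_distrib_left[symmetric] by (simp add: sum.distrib)
  have S2: "(\<Sum>i=1..n. (?d i)\<^sup>2) = N\<^sup>2 / 4 * (n + 2 * ?z + ?z2)"
  proof -
    have "(\<Sum>i=1..n. (?d i)\<^sup>2) = (\<Sum>i=1..n. N\<^sup>2 / 4 * (1 + 2 * zdeg n g i + (zdeg n g i)\<^sup>2))"
      unfolding d by (intro sum.cong) (auto simp: power2_eq_square algebra_simps)
    also have "\<dots> = N\<^sup>2 / 4 * (\<Sum>i=1..n. 1 + 2 * zdeg n g i + (zdeg n g i)\<^sup>2)"
      by (rule sum_distrib_left[symmetric])
    finally show ?thesis by (simp add: sum.distrib flip: sum_distrib_left)
  qed
  have "(\<omega>2 + \<omega>1 / N) * real (edge_count n g) + \<omega>1 / N * real (two_star_count n g)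
     = \<omega>2 / 2 * (\<Sum>i=1..n. ?d i) + \<omega>1 / (2 * N) * (\<Sum>i=1..n. (?d i)\<^sup>2)"
    unfolding E T using N by (simp add: field_simps)
  also have "\<dots> = \<omega>2 * N / 4 * (n + ?z) + \<omega>1 * N / 8 * (n + 2 * ?z + ?z2)"
    unfolding S1 S2 using N by (simp add: field_simps power2_eq_square)
  also have "\<dots> = N * n * (\<omega>2 / 4 + \<omega>1 / 8) + energy \<theta> \<beta> n g"
    unfolding energy_def N_def[symmetric] \<omega> by (simp add: algebra_simps)
  finally show ?thesis unfolding two_star_weight_def N_def by (simp add: exp_add)
qed

text \<open>A graph is a subset of \<open>pairs n\<close>, so the sum over graphs is the expansion
  of a product over edges.\<close>

lemma sum_graphs_prod:
  fixes a b :: "nat \<times> nat \<Rightarrow> real"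
  shows "(\<Sum>g\<in>graphs n. \<Prod>p\<in>pairs n. if g (fst p) (snd p) = 1 then a p else b p) = (\<Prod>p\<in>pairs n. a p + b p)"
proof -
  have "(\<Prod>p\<in>pairs n. a p + b p) = (\<Sum>S\<in>Pow (pairs n). prod a S * prod b (pairs n - S))"
    by (rule prod_add) simp
  also have "\<dots> = (\<Sum>g\<in>graphs n. \<Prod>p\<in>pairs n. if g (fst p) (snd p) = 1 then a p else b p)"
  proof (rule sum.reindex_bij_witness[where
      i = "\<lambda>g. {p \<in> pairs n. g (fst p) (snd p) = 1}" and
      j = "\<lambda>S i j. if (i, j) \<in> S \<or> (j, i) \<in> S then 1 else 0"])
    fix S assume S: "S \<in> Pow (pairs n)"
    let ?g = "\<lambda>i j. if (i, j) \<in> S \<or> (j, i) \<in> S then 1 else 0 :: nat"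
    show 1: "{p \<in> pairs n. ?g (fst p) (snd p) = 1} = S"
      using S by (auto simp: pairs_def)
    show "?g \<in> graphs n" using S by (auto simp: graphs_def pairs_def)
    have "(\<Prod>p\<in>pairs n. if ?g (fst p) (snd p) = 1 then a p else b p)
       = (\<Prod>p\<in>pairs n. if p \<in> S then a p else b p)"
    proof (intro prod.cong refl)
      fix p assume "p \<in> pairs n"
      hence "(snd p, fst p) \<notin> S" using S by (auto simp: pairs_def)
      thus "(if ?g (fst p) (snd p) = 1 then a p else b p) = (if p \<in> S then a p else b p)" by simp
    qed
    also have "\<dots> = prod a (pairs n \<inter> S) * prod b (pairs n - S)"
      by (subst prod.If_cases) (auto simp: Diff_eq)
    also have "pairs n \<inter> S = S" using S by auto
    finally show "(\<Prod>p\<in>pairs n. if ?g (fst p) (snd p) = 1 then a p else b p) = prod a S * prod b (pairs n - S)" .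
  next
    fix g assume g: "g \<in> graphs n"
    show "{p \<in> pairs n. g (fst p) (snd p) = 1} \<in> Pow (pairs n)" by auto
    show "(\<lambda>i j. if (i, j) \<in> {p \<in> pairs n. g (fst p) (snd p) = 1} \<or> (j, i) \<in> {p \<in> pairs n. g (fst p) (snd p) = 1}
        then 1 else 0) = g"
    proof (intro ext)
      fix i j
      have *: "g i j = g j i" "g i i = 0" "g i j \<in> {0, 1}" "i \<notin> {1..n} \<or> j \<notin> {1..n} \<longrightarrow> g i j = 0"
        using g by (auto simp: graphs_def)
      show "(if (i, j) \<in> {p \<in> pairs n. g (fst p) (snd p) = 1} \<or> (j, i) \<in> {p \<in> pairs n. g (fst p) (snd p) = 1}
        then 1 else 0) = g i j"
        using * by (cases i j rule: linorder_cases) (auto simp: pairs_def)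
    qed
  qed
  finally show ?thesis ..
qed

lemma sum_graphs_exp:
  "(\<Sum>g\<in>graphs n. exp (\<Sum>(i, j)\<in>pairs n. spin g i j * c i j)) = (\<Prod>(i, j)\<in>pairs n. 2 * cosh (c i j :: real))"
proof -
  have "exp (\<Sum>(i, j)\<in>pairs n. spin g i j * c i j)
     = (\<Prod>p\<in>pairs n. if g (fst p) (snd p) = 1 then exp (c (fst p) (snd p)) else exp (- c (fst p) (snd p)))"
    if g: "g \<in> graphs n" for g
    unfolding exp_sum[OF finite_pairs]
  proof (intro prod.cong refl)
    fix p
    have "g (fst p) (snd p) \<in> {0, 1}" using g by (auto simp: graphs_def)
    thus "exp (case p of (i, j) \<Rightarrow> spin g i j * c i j)
      = (if g (fst p) (snd p) = 1 then exp (c (fst p) (snd p)) else exp (- c (fst p) (snd p)))"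
      by (auto simp: spin_def case_prod_unfold)
  qed
  hence "(\<Sum>g\<in>graphs n. exp (\<Sum>(i, j)\<in>pairs n. spin g i j * c i j))
    = (\<Sum>g\<in>graphs n. \<Prod>p\<in>pairs n.
        if g (fst p) (snd p) = 1 then exp (c (fst p) (snd p)) else exp (- c (fst p) (snd p)))"
    by (intro sum.cong refl)
  also have "\<dots> = (\<Prod>p\<in>pairs n. exp (c (fst p) (snd p)) + exp (- c (fst p) (snd p)))"
    by (rule sum_graphs_prod)
  also have "\<dots> = (\<Prod>(i, j)\<in>pairs n. 2 * cosh (c i j))"
    by (intro prod.cong) (auto simp: cosh_def)
  finally show ?thesis .
qed

lemma spin_pairs_sum:
  assumes g: "g \<in> graphs n"
  shows "(\<Sum>(i, j)\<in>pairs n. spin g i j * (u i + u j)) = (real n - 1) * (\<Sum>i=1..n. u i * zdeg n g i)"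
proof -
  have "(\<Sum>(i, j)\<in>pairs n. spin g i j * (u i + u j)) = (\<Sum>(i, j)\<in>pairs n. spin g i j * u i + spin g j i * u j)"
    using graph_sym[OF g] by (intro sum.cong) (auto simp: spin_def algebra_simps)
  also have "\<dots> = (\<Sum>i=1..n. \<Sum>j\<in>{1..n} - {i}. spin g i j * u i)" by (rule sum_offdiag[symmetric])
  also have "\<dots> = (\<Sum>i=1..n. u i * ((real n - 1) * zdeg n g i))"
    by (intro sum.cong refl) (simp only: zdeg_spin[OF g] sum_distrib_right[symmetric] mult.commute[of "u _"])
  finally show ?thesis by (simp add: sum_distrib_left mult_ac)
qed

context two_star
begin

lemma pair_energy_pairs: "pair_energy {1..n} \<phi> = (\<Sum>(i, j)\<in>pairs n. h (\<phi> i) (\<phi> j))"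
proof -
  have "2 * pair_energy {1..n} \<phi> = (\<Sum>(i, j)\<in>pairs n. h (\<phi> i) (\<phi> j) + h (\<phi> j) (\<phi> i))"
    using sum_offdiag[of "\<lambda>i j. h (\<phi> i) (\<phi> j)" n] by (simp add: pair_energy_def)
  also have "\<dots> = 2 * (\<Sum>(i, j)\<in>pairs n. h (\<phi> i) (\<phi> j))"
    unfolding sum_distrib_left by (intro sum.cong) (auto simp: h_commute)
  finally show ?thesis by simp
qed

text \<open>Expanding the square cancels the quadratic part of \<open>energy\<close>, and the cross
  term is linear in the spins. For fixed \<phi> the edges are thus independent, and the sum over
  graphs factors into terms \<open>2 * cosh\<close>, whose logarithm is the \<open>lncosh\<close> in
  h. The constant collects \<open>2 * exp (- q0)\<close> per pair.\<close>

lemma hubbard_stratonovich: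
  "\<exists>c>0. \<forall>\<phi>. (\<Sum>g\<in>graphs n. exp (energy \<theta> \<beta> n g - \<theta> * (real n - 1) / 2 * (\<Sum>i=1..n. (\<phi> i - zdeg n g i)\<^sup>2)))
     = c * exp (- pair_energy {1..n} \<phi>)"
proof (intro exI conjI allI)
  define N where "N = real n - 1"
  define q0 where "q0 = qpot \<theta> \<beta> t"
  show "(\<Prod>(i, j)\<in>pairs n. 2 * exp (- q0)) > 0" by (intro prod_pos) auto
  fix \<phi> :: "nat \<Rightarrow> real"
  let ?c = "\<lambda>i j. \<theta> * (\<phi> i + \<phi> j) + \<beta>"
  have phi2: "(\<Sum>(i, j)\<in>pairs n. (\<phi> i)\<^sup>2 + (\<phi> j)\<^sup>2) = N * (\<Sum>i=1..n. (\<phi> i)\<^sup>2)"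
  proof -
    have "(\<Sum>(i, j)\<in>pairs n. (\<phi> i)\<^sup>2 + (\<phi> j)\<^sup>2) = (\<Sum>i=1..n. \<Sum>j\<in>{1..n} - {i}. (\<phi> i)\<^sup>2)"
      by (rule sum_offdiag[symmetric])
    also have "\<dots> = (\<Sum>i=1..n. N * (\<phi> i)\<^sup>2)"
      by (intro sum.cong) (auto simp: N_def of_nat_diff)
    finally show ?thesis by (simp add: sum_distrib_left)
  qed
  have "energy \<theta> \<beta> n g - \<theta> * N / 2 * (\<Sum>i=1..n. (\<phi> i - zdeg n g i)\<^sup>2)
     = - (\<theta> / 2 * (N * (\<Sum>i=1..n. (\<phi> i)\<^sup>2))) + (\<Sum>(i, j)\<in>pairs n. spin g i j * ?c i j)" if g: "g \<in> graphs n" for g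
  proof -
    have e1: "(\<Sum>i=1..n. (\<phi> i - zdeg n g i)\<^sup>2)
      = (\<Sum>i=1..n. (\<phi> i)\<^sup>2) - 2 * (\<Sum>i=1..n. \<phi> i * zdeg n g i) + (\<Sum>i=1..n. (zdeg n g i)\<^sup>2)"
      by (simp add: power2_diff sum.distrib sum_subtractf sum_distrib_left mult_ac)
    have e2: "(\<Sum>(i, j)\<in>pairs n. spin g i j * ?c i j)
      = \<theta> * (\<Sum>(i, j)\<in>pairs n. spin g i j * (\<phi> i + \<phi> j)) + \<beta> * (\<Sum>(i, j)\<in>pairs n. spin g i j * (1/2 + 1/2))"
      unfolding sum_distrib_left sum.distrib[symmetric] by (intro sum.cong) (auto simp: algebra_simps)
    have e3: "(\<Sum>(i, j)\<in>pairs n. spin g i j * (\<phi> i + \<phi> j)) = N * (\<Sum>i=1..n. \<phi> i * zdeg n g i)"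
      unfolding N_def by (rule spin_pairs_sum[OF g])
    have e4: "(\<Sum>(i, j)\<in>pairs n. spin g i j * (1/2 + 1/2)) = N * (1 / 2 * (\<Sum>i=1..n. zdeg n g i))"
      unfolding N_def sum_distrib_left[of "1/2"] by (rule spin_pairs_sum[OF g])
    show ?thesis
      unfolding energy_def N_def[symmetric] e2 e3 e4 e1 by (simp add: algebra_simps)
  qed
  hence "(\<Sum>g\<in>graphs n. exp (energy \<theta> \<beta> n g - \<theta> * N / 2 * (\<Sum>i=1..n. (\<phi> i - zdeg n g i)\<^sup>2)))
    = (\<Sum>g\<in>graphs n. exp (- (\<theta> / 2 * (N * (\<Sum>i=1..n. (\<phi> i)\<^sup>2)))) * exp (\<Sum>(i, j)\<in>pairs n. spin g i j * ?c i j))"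
    by (intro sum.cong) (auto simp: exp_add[symmetric])
  also have "\<dots> = exp (- (\<theta> / 2 * (\<Sum>(i, j)\<in>pairs n. (\<phi> i)\<^sup>2 + (\<phi> j)\<^sup>2))) * (\<Prod>(i, j)\<in>pairs n. 2 * cosh (?c i j))"
    unfolding phi2 sum_graphs_exp[symmetric] by (rule sum_distrib_left[symmetric])
  also have "exp (- (\<theta> / 2 * (\<Sum>(i, j)\<in>pairs n. (\<phi> i)\<^sup>2 + (\<phi> j)\<^sup>2)))
     = (\<Prod>(i, j)\<in>pairs n. exp (- (\<theta> / 2 * ((\<phi> i)\<^sup>2 + (\<phi> j)\<^sup>2))))"
    by (simp add: sum_distrib_left exp_sum case_prod_unfold flip: sum_negf)
  also have "\<dots> * (\<Prod>(i, j)\<in>pairs n. 2 * cosh (?c i j))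
     = (\<Prod>(i, j)\<in>pairs n. (2 * exp (- q0)) * exp (- h (\<phi> i) (\<phi> j)))"
    unfolding prod.distrib[symmetric]
  proof (intro prod.cong refl)
    fix p :: "nat \<times> nat"
    obtain i j where p: "p = (i, j)" by force
    have "exp (- (\<theta> / 2 * ((\<phi> i)\<^sup>2 + (\<phi> j)\<^sup>2))) * (2 * cosh (?c i j))
       = 2 * exp (- q0) * exp (- h (\<phi> i) (\<phi> j))"
      by (simp add: h_def q0_def flip: exp_lncosh exp_add)
    thus "(case p of (i, j) \<Rightarrow> exp (- (\<theta> / 2 * ((\<phi> i)\<^sup>2 + (\<phi> j)\<^sup>2)))) * (case p of (i, j) \<Rightarrow> 2 * cosh (?c i j))
       = (case p of (i, j) \<Rightarrow> 2 * exp (- q0) * exp (- h (\<phi> i) (\<phi> j)))" by (simp add: p)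
  qed
  also have "\<dots> = (\<Prod>(i, j)\<in>pairs n. 2 * exp (- q0)) * exp (- pair_energy {1..n} \<phi>)"
  proof -
    have "exp (- pair_energy {1..n} \<phi>) = (\<Prod>p\<in>pairs n. exp (- h (\<phi> (fst p)) (\<phi> (snd p))))"
      unfolding pair_energy_pairs sum_negf[symmetric] case_prod_unfold by (rule exp_sum) simp
    thus ?thesis by (simp add: case_prod_unfold prod.distrib)
  qed
  finally show "(\<Sum>g\<in>graphs n. exp (energy \<theta> \<beta> n g - \<theta> * (real n - 1) / 2 * (\<Sum>i=1..n. (\<phi> i - zdeg n g i)\<^sup>2)))
     = (\<Prod>(i, j)\<in>pairs n. 2 * exp (- q0)) * exp (- pair_energy {1..n} \<phi>)" unfolding N_def .
qed


section \<open>Transfer of the exponential moment from the field to the degrees\<close>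

definition star_energy :: "nat \<Rightarrow> (nat \<Rightarrow> nat \<Rightarrow> nat) \<Rightarrow> nat \<Rightarrow> real" where
  "star_energy n g i = (\<Sum>j\<in>{1..n} - {i}. h (zdeg n g i) (zdeg n g j))"

lemma star_energy_nonneg: "star_energy n g i \<ge> 0"
  unfolding star_energy_def by (intro sum_nonneg h_nonneg)

text \<open>Passing from \<phi> to the degrees by \<open>h_shift2\<close> costs a factor 4 and
  squared distances, and the product of exponentials is split by e^a e^b \<le> (e^(2a) + e^(2b)) /
  2. The exponent 1/16 is chosen so that the first part becomes the tilt 2 * 4 / 16 = 1/2 of
  \<open>star_exp_moment\<close> while the second stays below the Gaussian weight \<theta> (n - 1) /
  2.\<close>

lemma star_energy_exp_le:
  assumes i: "i \<in> {1..n}"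
  shows "exp (star_energy n g i / 16) \<le>
     (exp (1/2 * (\<Sum>j\<in>{1..n} - {i}. h (\<phi> i) (\<phi> j)))
      + exp (\<Sum>j=1..n. (\<theta> / 4 + (if j = i then \<theta> * (real n - 1) / 8 else 0)) * (\<phi> j - zdeg n g j)\<^sup>2)) / 2"
proof -
  let ?z = "zdeg n g" and ?J = "{1..n} - {i}"
  define a where "a = 1/4 * (\<Sum>j\<in>?J. h (\<phi> i) (\<phi> j))"
  define b where "b = \<theta> * (real n - 1) / 16 * (\<phi> i - ?z i)\<^sup>2 + \<theta> / 8 * (\<Sum>j=1..n. (\<phi> j - ?z j)\<^sup>2)"
  have "star_energy n g i \<le> (\<Sum>j\<in>?J. 4 * h (\<phi> i) (\<phi> j) + \<theta> * (?z i - \<phi> i)\<^sup>2 + 2 * \<theta> * (?z j - \<phi> j)\<^sup>2)"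
    unfolding star_energy_def by (intro sum_mono h_shift2)
  also have "\<dots> = 4 * (\<Sum>j\<in>?J. h (\<phi> i) (\<phi> j)) + (real n - 1) * (\<theta> * (\<phi> i - ?z i)\<^sup>2) + 2 * \<theta> * (\<Sum>j\<in>?J. (\<phi> j - ?z j)\<^sup>2)"
    using i by (simp add: sum.distrib sum_distrib_left power2_commute of_nat_diff)
  also have "(\<Sum>j\<in>?J. (\<phi> j - ?z j)\<^sup>2) \<le> (\<Sum>j=1..n. (\<phi> j - ?z j)\<^sup>2)"
    by (intro sum_mono2) auto
  finally have "star_energy n g i / 16 \<le> a + b"
    using \<theta>_pos by (simp add: a_def b_def field_simps)
  hence "exp (star_energy n g i / 16) \<le> exp a * exp b" by (simp flip: exp_add)
  also have "\<dots> \<le> ((exp a)\<^sup>2 + (exp b)\<^sup>2) / 2"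
    using sum_squares_bound[of "exp a" "exp b"] by simp
  also have "\<dots> = (exp (2 * a) + exp (2 * b)) / 2" by (simp add: exp_double)
  also have "2 * b = (\<Sum>j=1..n. (\<theta> / 4 + (if j = i then \<theta> * (real n - 1) / 8 else 0)) * (\<phi> j - ?z j)\<^sup>2)"
    using i by (simp add: b_def distrib_right sum.distrib sum_distrib_left if_distrib[of "\<lambda>x. x * _"] sum.delta cong: if_cong)
  finally show ?thesis by (simp add: a_def)
qed

text \<open>Given the graph, the coordinates are independent Gaussians around z j. Coordinate i
  loses a fixed fraction of its precision, which costs a factor at most 2. Every other coordinate
  loses only \<theta> / 4 out of order n, a factor 1 + O(1 / n), and the product of these stays
  below e^(1/2).\<close>

lemma gauss_product_le:
  fixes z :: "nat \<Rightarrow> real"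
  assumes n: "n \<ge> 3" and i: "i \<in> {1..n}"
  shows "(\<integral>\<^sup>+\<phi>. ennreal (exp (- (\<theta> * (real n - 1) / 2 * (\<Sum>j=1..n. (\<phi> j - z j)\<^sup>2)))
      * exp (\<Sum>j=1..n. (\<theta> / 4 + (if j = i then \<theta> * (real n - 1) / 8 else 0)) * (\<phi> j - z j)\<^sup>2)) \<partial>PiM {1..n} (\<lambda>_. lborel))
    \<le> ennreal (4 * sqrt (2 * pi / (\<theta> * (real n - 1))) ^ n)"
proof -
  define N where "N = real n - 1"
  have N: "N \<ge> 2" using n by (simp add: N_def)
  define G where "G = sqrt (2 * pi / (\<theta> * N))"
  have G: "G > 0" using N \<theta>_pos by (simp add: G_def)
  define b where "b j = \<theta> * N / 2 - (\<theta> / 4 + (if j = i then \<theta> * N / 8 else 0))" for j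
  have b_i: "b i \<ge> \<theta> * N / 4"
  proof -
    have "\<theta> * 2 \<le> \<theta> * N" using N \<theta>_pos by (intro mult_left_mono) auto
    moreover have "b i = \<theta> * N / 2 - (\<theta> / 4 + \<theta> * N / 8)" by (simp add: b_def)
    ultimately show ?thesis by linarith
  qed
  have b_pos: "b j > 0" for j
  proof -
    have "b j \<ge> b i" using \<theta>_pos N by (simp add: b_def)
    moreover have "b i > 0" using \<theta>_pos N by (intro order.strict_trans2[OF _ b_i]) auto
    ultimately show ?thesis by simp
  qed
  have "(\<integral>\<^sup>+\<phi>. ennreal (exp (- (\<theta> * N / 2 * (\<Sum>j=1..n. (\<phi> j - z j)\<^sup>2)))
      * exp (\<Sum>j=1..n. (\<theta> / 4 + (if j = i then \<theta> * N / 8 else 0)) * (\<phi> j - z j)\<^sup>2)) \<partial>PiM {1..n} (\<lambda>_. lborel))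
    = (\<integral>\<^sup>+\<phi>. (\<Prod>j=1..n. ennreal (exp (- (b j * (\<phi> j - z j)\<^sup>2)))) \<partial>PiM {1..n} (\<lambda>_. lborel))"
  proof (intro nn_integral_cong)
    fix \<phi> :: "nat \<Rightarrow> real"
    have "exp (- (\<theta> * N / 2 * (\<Sum>j=1..n. (\<phi> j - z j)\<^sup>2)))
      * exp (\<Sum>j=1..n. (\<theta> / 4 + (if j = i then \<theta> * N / 8 else 0)) * (\<phi> j - z j)\<^sup>2)
      = exp (\<Sum>j=1..n. - (b j * (\<phi> j - z j)\<^sup>2))"
      unfolding exp_add[symmetric] sum_distrib_left sum_negf[symmetric] sum.distrib[symmetric]
      by (intro arg_cong[of _ _ exp] sum.cong refl) (simp add: b_def algebra_simps)
    also have "\<dots> = (\<Prod>j=1..n. exp (- (b j * (\<phi> j - z j)\<^sup>2)))" by (rule exp_sum) simp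
    finally show "ennreal (exp (- (\<theta> * N / 2 * (\<Sum>j=1..n. (\<phi> j - z j)\<^sup>2)))
      * exp (\<Sum>j=1..n. (\<theta> / 4 + (if j = i then \<theta> * N / 8 else 0)) * (\<phi> j - z j)\<^sup>2))
      = (\<Prod>j=1..n. ennreal (exp (- (b j * (\<phi> j - z j)\<^sup>2))))" by (simp only: prod_ennreal[symmetric] exp_ge_zero)
  qed
  also have "\<dots> = (\<Prod>j=1..n. \<integral>\<^sup>+x. ennreal (exp (- (b j * (x - z j)\<^sup>2))) \<partial>lborel)"
    by (intro PL.product_nn_integral_prod) auto
  also have "\<dots> = (\<Prod>j=1..n. ennreal (sqrt (pi / b j)))"
    by (intro prod.cong refl ennreal_gauss_integral b_pos)
  also have "\<dots> = ennreal (\<Prod>j=1..n. sqrt (pi / b j))"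
    by (rule prod_ennreal) (simp add: b_pos less_imp_le)
  also have "\<dots> \<le> ennreal (4 * G ^ n)"
  proof (rule ennreal_leI)
    have Gi: "sqrt (pi / b i) \<le> 2 * G"
    proof -
      have "pi / b i \<le> pi / (\<theta> * N / 4)" using b_i \<theta>_pos N using b_pos[of i] by (intro divide_left_mono mult_pos_pos) auto
      also have "\<dots> \<le> 2\<^sup>2 * (2 * pi / (\<theta> * N))" using \<theta>_pos N by (simp add: field_simps)
      finally have "sqrt (pi / b i) \<le> sqrt (2\<^sup>2 * (2 * pi / (\<theta> * N)))" by (rule real_sqrt_le_mono)
      thus ?thesis unfolding real_sqrt_mult G_def by simp
    qed
    have Gj: "sqrt (pi / b j) \<le> G * exp (1 / (2 * N))" if "j \<noteq> i" for j
    proof -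
      \<comment> \<open>The relative loss of precision, \<theta> / 4 against \<theta> N / 2.\<close>
      define x where "x = 1 / (2 * N)"
      have x: "0 < x" "x \<le> 1/4" using N by (simp_all add: x_def field_simps)
      have "1 \<le> (1 - x) * (1 + 2 * x)" using x mult_left_mono[of x "1/2" x] by (simp add: algebra_simps)
      also have "\<dots> \<le> (1 - x) * exp (2 * x)" using x exp_ge_add_one_self[of "2 * x"] by (intro mult_left_mono) auto
      finally have "1 / (1 - x) \<le> exp (2 * x)" using x by (simp add: field_simps)
      hence "(2 * pi / (\<theta> * N)) * (1 / (1 - x)) \<le> (2 * pi / (\<theta> * N)) * (exp x)\<^sup>2"
        using \<theta>_pos N by (intro mult_left_mono) (auto simp: exp_double)
      also have "(2 * pi / (\<theta> * N)) * (1 / (1 - x)) = pi / b j"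
        using \<theta>_pos N that by (simp add: b_def x_def field_simps)
      finally have "sqrt (pi / b j) \<le> sqrt ((2 * pi / (\<theta> * N)) * (exp x)\<^sup>2)" by (rule real_sqrt_le_mono)
      thus ?thesis unfolding real_sqrt_mult G_def x_def by simp
    qed
    have "(\<Prod>j=1..n. sqrt (pi / b j)) = sqrt (pi / b i) * (\<Prod>j\<in>{1..n} - {i}. sqrt (pi / b j))"
      using i by (intro prod.remove) auto
    also have "\<dots> \<le> (2 * G) * (\<Prod>j\<in>{1..n} - {i}. G * exp (1 / (2 * N)))"
      using Gi Gj G b_pos by (intro mult_mono prod_mono prod_nonneg) (auto simp: less_imp_le)
    also have "(\<Prod>j\<in>{1..n} - {i}. G * exp (1 / (2 * N))) = G ^ (n - 1) * exp (1 / (2 * N)) ^ (n - 1)"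
      using i by (simp add: power_mult_distrib)
    also have "exp (1 / (2 * N)) ^ (n - 1) = exp (1/2)"
      using N n by (simp add: N_def field_simps of_nat_diff flip: exp_of_nat_mult)
    also have "2 * G * (G ^ (n - 1) * exp (1/2)) = 2 * exp (1/2) * G ^ n"
      using n by (cases n) auto
    also have "\<dots> \<le> 4 * G ^ n"
    proof -
      have "exp (1/2) ^ 2 \<le> (2 :: real) ^ 2" using exp_le by (simp flip: exp_double)
      hence "exp (1/2) \<le> (2 :: real)" by (rule power2_le_imp_le) simp
      thus ?thesis using G by (intro mult_right_mono) auto
    qed
    finally show "(\<Prod>j=1..n. sqrt (pi / b j)) \<le> 4 * G ^ n" .
  qed
  finally show ?thesis unfolding G_def N_def .
qed

lemma gauss_product_eq:
  fixes z :: "nat \<Rightarrow> real"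
  assumes n: "n \<ge> 2"
  shows "(\<integral>\<^sup>+\<phi>. ennreal (exp (- (\<theta> * (real n - 1) / 2 * (\<Sum>j=1..n. (\<phi> j - z j)\<^sup>2)))) \<partial>PiM {1..n} (\<lambda>_. lborel))
    = ennreal (sqrt (2 * pi / (\<theta> * (real n - 1))) ^ n)"
proof -
  define a where "a = \<theta> * (real n - 1) / 2"
  have a: "a > 0" using n \<theta>_pos by (simp add: a_def)
  have "(\<integral>\<^sup>+\<phi>. ennreal (exp (- (a * (\<Sum>j=1..n. (\<phi> j - z j)\<^sup>2)))) \<partial>PiM {1..n} (\<lambda>_. lborel))
    = (\<integral>\<^sup>+\<phi>. (\<Prod>j=1..n. ennreal (exp (- (a * (\<phi> j - z j)\<^sup>2)))) \<partial>PiM {1..n} (\<lambda>_. lborel))"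
    by (intro nn_integral_cong) (simp add: prod_ennreal sum_distrib_left exp_sum flip: sum_negf)
  also have "\<dots> = (\<Prod>j=1..n. \<integral>\<^sup>+x. ennreal (exp (- (a * (x - z j)\<^sup>2))) \<partial>lborel)"
    by (intro PL.product_nn_integral_prod) auto
  also have "\<dots> = (\<Prod>j=1..n. ennreal (sqrt (pi / a)))"
    by (intro prod.cong refl ennreal_gauss_integral a)
  also have "\<dots> = ennreal (sqrt (pi / a) ^ n)" using a by (simp add: ennreal_power)
  also have "pi / a = 2 * pi / (\<theta> * (real n - 1))" by (simp add: a_def)
  finally show ?thesis unfolding a_def .
qed

text \<open>On the product of graphs and fields, integrating out the field gives
  \<open>W * G\<close> and summing out the graphs gives \<open>c * Z\<close>. Each half of
  \<open>star_energy_exp_le\<close> is evaluated where it is explicit: the tilt \<open>D\<close> in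
  the field measure, the Gaussian term \<open>X\<close> conditionally on the graph.\<close>

lemma star_energy_exp_moment:
  "\<exists>C>0. \<forall>n\<ge>3. \<forall>i\<in>{1..n}.
     (\<Sum>g\<in>graphs n. exp (energy \<theta> \<beta> n g) * exp (star_energy n g i / 16)) \<le> C * (\<Sum>g\<in>graphs n. exp (energy \<theta> \<beta> n g))"
proof -
  obtain C where C: "C > 0" and C_le: "\<forall>I k. finite I \<and> card I \<ge> 2 \<and> k \<notin> I \<longrightarrow>
     (\<integral>\<^sup>+\<phi>. ennreal (exp (- pair_energy (insert k I) \<phi> + 1/2 * (\<Sum>j\<in>I. h (\<phi> k) (\<phi> j)))) \<partial>PiM (insert k I) (\<lambda>_. lborel))
       \<le> ennreal C * Z (insert k I) 1"
    using star_exp_moment by (elim exE conjE) (rule that)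
  have "(\<Sum>g\<in>graphs n. exp (energy \<theta> \<beta> n g) * exp (star_energy n g i / 16))
      \<le> (C + 4) * (\<Sum>g\<in>graphs n. exp (energy \<theta> \<beta> n g))" if n: "n \<ge> 3" and i: "i \<in> {1..n}" for n i
  proof -
    let ?M = "PiM {1..n} (\<lambda>_. lborel :: real measure)"
    define W where "W = (\<Sum>g\<in>graphs n. exp (energy \<theta> \<beta> n g))"
    define G where "G = sqrt (2 * pi / (\<theta> * (real n - 1))) ^ n"
    have G: "G > 0" using n \<theta>_pos by (simp add: G_def)
    have W: "W \<ge> 0" unfolding W_def by (intro sum_nonneg) auto
    define \<gamma> where "\<gamma> g \<phi> = exp (- (\<theta> * (real n - 1) / 2 * (\<Sum>j=1..n. (\<phi> j - zdeg n g j)\<^sup>2)))" for g \<phi>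
    define D where "D \<phi> = exp (1/2 * (\<Sum>j\<in>{1..n} - {i}. h (\<phi> i) (\<phi> j)))" for \<phi>
    define X where "X g \<phi> = exp (\<Sum>j=1..n. (\<theta> / 4 + (if j = i then \<theta> * (real n - 1) / 8 else 0)) * (\<phi> j - zdeg n g j)\<^sup>2)" for g \<phi>
    obtain c where c: "c > 0" "\<And>\<phi>. (\<Sum>g\<in>graphs n. exp (energy \<theta> \<beta> n g) * \<gamma> g \<phi>) = c * exp (- pair_energy {1..n} \<phi>)"
      using hubbard_stratonovich[of n] unfolding \<gamma>_def by (auto simp: exp_add[symmetric])
    have comp: "(\<lambda>\<phi>. \<phi> j) \<in> borel_measurable ?M" if "j \<in> {1..n}" for j
      using measurable_component_singleton[OF that, of "\<lambda>_. lborel :: real measure"] by simp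
    have HI_m [measurable]: "pair_energy {1..n} \<in> borel_measurable ?M" by (rule pair_energy_measurable) simp
    have D_m [measurable]: "D \<in> borel_measurable ?M"
      using star_measurable[of i "{1..n}" "{1..n} - {i}"] i unfolding D_def [abs_def] by measurable
    have \<gamma>_m [measurable]: "\<gamma> g \<in> borel_measurable ?M" for g
      unfolding \<gamma>_def [abs_def] using comp by (intro measurable_compose[OF _ borel_measurable_exp] borel_measurable_uminus
         borel_measurable_times borel_measurable_sum borel_measurable_power borel_measurable_diff borel_measurable_const) auto
    have X_m [measurable]: "X g \<in> borel_measurable ?M" for g
      unfolding X_def [abs_def] using comp by (intro measurable_compose[OF _ borel_measurable_exp]
         borel_measurable_times borel_measurable_sum borel_measurable_power borel_measurable_diff borel_measurable_const) auto
    have pos: "\<gamma> g \<phi> > 0" "D \<phi> > 0" "X g \<phi> > 0" for g \<phi> by (simp_all add: \<gamma>_def D_def X_def)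
    have aux: "a \<le> b + c" if "a \<le> (exp x + exp y) / 2" "b = exp x" "c = exp y" for a b c x y :: real
    proof -
      have "0 < b" "0 < c" using that(2,3) by simp_all
      moreover have "a \<le> b / 2 + c / 2" using that by (simp add: add_divide_distrib)
      ultimately show ?thesis by linarith
    qed
    note One_nat_def [simp del]
    have int_\<gamma>: "(\<integral>\<^sup>+\<phi>. ennreal (\<gamma> g \<phi>) \<partial>?M) = ennreal G" for g
      unfolding \<gamma>_def G_def using n by (intro gauss_product_eq) auto
    have int_X: "(\<integral>\<^sup>+\<phi>. ennreal (\<gamma> g \<phi> * X g \<phi>) \<partial>?M) \<le> ennreal (4 * G)" for g
      unfolding \<gamma>_def X_def G_def using n i by (intro gauss_product_le) auto
    have sum_int: "ennreal (\<Sum>g\<in>graphs n. exp (energy \<theta> \<beta> n g) * f g) * ennreal G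
        = (\<integral>\<^sup>+\<phi>. ennreal (\<Sum>g\<in>graphs n. exp (energy \<theta> \<beta> n g) * f g * \<gamma> g \<phi>) \<partial>?M)" if f: "\<And>g. f g \<ge> 0" for f
    proof -
      have "(\<integral>\<^sup>+\<phi>. ennreal (\<Sum>g\<in>graphs n. exp (energy \<theta> \<beta> n g) * f g * \<gamma> g \<phi>) \<partial>?M)
         = (\<integral>\<^sup>+\<phi>. (\<Sum>g\<in>graphs n. ennreal (exp (energy \<theta> \<beta> n g) * f g) * ennreal (\<gamma> g \<phi>)) \<partial>?M)"
        using f pos by (intro nn_integral_cong) (simp add: ennreal_mult less_imp_le sum_ennreal[symmetric])
      also have "\<dots> = (\<Sum>g\<in>graphs n. ennreal (exp (energy \<theta> \<beta> n g) * f g) * ennreal G)"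
        by (subst nn_integral_sum) (auto simp: nn_integral_cmult int_\<gamma>)
      also have "\<dots> = ennreal (\<Sum>g\<in>graphs n. exp (energy \<theta> \<beta> n g) * f g) * ennreal G"
        using f by (simp add: sum_ennreal flip: sum_distrib_right)
      finally show ?thesis ..
    qed
    have ins: "insert i ({1..n} - {i}) = {1..n}" using i by auto
    have ZW: "ennreal c * Z {1..n} 1 = ennreal W * ennreal G"
    proof -
      have "ennreal W * ennreal G = (\<integral>\<^sup>+\<phi>. ennreal (c * exp (- pair_energy {1..n} \<phi>)) \<partial>?M)"
        using sum_int[of "\<lambda>_. 1"] by (simp add: W_def c(2))
      also have "\<dots> = ennreal c * Z {1..n} 1"
        unfolding Z_def using c(1) by (simp add: ennreal_mult nn_integral_cmult less_imp_le)
      finally show ?thesis ..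
    qed
    have "ennreal (\<Sum>g\<in>graphs n. exp (energy \<theta> \<beta> n g) * exp (star_energy n g i / 16)) * ennreal G
       = (\<integral>\<^sup>+\<phi>. ennreal (\<Sum>g\<in>graphs n. exp (energy \<theta> \<beta> n g) * exp (star_energy n g i / 16) * \<gamma> g \<phi>) \<partial>?M)"
      by (rule sum_int) simp
    also have "\<dots> \<le> (\<integral>\<^sup>+\<phi>. ennreal (c * (exp (- pair_energy {1..n} \<phi>) * D \<phi>)) +
          (\<Sum>g\<in>graphs n. ennreal (exp (energy \<theta> \<beta> n g)) * ennreal (\<gamma> g \<phi> * X g \<phi>)) \<partial>?M)"
    proof (intro nn_integral_mono)
      fix \<phi> :: "nat \<Rightarrow> real"
      have "(\<Sum>g\<in>graphs n. exp (energy \<theta> \<beta> n g) * exp (star_energy n g i / 16) * \<gamma> g \<phi>)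
         \<le> (\<Sum>g\<in>graphs n. exp (energy \<theta> \<beta> n g) * (D \<phi> + X g \<phi>) * \<gamma> g \<phi>)"
      proof (intro sum_mono mult_right_mono mult_left_mono)
        fix g
        show "exp (star_energy n g i / 16) \<le> D \<phi> + X g \<phi>"
          using aux[OF star_energy_exp_le[OF i, of g \<phi>]] by (simp add: D_def X_def)
      qed (auto simp: pos less_imp_le)
      also have "\<dots> = c * (exp (- pair_energy {1..n} \<phi>) * D \<phi>) + (\<Sum>g\<in>graphs n. exp (energy \<theta> \<beta> n g) * (\<gamma> g \<phi> * X g \<phi>))"
        unfolding mult.assoc[symmetric] c(2)[symmetric] sum_distrib_right sum.distrib[symmetric]
        by (intro sum.cong) (auto simp: algebra_simps)
      finally have "ennreal (\<Sum>g\<in>graphs n. exp (energy \<theta> \<beta> n g) * exp (star_energy n g i / 16) * \<gamma> g \<phi>)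
        \<le> ennreal (c * (exp (- pair_energy {1..n} \<phi>) * D \<phi>) + (\<Sum>g\<in>graphs n. exp (energy \<theta> \<beta> n g) * (\<gamma> g \<phi> * X g \<phi>)))"
        by (rule ennreal_leI)
      also have "\<dots> = ennreal (c * (exp (- pair_energy {1..n} \<phi>) * D \<phi>)) + ennreal (\<Sum>g\<in>graphs n. exp (energy \<theta> \<beta> n g) * (\<gamma> g \<phi> * X g \<phi>))"
        using c(1) pos by (intro ennreal_plus sum_nonneg mult_nonneg_nonneg) (auto simp: less_imp_le)
      also have "ennreal (\<Sum>g\<in>graphs n. exp (energy \<theta> \<beta> n g) * (\<gamma> g \<phi> * X g \<phi>))
         = (\<Sum>g\<in>graphs n. ennreal (exp (energy \<theta> \<beta> n g)) * ennreal (\<gamma> g \<phi> * X g \<phi>))"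
        using pos by (subst sum_ennreal[symmetric]) (auto simp: less_imp_le ennreal_mult intro!: sum.cong)
      finally show "ennreal (\<Sum>g\<in>graphs n. exp (energy \<theta> \<beta> n g) * exp (star_energy n g i / 16) * \<gamma> g \<phi>)
        \<le> ennreal (c * (exp (- pair_energy {1..n} \<phi>) * D \<phi>)) + (\<Sum>g\<in>graphs n. ennreal (exp (energy \<theta> \<beta> n g)) * ennreal (\<gamma> g \<phi> * X g \<phi>))" .
    qed
    also have "\<dots> = ennreal c * (\<integral>\<^sup>+\<phi>. ennreal (exp (- pair_energy {1..n} \<phi>) * D \<phi>) \<partial>?M)
        + (\<Sum>g\<in>graphs n. ennreal (exp (energy \<theta> \<beta> n g)) * (\<integral>\<^sup>+\<phi>. ennreal (\<gamma> g \<phi> * X g \<phi>) \<partial>?M))"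
      using c(1) pos by (simp add: nn_integral_add nn_integral_sum nn_integral_cmult ennreal_mult[of c] less_imp_le)
    also have "\<dots> \<le> ennreal c * (ennreal C * Z {1..n} 1) + (\<Sum>g\<in>graphs n. ennreal (exp (energy \<theta> \<beta> n g)) * ennreal (4 * G))"
    proof (intro add_mono mult_left_mono sum_mono int_X)
      show "(\<integral>\<^sup>+\<phi>. ennreal (exp (- pair_energy {1..n} \<phi>) * D \<phi>) \<partial>?M) \<le> ennreal C * Z {1..n} 1"
        using C_le[rule_format, of "{1..n} - {i}" i] n i unfolding ins D_def exp_add[symmetric] by simp
    qed auto
    also have "\<dots> = ennreal C * (ennreal W * ennreal G) + ennreal W * ennreal (4 * G)"
      unfolding mult.left_commute[of "ennreal c"] ZW W_def
      by (simp add: sum_ennreal flip: sum_distrib_right)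
    also have "\<dots> = ennreal ((C + 4) * W) * ennreal G"
      using C W G by (simp add: algebra_simps flip: ennreal_mult ennreal_plus)
    finally have "ennreal ((\<Sum>g\<in>graphs n. exp (energy \<theta> \<beta> n g) * exp (star_energy n g i / 16)) * G)
       \<le> ennreal (((C + 4) * W) * G)"
      using G C W by (simp add: ennreal_mult sum_nonneg)
    hence "(\<Sum>g\<in>graphs n. exp (energy \<theta> \<beta> n g) * exp (star_energy n g i / 16)) * G \<le> ((C + 4) * W) * G"
      using G C W by (subst (asm) ennreal_le_iff) auto
    thus ?thesis using G by (simp add: W_def)
  qed
  thus ?thesis using C by (intro exI[of _ "C + 4"]) auto
qed

end

section \<open>Toggling an edge and the Stein identity\<close>

text \<open>Truncated subtraction is an involution only on 0/1 entries, which is why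
  \<open>toggle_toggle\<close> asks for a graph.\<close>

definition toggle :: "nat \<Rightarrow> nat \<Rightarrow> (nat \<Rightarrow> nat \<Rightarrow> nat) \<Rightarrow> nat \<Rightarrow> nat \<Rightarrow> nat" where
  "toggle i j g = (\<lambda>a b. if a = i \<and> b = j \<or> a = j \<and> b = i then 1 - g a b else g a b)"

lemma toggle_graph:
  assumes "g \<in> graphs n" "i \<in> {1..n}" "j \<in> {1..n}" "i \<noteq> j"
  shows "toggle i j g \<in> graphs n"
  using assms unfolding graphs_def toggle_def by auto

lemma toggle_toggle: "g \<in> graphs n \<Longrightarrow> toggle i j (toggle i j g) = g"
proof -
  assume g: "g \<in> graphs n"
  have "g a b \<le> 1" for a b
  proof -
    have "g a b \<in> {0, 1}" using g by (auto simp: graphs_def)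
    thus ?thesis by auto
  qed
  hence "1 - (1 - g a b) = g a b" for a b by (metis diff_diff_cancel)
  thus ?thesis by (intro ext) (auto simp: toggle_def)
qed

lemma spin_cases: "g \<in> graphs n \<Longrightarrow> spin g i j = 1 \<or> spin g i j = -1"
proof -
  assume "g \<in> graphs n"
  hence "g i j \<in> {0, 1}" by (auto simp: graphs_def)
  thus ?thesis by (auto simp: spin_def)
qed

lemma spin_toggle: "g \<in> graphs n \<Longrightarrow> spin (toggle i j g) i j = - spin g i j"
proof -
  assume "g \<in> graphs n"
  hence "g i j \<in> {0, 1}" by (auto simp: graphs_def)
  thus ?thesis by (auto simp: spin_def toggle_def)
qed

lemma zdeg_toggle:
  assumes g: "g \<in> graphs n" and ij: "i \<in> {1..n}" "j \<in> {1..n}" "i \<noteq> j"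
  shows "zdeg n (toggle i j g) l = zdeg n g l - (if l = i \<or> l = j then 2 * spin g i j / (real n - 1) else 0)"
proof -
  have v: "g i j \<in> {0, 1}" using g by (auto simp: graphs_def)
  have s: "g j i = g i j" using graph_sym[OF g] .
  have *: "real (vdeg n (toggle i j g) l) = real (vdeg n g l) - (if l = i \<or> l = j then spin g i j else 0)"
  proof -
    have "real (vdeg n (toggle i j g) l) - real (vdeg n g l) = (\<Sum>k=1..n. real (toggle i j g l k) - real (g l k))"
      by (simp add: vdeg_def sum_subtractf)
    also have "\<dots> = (\<Sum>k=1..n. if k = (if l = i then j else i) then (if l = i \<or> l = j then - spin g i j else 0) else 0)"
      using v s ij(3) by (intro sum.cong refl) (auto simp: toggle_def spin_def)
    also have "\<dots> = (if l = i \<or> l = j then - spin g i j else 0)"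
      using ij by (subst sum.delta) auto
    finally show ?thesis by (cases "l = i \<or> l = j") simp_all
  qed
  show ?thesis unfolding zdeg_def * by (simp add: diff_divide_distrib add_divide_distrib)
qed

text \<open>The field felt by the spin of the pair \<open>{i, j}\<close>; the subtracted self-interaction makes it
  invariant under toggling.\<close>
definition edge_field :: "real \<Rightarrow> real \<Rightarrow> nat \<Rightarrow> nat \<Rightarrow> nat \<Rightarrow> (nat \<Rightarrow> nat \<Rightarrow> nat) \<Rightarrow> real" where
  "edge_field \<theta> \<beta> n i j g = \<theta> * (zdeg n g i + zdeg n g j) + \<beta> - 2 * \<theta> * spin g i j / (real n - 1)"

lemma edge_field_toggle:
  assumes g: "g \<in> graphs n" and ij: "i \<in> {1..n}" "j \<in> {1..n}" "i \<noteq> j"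
  shows "edge_field \<theta> \<beta> n i j (toggle i j g) = edge_field \<theta> \<beta> n i j g"
  using spin_toggle[OF g, of i j] unfolding edge_field_def zdeg_toggle[OF assms] by (simp add: field_simps)

lemma sum_two_changed:
  fixes f f' :: "nat \<Rightarrow> real"
  assumes ij: "i \<in> {1..n}" "j \<in> {1..n}" "i \<noteq> j" and eq: "\<And>l. l \<noteq> i \<Longrightarrow> l \<noteq> j \<Longrightarrow> f' l = f l"
  shows "(\<Sum>l=1..n. f l) - (\<Sum>l=1..n. f' l) = (f i - f' i) + (f j - f' j)"
proof -
  have "(\<Sum>l=1..n. f l) - (\<Sum>l=1..n. f' l) = (\<Sum>l=1..n. f l - f' l)" by (simp add: sum_subtractf)
  also have "\<dots> = (\<Sum>l\<in>{i, j}. f l - f' l)"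
    using ij eq by (intro sum.mono_neutral_right) auto
  finally show ?thesis using ij by simp
qed

text \<open>Two coordinates move by \<open>2 * Y / N\<close>; the second-order part of their squares
  is exactly the self-interaction subtracted in \<open>edge_field\<close>. The spin given all other
  edges therefore has log-odds twice the field.\<close>

lemma energy_toggle:
  assumes g: "g \<in> graphs n" and ij: "i \<in> {1..n}" "j \<in> {1..n}" "i \<noteq> j"
  shows "energy \<theta> \<beta> n (toggle i j g) = energy \<theta> \<beta> n g - 2 * spin g i j * edge_field \<theta> \<beta> n i j g"
proof -
  define N where "N = real n - 1"
  define Y where "Y = spin g i j"
  let ?z = "zdeg n g" and ?z' = "zdeg n (toggle i j g)"
  have N: "N > 0" using ij by (auto simp: N_def)
  have Y2: "Y * Y = 1" using spin_cases[OF g, of i j] by (auto simp: Y_def)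
  have z': "?z' l = ?z l - (if l = i \<or> l = j then 2 * Y / N else 0)" for l
    using zdeg_toggle[OF assms] unfolding Y_def N_def .
  have 1: "(\<Sum>l=1..n. ?z l) - (\<Sum>l=1..n. ?z' l) = 4 * Y / N"
    using sum_two_changed[OF ij, of ?z' ?z] by (simp add: z' add_divide_distrib)
  have "(\<Sum>l=1..n. (?z l)\<^sup>2) - (\<Sum>l=1..n. (?z' l)\<^sup>2) = ((?z i)\<^sup>2 - (?z' i)\<^sup>2) + ((?z j)\<^sup>2 - (?z' j)\<^sup>2)"
    by (rule sum_two_changed[OF ij]) (simp add: z')
  also have "\<dots> = 4 * Y / N * (?z i + ?z j) - 8 * (Y * Y) / N\<^sup>2"
    using \<open>N > 0\<close> by (simp add: z' power2_eq_square field_simps)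
  finally have 2: "(\<Sum>l=1..n. (?z l)\<^sup>2) - (\<Sum>l=1..n. (?z' l)\<^sup>2) = 4 * Y / N * (?z i + ?z j) - 8 * (Y * Y) / N\<^sup>2" .
  have "energy \<theta> \<beta> n g - energy \<theta> \<beta> n (toggle i j g)
     = N * (\<theta> / 2 * ((\<Sum>l=1..n. (?z l)\<^sup>2) - (\<Sum>l=1..n. (?z' l)\<^sup>2)) + \<beta> / 2 * ((\<Sum>l=1..n. ?z l) - (\<Sum>l=1..n. ?z' l)))"
    by (simp add: energy_def N_def algebra_simps)
  also have "\<dots> = 2 * Y * (\<theta> * (?z i + ?z j) + \<beta> - 2 * \<theta> * Y / N)"
    unfolding 1 2 using N by (simp add: field_simps power2_eq_square)
  finally show ?thesis by (simp add: edge_field_def Y_def N_def)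
qed

definition gibbs_mean :: "real \<Rightarrow> real \<Rightarrow> nat \<Rightarrow> ((nat \<Rightarrow> nat \<Rightarrow> nat) \<Rightarrow> real) \<Rightarrow> real" where
  "gibbs_mean \<theta> \<beta> n X = (\<Sum>g\<in>graphs n. exp (energy \<theta> \<beta> n g) * X g) / (\<Sum>g\<in>graphs n. exp (energy \<theta> \<beta> n g))"

lemma partition_pos: "(\<Sum>g\<in>graphs n. exp (energy \<theta> \<beta> n g)) > 0"
proof -
  have "(\<lambda>i j. 0) \<in> graphs n" by (simp add: graphs_def)
  thus ?thesis by (intro sum_pos finite_graphs) auto
qed

lemma gibbs_mean_cong: "(\<And>g. g \<in> graphs n \<Longrightarrow> X g = X' g) \<Longrightarrow> gibbs_mean \<theta> \<beta> n X = gibbs_mean \<theta> \<beta> n X'"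
  unfolding gibbs_mean_def by (intro arg_cong2[of _ _ _ _ "(/)"] sum.cong) auto

lemma gibbs_mean_add: "gibbs_mean \<theta> \<beta> n (\<lambda>g. X g + X' g) = gibbs_mean \<theta> \<beta> n X + gibbs_mean \<theta> \<beta> n X'"
  by (simp add: gibbs_mean_def distrib_left sum.distrib add_divide_distrib)

lemma gibbs_mean_diff: "gibbs_mean \<theta> \<beta> n (\<lambda>g. X g - X' g) = gibbs_mean \<theta> \<beta> n X - gibbs_mean \<theta> \<beta> n X'"
  by (simp add: gibbs_mean_def right_diff_distrib sum_subtractf diff_divide_distrib)

lemma gibbs_mean_cmult: "gibbs_mean \<theta> \<beta> n (\<lambda>g. c * X g) = c * gibbs_mean \<theta> \<beta> n X"
  by (simp add: gibbs_mean_def sum_distrib_left mult_ac)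

lemma gibbs_mean_const: "gibbs_mean \<theta> \<beta> n (\<lambda>g. c) = c"
  using partition_pos[where \<theta> = \<theta> and \<beta> = \<beta> and n = n] by (simp add: gibbs_mean_def flip: sum_distrib_right)

lemma gibbs_mean_sum: "gibbs_mean \<theta> \<beta> n (\<lambda>g. \<Sum>i\<in>I. X i g) = (\<Sum>i\<in>I. gibbs_mean \<theta> \<beta> n (X i))"
  unfolding gibbs_mean_def sum_distrib_left sum_divide_distrib by (rule sum.swap)

lemma gibbs_mean_mono: "(\<And>g. g \<in> graphs n \<Longrightarrow> X g \<le> X' g) \<Longrightarrow> gibbs_mean \<theta> \<beta> n X \<le> gibbs_mean \<theta> \<beta> n X'"
  unfolding gibbs_mean_def by (intro divide_right_mono sum_mono mult_left_mono less_imp_le[OF partition_pos]) auto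

lemma gibbs_mean_nonneg: "(\<And>g. g \<in> graphs n \<Longrightarrow> 0 \<le> X g) \<Longrightarrow> 0 \<le> gibbs_mean \<theta> \<beta> n X"
  using gibbs_mean_mono[of n "\<lambda>_. 0" X \<theta> \<beta>] by (simp add: gibbs_mean_const)

lemma gibbs_mean_abs: "\<bar>gibbs_mean \<theta> \<beta> n X\<bar> \<le> gibbs_mean \<theta> \<beta> n (\<lambda>g. \<bar>X g\<bar>)"
proof -
  have "gibbs_mean \<theta> \<beta> n X \<le> gibbs_mean \<theta> \<beta> n (\<lambda>g. \<bar>X g\<bar>)" by (intro gibbs_mean_mono) auto
  moreover have "gibbs_mean \<theta> \<beta> n (\<lambda>g. (-1) * X g) \<le> gibbs_mean \<theta> \<beta> n (\<lambda>g. \<bar>X g\<bar>)" by (intro gibbs_mean_mono) auto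
  ultimately show ?thesis unfolding gibbs_mean_cmult by auto
qed

lemma gibbs_mean_abs_le: "(\<And>g. g \<in> graphs n \<Longrightarrow> \<bar>X g\<bar> \<le> X' g) \<Longrightarrow> \<bar>gibbs_mean \<theta> \<beta> n X\<bar> \<le> gibbs_mean \<theta> \<beta> n X'"
  using gibbs_mean_abs[of \<theta> \<beta> n X] gibbs_mean_mono[of n "\<lambda>g. \<bar>X g\<bar>" X' \<theta> \<beta>] by simp

text \<open>For a spin with weights e^a at 1 and e^(-a) at -1, its covariance with any function is
  the variance 1 - tanh^2 a times half the increment \<open>F - F'\<close>. This is integration by
  parts on two points, with no remainder.\<close>

lemma two_point_stein:
  fixes a F F' :: real
  shows "exp a * (F - F * tanh a - (1 - (tanh a)\<^sup>2) * (F - F') / 2)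
       + exp (- a) * (- F' - F' * tanh a - (1 - (tanh a)\<^sup>2) * (F - F') / 2) = 0"
proof -
  define p where "p = exp a"
  define q where "q = exp (- a)"
  have pq: "p * q = 1" "p + q > 0" by (simp_all add: p_def q_def add_pos_pos flip: exp_add)
  have T: "tanh a = (p - q) / (p + q)" by (simp add: tanh_altdef p_def q_def)
  have 1: "1 - tanh a = 2 * q / (p + q)" "1 + tanh a = 2 * p / (p + q)"
    using pq(2) by (simp_all add: T field_simps)
  have "1 - (tanh a)\<^sup>2 = (1 - tanh a) * (1 + tanh a)" by (simp add: power2_eq_square algebra_simps)
  also have "\<dots> = 4 * (p * q) / (p + q)\<^sup>2" unfolding 1 by (simp add: power2_eq_square)
  finally have 2: "1 - (tanh a)\<^sup>2 = 4 / (p + q)\<^sup>2" using pq(1) by simp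
  define r where "r = p + q"
  have "p * (F * (2 * q / r)) + q * (- (F' * (2 * p / r))) = (F - F') * (2 / r) * (p * q)"
    by (simp add: algebra_simps diff_divide_distrib)
  hence "p * (F * (1 - tanh a)) + q * (- (F' * (1 + tanh a))) = (F - F') * (2 / (p + q)) * (p * q)"
    unfolding 1 r_def .
  moreover have "(p + q) * ((1 - (tanh a)\<^sup>2) * (F - F') / 2) = (F - F') * (2 / (p + q))"
    unfolding 2 using pq(2) unfolding r_def[symmetric] by (simp add: power2_eq_square field_simps)
  moreover have "p * (F - F * tanh a - V) + q * (- F' - F' * tanh a - V)
      = (p * (F * (1 - tanh a)) + q * (- (F' * (1 + tanh a)))) - (p + q) * V" for V
    by (simp add: algebra_simps)
  ultimately show ?thesis unfolding p_def[symmetric] q_def[symmetric]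
    by (simp only: pq(1) mult_1_right diff_self)
qed

text \<open>Graphs are paired with their toggles. The field is common to both members of a pair, and
  every pair contributes zero by \<open>two_point_stein\<close>.\<close>

lemma stein_identity:
  assumes ij: "i \<in> {1..n}" "j \<in> {1..n}" "i \<noteq> j"
  shows "gibbs_mean \<theta> \<beta> n (\<lambda>g. F g * spin g i j)
    = gibbs_mean \<theta> \<beta> n (\<lambda>g. F g * tanh (edge_field \<theta> \<beta> n i j g)
        + (1 - (tanh (edge_field \<theta> \<beta> n i j g))\<^sup>2) * (spin g i j * (F g - F (toggle i j g)) / 2))"
proof -
  let ?w = "\<lambda>g. exp (energy \<theta> \<beta> n g)"
  define X where "X g = F g * spin g i j - (F g * tanh (edge_field \<theta> \<beta> n i j g)
        + (1 - (tanh (edge_field \<theta> \<beta> n i j g))\<^sup>2) * (spin g i j * (F g - F (toggle i j g)) / 2))" for g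
  have "(\<Sum>g\<in>graphs n. ?w g * X g) = (\<Sum>g\<in>graphs n. ?w (toggle i j g) * X (toggle i j g))"
    by (rule sum.reindex_bij_witness[of _ "toggle i j" "toggle i j"])
       (auto simp: toggle_toggle toggle_graph[OF _ ij])
  hence "2 * (\<Sum>g\<in>graphs n. ?w g * X g) = (\<Sum>g\<in>graphs n. ?w g * X g + ?w (toggle i j g) * X (toggle i j g))"
    by (simp add: sum.distrib)
  also have "\<dots> = (\<Sum>g\<in>graphs n. 0)"
  proof (rule sum.cong)
    fix g assume g: "g \<in> graphs n"
    define a where "a = edge_field \<theta> \<beta> n i j g"
    \<comment> \<open>The factor common to the weights of g and of its toggle.\<close>
    define e where "e = exp (energy \<theta> \<beta> n g - spin g i j * a)"
    have w: "?w g = e * exp (spin g i j * a)" "?w (toggle i j g) = e * exp (- (spin g i j * a))"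
      unfolding energy_toggle[OF g ij] e_def a_def by (simp_all flip: exp_add)
    show "?w g * X g + ?w (toggle i j g) * X (toggle i j g) = 0"
    proof (cases "spin g i j = 1")
      case True
      thus ?thesis unfolding w X_def spin_toggle[OF g] edge_field_toggle[OF g ij] toggle_toggle[OF g] a_def[symmetric]
        using arg_cong[OF two_point_stein[of a "F g" "F (toggle i j g)"], of "\<lambda>x. e * x"]
        by (simp add: algebra_simps)
    next
      case False
      hence s: "spin g i j = -1" using spin_cases[OF g, of i j] by auto
      thus ?thesis unfolding w X_def spin_toggle[OF g] edge_field_toggle[OF g ij] toggle_toggle[OF g] a_def[symmetric]
        using arg_cong[OF two_point_stein[of a "F (toggle i j g)" "F g"], of "\<lambda>x. e * x"]
        by (simp add: algebra_simps)
    qed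
  qed simp
  finally have "gibbs_mean \<theta> \<beta> n X = 0" by (simp add: gibbs_mean_def)
  thus ?thesis unfolding X_def gibbs_mean_diff by simp
qed

section \<open>Centred degrees, their power sums, and sums over ordered pairs\<close>

definition mz :: "nat \<Rightarrow> (nat \<Rightarrow> nat \<Rightarrow> nat) \<Rightarrow> real" where
  "mz n g = (\<Sum>i=1..n. zdeg n g i) / n"

definition yd :: "nat \<Rightarrow> (nat \<Rightarrow> nat \<Rightarrow> nat) \<Rightarrow> nat \<Rightarrow> real" where
  "yd n g i = zdeg n g i - mz n g"

definition S2 :: "nat \<Rightarrow> (nat \<Rightarrow> nat \<Rightarrow> nat) \<Rightarrow> real" where
  "S2 n g = (\<Sum>i=1..n. (yd n g i)\<^sup>2)"

definition S3 :: "nat \<Rightarrow> (nat \<Rightarrow> nat \<Rightarrow> nat) \<Rightarrow> real" where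
  "S3 n g = (\<Sum>i=1..n. yd n g i ^ 3)"

abbreviation offsum :: "nat \<Rightarrow> (nat \<Rightarrow> nat \<Rightarrow> real) \<Rightarrow> real" where
  "offsum n f \<equiv> (\<Sum>i=1..n. \<Sum>j\<in>{1..n} - {i}. f i j)"

lemma offsum_add: "offsum n (\<lambda>i j. f i j + f' i j) = offsum n f + offsum n f'"
  by (simp add: sum.distrib)

lemma offsum_fst: "offsum n (\<lambda>i j. f i) = (real n - 1) * (\<Sum>i=1..n. f i)"
proof -
  have "offsum n (\<lambda>i j. f i) = (\<Sum>i=1..n. (real n - 1) * f i)"
    by (intro sum.cong) (auto simp: of_nat_diff)
  thus ?thesis by (simp add: sum_distrib_left)
qed

lemma offsum_prod:
  "offsum n (\<lambda>i j. a i * b j) = (\<Sum>i=1..n. a i) * (\<Sum>j=1..n. b j) - (\<Sum>i=1..n. a i * b i)"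
proof -
  have "(\<Sum>j\<in>{1..n} - {i}. a i * b j) = a i * (\<Sum>j=1..n. b j) - a i * b i" if "i \<in> {1..n}" for i
    using that by (simp add: sum_diff1 sum_distrib_left)
  thus ?thesis by (simp add: sum_subtractf sum_distrib_right)
qed

lemma sum_yd: "n > 0 \<Longrightarrow> (\<Sum>i=1..n. yd n g i) = 0"
  by (simp add: yd_def sum_subtractf mz_def)

lemma offsum_yd: "n > 0 \<Longrightarrow> offsum n (\<lambda>i j. yd n g i) = 0"
  unfolding offsum_fst by (simp only: sum_yd mult_zero_right)

lemma offsum_yd_add: "n > 0 \<Longrightarrow> offsum n (\<lambda>i j. yd n g i + yd n g j) = 0"
proof -
  assume n: "n > 0"
  have "offsum n (\<lambda>i j. 1 * yd n g j) = 0" unfolding offsum_prod sum_yd[OF n]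
    by (simp only: mult_1 sum_yd[OF n] mult_zero_right diff_self)
  thus ?thesis unfolding offsum_add offsum_yd[OF n] mult_1 add_0 .
qed

text \<open>Centring makes the sum of y_i y_j over i \<noteq> j equal to - \<open>S2\<close>; with
  the n - 1 copies of each y_i^2 this leaves n - 2.\<close>

lemma offsum_yd_linear:
  "n > 0 \<Longrightarrow> offsum n (\<lambda>i j. yd n g i * (yd n g i + yd n g j)) = (real n - 2) * S2 n g"
proof -
  assume n: "n > 0"
  have "offsum n (\<lambda>i j. yd n g i * (yd n g i + yd n g j))
      = offsum n (\<lambda>i j. (yd n g i)\<^sup>2) + offsum n (\<lambda>i j. yd n g i * yd n g j)"
    by (simp add: distrib_left power2_eq_square sum.distrib)
  also have "\<dots> = (real n - 1) * S2 n g - S2 n g"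
    unfolding offsum_fst offsum_prod sum_yd[OF n] by (simp add: S2_def power2_eq_square)
  finally show ?thesis by (simp add: algebra_simps)
qed

lemma offsum_yd_square_linear:
  "n > 0 \<Longrightarrow> offsum n (\<lambda>i j. (yd n g i)\<^sup>2 * (yd n g i + yd n g j)) = (real n - 2) * S3 n g"
proof -
  assume n: "n > 0"
  have "offsum n (\<lambda>i j. (yd n g i)\<^sup>2 * (yd n g i + yd n g j))
      = offsum n (\<lambda>i j. yd n g i ^ 3) + offsum n (\<lambda>i j. (yd n g i)\<^sup>2 * yd n g j)"
    by (simp add: distrib_left power2_eq_square power3_eq_cube sum.distrib)
  also have "\<dots> = (real n - 1) * S3 n g - S3 n g"
    unfolding offsum_fst offsum_prod sum_yd[OF n] by (simp add: S3_def power2_eq_square power3_eq_cube mult.assoc)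
  finally show ?thesis by (simp add: algebra_simps)
qed

text \<open>n - 4 is n - 1 from the cubes, minus 2 from the mixed term and minus 1 from y_i y_j^2,
  both by centring.\<close>

lemma offsum_yd_quadratic:
  "n > 0 \<Longrightarrow> offsum n (\<lambda>i j. yd n g i * (yd n g i + yd n g j)\<^sup>2) = (real n - 4) * S3 n g"
proof -
  assume n: "n > 0"
  have "offsum n (\<lambda>i j. yd n g i * (yd n g i + yd n g j)\<^sup>2)
      = offsum n (\<lambda>i j. yd n g i ^ 3 + 2 * ((yd n g i)\<^sup>2 * yd n g j) + yd n g i * (yd n g j)\<^sup>2)"
    by (intro sum.cong refl) (simp add: power2_eq_square power3_eq_cube algebra_simps)
  also have "\<dots> = offsum n (\<lambda>i j. yd n g i ^ 3) + 2 * offsum n (\<lambda>i j. (yd n g i)\<^sup>2 * yd n g j) + offsum n (\<lambda>i j. yd n g i * (yd n g j)\<^sup>2)"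
    by (simp add: sum.distrib sum_distrib_left)
  also have "\<dots> = (real n - 1) * S3 n g - 2 * S3 n g - S3 n g"
    unfolding offsum_fst offsum_prod sum_yd[OF n] by (simp add: S3_def power2_eq_square power3_eq_cube mult.assoc)
  finally show ?thesis by (simp add: algebra_simps)
qed

lemma offsum_spin:
  assumes g: "g \<in> graphs n"
  shows "offsum n (\<lambda>i j. f i * spin g i j) = (real n - 1) * (\<Sum>i=1..n. f i * zdeg n g i)"
proof -
  have "offsum n (\<lambda>i j. f i * spin g i j) = (\<Sum>i=1..n. f i * ((real n - 1) * zdeg n g i))"
    by (intro sum.cong refl) (simp add: zdeg_spin[OF g] flip: sum_distrib_left)
  thus ?thesis by (simp add: sum_distrib_left mult_ac)
qed

text \<open>The left side of the summed Stein identity: the spins at i add up to (n - 1) z_i, and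
  centring removes the mean from z_i.\<close>

lemma offsum_spin_yd:
  assumes g: "g \<in> graphs n" and n: "n > 0"
  shows "offsum n (\<lambda>i j. yd n g i * spin g i j) = (real n - 1) * S2 n g"
proof -
  have "(\<Sum>i=1..n. yd n g i * zdeg n g i) = (\<Sum>i=1..n. (yd n g i)\<^sup>2 + mz n g * yd n g i)"
    by (intro sum.cong) (auto simp: yd_def power2_eq_square algebra_simps)
  also have "\<dots> = S2 n g" using sum_yd[OF n] by (simp add: sum.distrib S2_def flip: sum_distrib_left)
  finally show ?thesis using offsum_spin[OF g, of "yd n g"] by simp
qed

lemma offsum_spin_yd_square:
  assumes g: "g \<in> graphs n" and n: "n > 0"
  shows "offsum n (\<lambda>i j. (yd n g i)\<^sup>2 * spin g i j) = (real n - 1) * (S3 n g + mz n g * S2 n g)"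
proof -
  have "(\<Sum>i=1..n. (yd n g i)\<^sup>2 * zdeg n g i) = (\<Sum>i=1..n. yd n g i ^ 3 + mz n g * (yd n g i)\<^sup>2)"
    by (intro sum.cong) (auto simp: yd_def power2_eq_square power3_eq_cube algebra_simps)
  also have "\<dots> = S3 n g + mz n g * S2 n g" by (simp add: sum.distrib S2_def S3_def flip: sum_distrib_left)
  finally show ?thesis using offsum_spin[OF g, of "\<lambda>i. (yd n g i)\<^sup>2"] by simp
qed

lemma offsum_spin_one:
  assumes g: "g \<in> graphs n" and n: "n > 0"
  shows "offsum n (\<lambda>i j. spin g i j) = (real n - 1) * (real n * mz n g)"
  using offsum_spin[OF g, of "\<lambda>_. 1"] n by (simp add: mz_def)

lemma mz_toggle:
  assumes g: "g \<in> graphs n" and ij: "i \<in> {1..n}" "j \<in> {1..n}" "i \<noteq> j"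
  shows "mz n (toggle i j g) = mz n g - 4 * spin g i j / (real n * (real n - 1))"
proof -
  have "(\<Sum>l=1..n. zdeg n g l) - (\<Sum>l=1..n. zdeg n (toggle i j g) l) = 4 * spin g i j / (real n - 1)"
    using sum_two_changed[OF ij, of "zdeg n (toggle i j g)" "zdeg n g"]
    by (simp add: zdeg_toggle[OF assms] add_divide_distrib)
  hence "mz n g - mz n (toggle i j g) = 4 * spin g i j / (real n - 1) / n"
    by (simp add: mz_def flip: diff_divide_distrib)
  thus ?thesis by (simp add: mult.commute)
qed

lemma yd_toggle:
  assumes g: "g \<in> graphs n" and ij: "i \<in> {1..n}" "j \<in> {1..n}" "i \<noteq> j"
  shows "yd n (toggle i j g) i = yd n g i - 2 * spin g i j * ((real n - 2) / (real n * (real n - 1)))"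
proof -
  define N where "N = real n - 1"
  define M where "M = real n"
  have "N > 0" "M > 0" using ij by (auto simp: N_def M_def)
  hence "2 * spin g i j * ((M - 2) / (M * N)) = 2 * spin g i j / N - 4 * spin g i j / (M * N)"
    by (simp add: field_simps)
  hence "2 * spin g i j * ((real n - 2) / (real n * (real n - 1)))
     = 2 * spin g i j / (real n - 1) - 4 * spin g i j / (real n * (real n - 1))"
    unfolding N_def M_def .
  thus ?thesis
    unfolding yd_def mz_toggle[OF assms] zdeg_toggle[OF assms] by simp
qed

lemma S2_eq: "n > 0 \<Longrightarrow> S2 n g = (\<Sum>i=1..n. (zdeg n g i)\<^sup>2) - n * (mz n g)\<^sup>2"
proof -
  assume n: "n > 0"
  have s: "(\<Sum>i=1..n. zdeg n g i) = n * mz n g" using n by (simp add: mz_def)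
  have "S2 n g = (\<Sum>i=1..n. (zdeg n g i)\<^sup>2) - 2 * mz n g * (\<Sum>i=1..n. zdeg n g i) + n * (mz n g)\<^sup>2"
    by (simp add: S2_def yd_def power2_diff sum.distrib sum_subtractf sum_distrib_left mult_ac)
  thus ?thesis unfolding s by (simp add: power2_eq_square algebra_simps)
qed

lemma S2_toggle:
  assumes g: "g \<in> graphs n" and ij: "i \<in> {1..n}" "j \<in> {1..n}" "i \<noteq> j"
  shows "S2 n g - S2 n (toggle i j g) = 4 * spin g i j / (real n - 1) *
     (yd n g i + yd n g j - 2 * spin g i j * ((real n - 2) / (real n * (real n - 1))))"
proof -
  define N where "N = real n - 1"
  define Y where "Y = spin g i j"
  define M where "M = real n"
  let ?z = "zdeg n g" and ?z' = "zdeg n (toggle i j g)"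
  have n: "n > 0" "N > 0" "M > 0" using ij by (auto simp: N_def M_def)
  have Y2: "Y * Y = 1" using spin_cases[OF g, of i j] by (auto simp: Y_def)
  have z': "?z' l = ?z l - (if l = i \<or> l = j then 2 * Y / N else 0)" for l
    using zdeg_toggle[OF assms] unfolding Y_def N_def .
  have m': "mz n (toggle i j g) = mz n g - 4 * Y / (M * N)"
    using mz_toggle[OF assms] unfolding Y_def N_def M_def .
  have "(\<Sum>l=1..n. (?z l)\<^sup>2) - (\<Sum>l=1..n. (?z' l)\<^sup>2) = ((?z i)\<^sup>2 - (?z' i)\<^sup>2) + ((?z j)\<^sup>2 - (?z' j)\<^sup>2)"
    by (rule sum_two_changed[OF ij]) (simp add: z')
  also have "\<dots> = 4 * Y / N * (?z i + ?z j) - 8 * (Y * Y) / N\<^sup>2"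
    using \<open>N > 0\<close> by (simp add: z' power2_eq_square field_simps)
  finally have "S2 n g - S2 n (toggle i j g) = 4 * Y / N * (?z i + ?z j) - 8 * (Y * Y) / N\<^sup>2
     - M * ((mz n g)\<^sup>2 - (mz n g - 4 * Y / (M * N))\<^sup>2)"
    unfolding S2_eq[OF n(1)] m' by (simp add: M_def algebra_simps)
  also have "\<dots> = 4 * Y / N * (yd n g i + yd n g j - 2 * Y * ((M - 2) / (M * N)))"
    unfolding yd_def using n by (simp add: field_simps power2_eq_square)
  finally show ?thesis unfolding Y_def N_def M_def .
qed

section \<open>Error scales\<close>

lemma taylor2_bound:
  fixes f f' f'' :: "real \<Rightarrow> real"
  assumes f: "\<And>x. (f has_real_derivative f' x) (at x)" "\<And>x. (f' has_real_derivative f'' x) (at x)"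
    and B: "\<And>x. \<bar>f'' x\<bar> \<le> B"
  shows "\<bar>f (a + s) - f a - f' a * s\<bar> \<le> B / 2 * s\<^sup>2"
proof -
  define df where "df n x = (if n = 0 then f (a + x) else if n = 1 then f' (a + x) else f'' (a + x))" for n :: nat and x
  have shift: "((\<lambda>x. g (a + x)) has_real_derivative g' (a + x)) (at x)"
    if "\<And>x. (g has_real_derivative g' x) (at x)" for g g' :: "real \<Rightarrow> real" and x
    using that[of "x + a"] by (simp add: DERIV_shift add.commute[of a])
  have "\<exists>t. \<bar>t\<bar> \<le> \<bar>s\<bar> \<and> f (a + s) = (\<Sum>m<2. df m 0 / fact m * s ^ m) + df 2 t / fact 2 * s ^ 2"
  proof (rule Maclaurin_bi_le)
    show "df 0 = (\<lambda>x. f (a + x))" by (simp add: df_def fun_eq_iff)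
    show "\<forall>m t. m < 2 \<and> \<bar>t\<bar> \<le> \<bar>s\<bar> \<longrightarrow> DERIV (df m) t :> df (Suc m) t"
      using shift[OF f(1)] shift[OF f(2)] by (auto simp: less_2_cases_iff df_def [abs_def])
  qed
  then obtain t where "f (a + s) = f a + f' a * s + f'' (a + t) / 2 * s\<^sup>2"
    by (auto simp: df_def numeral_2_eq_2)
  hence "\<bar>f (a + s) - f a - f' a * s\<bar> = \<bar>f'' (a + t)\<bar> / 2 * s\<^sup>2" by (simp add: abs_mult)
  also have "\<dots> \<le> B / 2 * s\<^sup>2" using B[of "a + t"] by (intro mult_right_mono) auto
  finally show ?thesis .
qed

lemma taylor3_bound:
  fixes f f' f'' f3 :: "real \<Rightarrow> real"
  assumes f: "\<And>x. (f has_real_derivative f' x) (at x)" "\<And>x. (f' has_real_derivative f'' x) (at x)"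
     "\<And>x. (f'' has_real_derivative f3 x) (at x)"
    and B: "\<And>x. \<bar>f3 x\<bar> \<le> B"
  shows "\<bar>f (a + s) - f a - f' a * s - f'' a / 2 * s\<^sup>2\<bar> \<le> B / 6 * \<bar>s\<bar> ^ 3"
proof -
  define df where "df n x = (if n = 0 then f (a + x) else if n = 1 then f' (a + x) else if n = 2 then f'' (a + x) else f3 (a + x))"
    for n :: nat and x
  have shift: "((\<lambda>x. g (a + x)) has_real_derivative g' (a + x)) (at x)"
    if "\<And>x. (g has_real_derivative g' x) (at x)" for g g' :: "real \<Rightarrow> real" and x
    using that[of "x + a"] by (simp add: DERIV_shift add.commute[of a])
  have "\<exists>t. \<bar>t\<bar> \<le> \<bar>s\<bar> \<and> f (a + s) = (\<Sum>m<3. df m 0 / fact m * s ^ m) + df 3 t / fact 3 * s ^ 3"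
  proof (rule Maclaurin_bi_le)
    show "df 0 = (\<lambda>x. f (a + x))" by (simp add: df_def fun_eq_iff)
    show "\<forall>m t. m < 3 \<and> \<bar>t\<bar> \<le> \<bar>s\<bar> \<longrightarrow> DERIV (df m) t :> df (Suc m) t"
    proof (intro allI impI)
      fix m t assume "m < (3::nat) \<and> \<bar>t\<bar> \<le> \<bar>s\<bar>"
      hence "m = 0 \<or> m = 1 \<or> m = 2" by auto
      thus "DERIV (df m) t :> df (Suc m) t"
        using shift[OF f(1)] shift[OF f(2)] shift[OF f(3)] by (auto simp: df_def [abs_def])
    qed
  qed
  then obtain t where "f (a + s) = f a + f' a * s + f'' a / 2 * s\<^sup>2 + f3 (a + t) / 6 * s ^ 3"
    by (auto simp: df_def eval_nat_numeral)
  hence "\<bar>f (a + s) - f a - f' a * s - f'' a / 2 * s\<^sup>2\<bar> = \<bar>f3 (a + t)\<bar> / 6 * \<bar>s\<bar> ^ 3" by (simp add: abs_mult power_abs)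
  also have "\<dots> \<le> B / 6 * \<bar>s\<bar> ^ 3" using B[of "a + t"] by (intro mult_right_mono) auto
  finally show ?thesis .
qed

lemma sech2_bounds: "0 \<le> 1 - (tanh (x::real))\<^sup>2" "1 - (tanh (x::real))\<^sup>2 \<le> 1"
  using tanh_square_less[of x] by auto

lemma tanh_deriv2_bound: "\<bar>- 2 * tanh x * (1 - (tanh x)\<^sup>2)\<bar> \<le> (2::real)"
proof -
  have "\<bar>- 2 * tanh x * (1 - (tanh x)\<^sup>2)\<bar> = 2 * (\<bar>tanh x\<bar> * \<bar>1 - (tanh x)\<^sup>2\<bar>)" by (simp add: abs_mult)
  also have "\<dots> \<le> 2 * (1 * 1)"
    using sech2_bounds[of x] abs_tanh_less[of x] by (intro mult_left_mono mult_mono) auto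
  finally show ?thesis by simp
qed

lemma tanh_deriv3_bound: "\<bar>- 2 * (1 - (tanh x)\<^sup>2)\<^sup>2 + 4 * (tanh x)\<^sup>2 * (1 - (tanh x)\<^sup>2)\<bar> \<le> (6::real)"
proof -
  have "\<bar>- 2 * (1 - (tanh x)\<^sup>2)\<^sup>2 + 4 * (tanh x)\<^sup>2 * (1 - (tanh x)\<^sup>2)\<bar>
     \<le> 2 * (1 - (tanh x)\<^sup>2)\<^sup>2 + 4 * ((tanh x)\<^sup>2 * (1 - (tanh x)\<^sup>2))"
    using sech2_bounds[of x] by (intro order.trans[OF abs_triangle_ineq]) (simp add: abs_mult)
  also have "\<dots> \<le> 2 * 1 + 4 * (1 * 1)"
    using sech2_bounds[of x] tanh_square_less[of x] power_le_one[of "1 - (tanh x)\<^sup>2" 2]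
    by (intro add_mono mult_left_mono mult_mono) auto
  finally show ?thesis by simp
qed

lemma tanh_has_deriv2:
  "((\<lambda>x. 1 - (tanh x)\<^sup>2) has_real_derivative - 2 * tanh x * (1 - (tanh x)\<^sup>2)) (at x)"
  by (auto intro!: derivative_eq_intros simp: algebra_simps)

lemma tanh_has_deriv3:
  "((\<lambda>x. - 2 * tanh x * (1 - (tanh x)\<^sup>2)) has_real_derivative
      - 2 * (1 - (tanh x)\<^sup>2)\<^sup>2 + 4 * (tanh x)\<^sup>2 * (1 - (tanh x)\<^sup>2)) (at x)"
  by (auto intro!: derivative_eq_intros simp: algebra_simps power2_eq_square)

lemma tanh_has_deriv: "(tanh has_real_derivative 1 - (tanh x)\<^sup>2) (at x)"
  by (auto intro!: derivative_eq_intros)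

lemma tanh_expand2: "\<bar>tanh (a + s) - tanh a - (1 - (tanh a)\<^sup>2) * s\<bar> \<le> (s::real)\<^sup>2"
  using taylor2_bound[OF tanh_has_deriv tanh_has_deriv2 tanh_deriv2_bound, of a s] by simp

lemma tanh_expand3:
  "\<bar>tanh (a + s) - tanh a - (1 - (tanh a)\<^sup>2) * s + tanh a * (1 - (tanh a)\<^sup>2) * s\<^sup>2\<bar> \<le> \<bar>s::real\<bar> ^ 3"
  using taylor3_bound[OF tanh_has_deriv tanh_has_deriv2 tanh_has_deriv3 tanh_deriv3_bound, of a s] by simp

lemma sech2_expand2:
  "\<bar>(1 - (tanh (a + s))\<^sup>2) - (1 - (tanh a)\<^sup>2) + 2 * tanh a * (1 - (tanh a)\<^sup>2) * s\<bar> \<le> 3 * (s::real)\<^sup>2"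
  using taylor2_bound[OF tanh_has_deriv2 tanh_has_deriv3 tanh_deriv3_bound, of a s] by simp

lemma lipschitz_from_deriv:
  fixes f f' :: "real \<Rightarrow> real"
  assumes "\<And>x. (f has_real_derivative f' x) (at x)" "\<And>x. \<bar>f' x\<bar> \<le> L"
  shows "\<bar>f x - f y\<bar> \<le> L * \<bar>x - y\<bar>"
  using field_differentiable_bound[of UNIV f f' L x y] assms by (auto simp: has_field_derivative_at_within)

lemma tanh_lipschitz: "\<bar>tanh x - tanh y\<bar> \<le> \<bar>x - (y::real)\<bar>"
  using lipschitz_from_deriv[OF tanh_has_deriv, of 1 x y] sech2_bounds by auto

lemma sech2_lipschitz: "\<bar>(1 - (tanh x)\<^sup>2) - (1 - (tanh y)\<^sup>2)\<bar> \<le> 2 * \<bar>x - (y::real)\<bar>"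
  using lipschitz_from_deriv[OF tanh_has_deriv2 tanh_deriv2_bound, of x y] by simp

context two_star
begin

text \<open>4 / \<theta> inverts the bound \<open>h_ge\<close>; the summand 1 makes
  \<open>ub\<close> at least n^(-1/2).\<close>

definition kap :: real where "kap = 1 + 4 / \<theta>"

text \<open>
  \<open>ub\<close> dominates both \<open>\<bar>yd\<bar>\<close> and \<open>n ^ (-1/2)\<close>, so that every error term below is a power of it, and
  \<open>RR\<close> controls the sums of these powers up to the fourth.
\<close>
definition ub :: "nat \<Rightarrow> (nat \<Rightarrow> nat \<Rightarrow> nat) \<Rightarrow> nat \<Rightarrow> real" where
  "ub n g i = sqrt (kap * (1 + star_energy n g i) / n)"

definition RR :: "nat \<Rightarrow> (nat \<Rightarrow> nat \<Rightarrow> nat) \<Rightarrow> real" where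
  "RR n g = (\<Sum>i=1..n. (1 + star_energy n g i) ^ 4) / n"

text \<open>\<open>T0\<close> and \<open>T1\<close> are mean and variance of a spin between two
  vertices of average degree, self-interaction neglected; \<open>pz\<close> is the defect in the
  self-consistency equation for that average.\<close>

definition T0 :: "nat \<Rightarrow> (nat \<Rightarrow> nat \<Rightarrow> nat) \<Rightarrow> real" where
  "T0 n g = tanh (2 * \<theta> * mz n g + \<beta>)"

definition T1 :: "nat \<Rightarrow> (nat \<Rightarrow> nat \<Rightarrow> nat) \<Rightarrow> real" where
  "T1 n g = 1 - (T0 n g)\<^sup>2"

definition pz :: "nat \<Rightarrow> (nat \<Rightarrow> nat \<Rightarrow> nat) \<Rightarrow> real" where
  "pz n g = mz n g - T0 n g"

text \<open>Squares are compared because the phases t and - t cannot be told apart when \<beta> =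
  0.\<close>

definition ez :: "nat \<Rightarrow> (nat \<Rightarrow> nat \<Rightarrow> nat) \<Rightarrow> real" where
  "ez n g = \<bar>(T0 n g)\<^sup>2 - t\<^sup>2\<bar>"

abbreviation Av :: "nat \<Rightarrow> ((nat \<Rightarrow> nat \<Rightarrow> nat) \<Rightarrow> real) \<Rightarrow> real" where
  "Av \<equiv> gibbs_mean \<theta> \<beta>"

lemma kap_ge_1: "kap \<ge> 1"
  using \<theta>_pos by (simp add: kap_def)

lemma T0_bound: "\<bar>T0 n g\<bar> \<le> 1"
  unfolding T0_def using abs_tanh_less[of "2 * \<theta> * mz n g + \<beta>"] by simp

lemma T1_bounds: "0 \<le> T1 n g" "T1 n g \<le> 1"
  unfolding T1_def T0_def using sech2_bounds by auto

lemma star_ge_1: "1 \<le> 1 + star_energy n g i"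
  using star_energy_nonneg by simp

lemma ub_nonneg: "ub n g i \<ge> 0"
  using kap_ge_1 star_ge_1[of n g i] by (simp add: ub_def)

lemma ub_square: "(ub n g i)\<^sup>2 = kap * (1 + star_energy n g i) / n"
  using kap_ge_1 star_ge_1[of n g i] by (simp add: ub_def)

text \<open>n y_i is the sum of the differences z_i - z_j, so Cauchy-Schwarz and \<open>h_ge\<close>
  apply. The energy thus controls centred degrees on the scale n^(-1/2) without information on their
  mean.\<close>

lemma yd_square_le:
  assumes n: "n > 0" and i: "i \<in> {1..n}"
  shows "(yd n g i)\<^sup>2 \<le> (ub n g i)\<^sup>2"
proof -
  let ?z = "zdeg n g"
  have "real n * yd n g i = (\<Sum>j=1..n. ?z i - ?z j)"
    using n by (simp add: yd_def mz_def sum_subtractf field_simps)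
  hence "(real n * yd n g i)\<^sup>2 \<le> (\<Sum>j=1..n. (?z i - ?z j)\<^sup>2) * n"
    using sum_squared_le_sum_of_squares[of "\<lambda>j. ?z i - ?z j" "{1..n}"] n by simp
  also have sq: "(\<Sum>j=1..n. (?z i - ?z j)\<^sup>2) * n \<le> (4 / \<theta> * star_energy n g i) * n"
  proof (rule mult_right_mono)
    have "(\<Sum>j=1..n. (?z i - ?z j)\<^sup>2) = (\<Sum>j\<in>{1..n} - {i}. (?z i - ?z j)\<^sup>2)"
      using i by (subst sum.remove[of _ i]) auto
    also have "\<dots> \<le> (\<Sum>j\<in>{1..n} - {i}. 4 / \<theta> * h (?z i) (?z j))"
    proof (rule sum_mono)
      fix j show "(?z i - ?z j)\<^sup>2 \<le> 4 / \<theta> * h (?z i) (?z j)"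
        using h_ge[of "?z i" "?z j"] \<theta>_pos by (simp add: field_simps)
    qed
    also have "\<dots> = 4 / \<theta> * star_energy n g i" by (simp add: star_energy_def sum_distrib_left)
    finally show "(\<Sum>j=1..n. (?z i - ?z j)\<^sup>2) \<le> 4 / \<theta> * star_energy n g i" .
  qed simp
  finally have "real n * (real n * (yd n g i)\<^sup>2) \<le> real n * (4 / \<theta> * star_energy n g i)"
    by (simp add: power2_eq_square mult_ac)
  hence "real n * (yd n g i)\<^sup>2 \<le> 4 / \<theta> * star_energy n g i"
    by (rule mult_left_le_imp_le) (use n in simp)
  also have "\<dots> \<le> kap * (1 + star_energy n g i)"
    using \<theta>_pos star_energy_nonneg[of n g i] unfolding kap_def by (intro mult_mono) auto
  finally show ?thesis using n unfolding ub_square by (simp add: field_simps)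
qed

lemma yd_abs_le: "n > 0 \<Longrightarrow> i \<in> {1..n} \<Longrightarrow> \<bar>yd n g i\<bar> \<le> ub n g i"
  using yd_square_le[of n i g] ub_nonneg[of n g i] abs_le_square_iff[of "yd n g i" "ub n g i"] by simp

lemma ub_ge: "n > 0 \<Longrightarrow> 1 / sqrt n \<le> ub n g i"
proof -
  assume n: "n > 0"
  have "1 \<le> kap * (1 + star_energy n g i)"
    using mult_mono[OF kap_ge_1 star_ge_1[of n g i]] kap_ge_1 by simp
  hence "1 / real n \<le> kap * (1 + star_energy n g i) / n" using n by (intro divide_right_mono) auto
  from real_sqrt_le_mono[OF this] show ?thesis by (simp add: ub_def real_sqrt_divide)
qed

lemma RR_ge_1: "n > 0 \<Longrightarrow> RR n g \<ge> 1"
proof -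
  assume n: "n > 0"
  have "(\<Sum>i=1..n. 1) \<le> (\<Sum>i=1..n. (1 + star_energy n g i) ^ 4)"
    by (intro sum_mono one_le_power star_ge_1)
  thus ?thesis using n by (simp add: RR_def field_simps)
qed

lemma star_power_le: "k \<le> 4 \<Longrightarrow> (\<Sum>i=1..n. (1 + star_energy n g i) ^ k) \<le> n * RR n g"
proof -
  assume k: "k \<le> 4"
  have "(\<Sum>i=1..n. (1 + star_energy n g i) ^ k) \<le> (\<Sum>i=1..n. (1 + star_energy n g i) ^ 4)"
    by (intro sum_mono power_increasing k star_ge_1)
  also have "\<dots> = n * RR n g" by (cases "n = 0") (auto simp: RR_def)
  finally show ?thesis .
qed

lemma sum_ub_2: "n > 0 \<Longrightarrow> (\<Sum>i=1..n. (ub n g i)\<^sup>2) \<le> kap * RR n g"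
proof -
  assume n: "n > 0"
  have "(\<Sum>i=1..n. (ub n g i)\<^sup>2) = kap / n * (\<Sum>i=1..n. (1 + star_energy n g i) ^ 1)"
    unfolding ub_square by (simp add: sum_distrib_left)
  also have "\<dots> \<le> kap / n * (n * RR n g)"
    using kap_ge_1 by (intro mult_left_mono star_power_le) auto
  finally show ?thesis using n by simp
qed

lemma sum_ub_4: "n > 0 \<Longrightarrow> (\<Sum>i=1..n. ub n g i ^ 4) \<le> kap\<^sup>2 * RR n g / n"
proof -
  assume n: "n > 0"
  have "ub n g i ^ 4 = (kap / n)\<^sup>2 * (1 + star_energy n g i)\<^sup>2" for i
  proof -
    have "ub n g i ^ 4 = ((ub n g i)\<^sup>2)\<^sup>2" by simp
    thus ?thesis unfolding ub_square by (simp add: power_mult_distrib power_divide)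
  qed
  hence "(\<Sum>i=1..n. ub n g i ^ 4) = (kap / n)\<^sup>2 * (\<Sum>i=1..n. (1 + star_energy n g i)\<^sup>2)"
    by (simp add: sum_distrib_left)
  also have "\<dots> \<le> (kap / n)\<^sup>2 * (n * RR n g)"
    by (intro mult_left_mono star_power_le) auto
  also have "\<dots> = kap\<^sup>2 * RR n g / n" using n by (simp add: power2_eq_square field_simps)
  finally show ?thesis .
qed

lemma S2_le: "n > 0 \<Longrightarrow> S2 n g \<le> kap * RR n g"
  unfolding S2_def by (rule order.trans[OF sum_mono[OF yd_square_le] sum_ub_2]) auto

lemma S2_nonneg: "S2 n g \<ge> 0"
  unfolding S2_def by (intro sum_nonneg) auto

text \<open>The cube is interpolated between the second and fourth powers with weight
  \<open>sqrt n\<close>. The resulting n^(-1/2) is exactly the scale of the limit theorem, so this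
  bound alone does not make the cubic term negligible; \<open>S3_estimate\<close> improves it in
  mean.\<close>

lemma S3_le: "n > 0 \<Longrightarrow> \<bar>S3 n g\<bar> \<le> kap\<^sup>2 * RR n g / sqrt n"
proof -
  assume n: "n > 0"
  have "\<bar>S3 n g\<bar> \<le> (\<Sum>i=1..n. \<bar>yd n g i ^ 3\<bar>)" unfolding S3_def by (rule sum_abs)
  also have "\<dots> \<le> (\<Sum>i=1..n. 1 / 2 * ((ub n g i)\<^sup>2 / sqrt n + sqrt n * ub n g i ^ 4))"
  proof (rule sum_mono)
    fix i assume i: "i \<in> {1..n}"
    define s where "s = sqrt n"
    have s: "s > 0" using n by (simp add: s_def)
    let ?u = "ub n g i"
    have "\<bar>yd n g i ^ 3\<bar> = \<bar>yd n g i\<bar> ^ 3" by (rule power_abs)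
    also have "\<dots> \<le> ?u ^ 3" using yd_abs_le[OF n i] by (intro power_mono) auto
    also have "\<dots> \<le> 1 / 2 * (?u\<^sup>2 / s + s * ?u ^ 4)"
    proof -
      have "0 \<le> ?u\<^sup>2 * (1 - s * ?u)\<^sup>2 / s" using s by simp
      also have "\<dots> = ?u\<^sup>2 / s + s * ?u ^ 4 - 2 * ?u ^ 3"
        using s by (simp add: field_simps power2_eq_square power3_eq_cube power4_eq_xxxx)
      finally show ?thesis by simp
    qed
    finally show "\<bar>yd n g i ^ 3\<bar> \<le> 1 / 2 * (?u\<^sup>2 / sqrt n + sqrt n * ?u ^ 4)" unfolding s_def .
  qed
  also have "\<dots> = 1 / 2 * ((\<Sum>i=1..n. (ub n g i)\<^sup>2) / sqrt n + sqrt n * (\<Sum>i=1..n. ub n g i ^ 4))"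
    by (simp add: sum.distrib sum_distrib_left sum_divide_distrib distrib_left)
  also have "\<dots> \<le> 1 / 2 * (kap * RR n g / sqrt n + sqrt n * (kap\<^sup>2 * RR n g / n))"
    using sum_ub_2[OF n, of g] sum_ub_4[OF n, of g]
    by (intro mult_left_mono add_mono divide_right_mono) auto
  also have "sqrt n * (kap\<^sup>2 * RR n g / n) = kap\<^sup>2 * RR n g / sqrt n"
    using n by (simp add: field_simps)
  also have "1 / 2 * (kap * RR n g / sqrt n + kap\<^sup>2 * RR n g / sqrt n) \<le> 1 / 2 * (kap\<^sup>2 * RR n g / sqrt n + kap\<^sup>2 * RR n g / sqrt n)"
    using kap_ge_1 RR_ge_1[OF n, of g]
    by (intro mult_left_mono add_mono divide_right_mono mult_right_mono) (auto simp: power2_eq_square)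
  finally show ?thesis by (simp add: mult.commute)
qed

lemma offsum_mono: "(\<And>i j. i \<in> {1..n} \<Longrightarrow> j \<in> {1..n} \<Longrightarrow> i \<noteq> j \<Longrightarrow> f i j \<le> f' i j) \<Longrightarrow> offsum n f \<le> offsum n f'"
  by (intro sum_mono) auto

lemma offsum_ub_2: "n > 0 \<Longrightarrow> offsum n (\<lambda>i j. (ub n g i + ub n g j)\<^sup>2) \<le> 4 * real n * kap * RR n g"
proof -
  assume n: "n > 0"
  have sym: "offsum n (\<lambda>i j. (ub n g j)\<^sup>2) = offsum n (\<lambda>i j. (ub n g i)\<^sup>2)"
    unfolding sum_offdiag by (simp add: add.commute)
  have "offsum n (\<lambda>i j. (ub n g i + ub n g j)\<^sup>2) \<le> offsum n (\<lambda>i j. 2 * (ub n g i)\<^sup>2 + 2 * (ub n g j)\<^sup>2)"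
  proof (rule offsum_mono)
    fix i j
    show "(ub n g i + ub n g j)\<^sup>2 \<le> 2 * (ub n g i)\<^sup>2 + 2 * (ub n g j)\<^sup>2"
      using zero_le_power2[of "ub n g i - ub n g j"] by (simp add: power2_eq_square algebra_simps)
  qed
  also have "\<dots> = 4 * offsum n (\<lambda>i j. (ub n g i)\<^sup>2)"
    using sym by (simp add: sum.distrib flip: sum_distrib_left)
  also have "\<dots> = 4 * ((real n - 1) * (\<Sum>i=1..n. (ub n g i)\<^sup>2))" unfolding offsum_fst ..
  also have "\<dots> \<le> 4 * (real n * (kap * RR n g))"
    using sum_ub_2[OF n, of g] n by (intro mult_left_mono mult_mono sum_nonneg) auto
  finally show ?thesis by (simp add: mult_ac)
qed

lemma offsum_ub_4: "n > 0 \<Longrightarrow> offsum n (\<lambda>i j. (ub n g i + ub n g j) ^ 4) \<le> 16 * kap\<^sup>2 * RR n g"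
proof -
  assume n: "n > 0"
  have sym: "offsum n (\<lambda>i j. ub n g j ^ 4) = offsum n (\<lambda>i j. ub n g i ^ 4)"
    unfolding sum_offdiag by (simp add: add.commute)
  have "offsum n (\<lambda>i j. (ub n g i + ub n g j) ^ 4) \<le> offsum n (\<lambda>i j. 8 * ub n g i ^ 4 + 8 * ub n g j ^ 4)"
  proof (rule offsum_mono)
    fix i j
    define a b where "a = ub n g i" and "b = ub n g j"
    have sq: "(x + y)\<^sup>2 \<le> 2 * x\<^sup>2 + 2 * y\<^sup>2" for x y :: real
      using zero_le_power2[of "x - y"] by (simp add: power2_eq_square algebra_simps)
    have "(a + b) ^ 4 = ((a + b)\<^sup>2)\<^sup>2" by simp
    also have "\<dots> \<le> (2 * a\<^sup>2 + 2 * b\<^sup>2)\<^sup>2" by (intro power_mono sq) auto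
    also have "\<dots> \<le> 2 * (2 * a\<^sup>2)\<^sup>2 + 2 * (2 * b\<^sup>2)\<^sup>2" by (rule sq)
    finally show "(a + b) ^ 4 \<le> 8 * a ^ 4 + 8 * b ^ 4" by (simp add: power_mult_distrib)
  qed
  also have "\<dots> = 16 * offsum n (\<lambda>i j. ub n g i ^ 4)"
    using sym by (simp add: sum.distrib flip: sum_distrib_left)
  also have "\<dots> = 16 * ((real n - 1) * (\<Sum>i=1..n. ub n g i ^ 4))" unfolding offsum_fst ..
  also have "\<dots> \<le> 16 * (real n * (kap\<^sup>2 * RR n g / n))"
    using sum_ub_4[OF n, of g] n ub_nonneg by (intro mult_left_mono mult_mono sum_nonneg) auto
  finally show ?thesis using n by simp
qed

text \<open>Cauchy-Schwarz over the vertices turns the square of an average of fourth powers into an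
  average of eighth powers, which the exponential moment dominates. A second moment is required
  because \<open>RR\<close> is later multiplied by other random quantities.\<close>

lemma RR_square_moment: "\<exists>C\<ge>1. \<forall>n\<ge>3. Av n (\<lambda>g. (RR n g)\<^sup>2) \<le> C"
proof -
  obtain C where C: "C > 0" "\<And>n i. n \<ge> 3 \<Longrightarrow> i \<in> {1..n} \<Longrightarrow>
     (\<Sum>g\<in>graphs n. exp (energy \<theta> \<beta> n g) * exp (star_energy n g i / 16)) \<le> C * (\<Sum>g\<in>graphs n. exp (energy \<theta> \<beta> n g))"
    using star_energy_exp_moment by auto
  define c where "c = 16 ^ 8 * (exp 1 * fact 8 :: real)"
  have c: "c > 0" by (simp add: c_def)
  have *: "(1 + star_energy n g i) ^ 8 \<le> c * exp (star_energy n g i / 16)" for n g i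
  proof -
    define A where "A = star_energy n g i"
    have A: "A \<ge> 0" by (simp add: A_def star_energy_nonneg)
    have "(1 + A) ^ 8 \<le> (16 * (1 + A / 16)) ^ 8" using A by (intro power_mono) auto
    also have "\<dots> = 16 ^ 8 * (1 + A / 16) ^ 8" by (rule power_mult_distrib)
    also have "\<dots> \<le> 16 ^ 8 * (exp (1 + A / 16) * fact 8)"
      using A by (intro mult_left_mono power_le_exp_fact) auto
    finally show ?thesis by (simp only: c_def A_def exp_add mult_ac)
  qed
  have "Av n (\<lambda>g. (RR n g)\<^sup>2) \<le> max 1 (c * C)" if n: "n \<ge> 3" for n
  proof -
    have "Av n (\<lambda>g. (RR n g)\<^sup>2) \<le> Av n (\<lambda>g. 1 / n * (\<Sum>i=1..n. c * exp (star_energy n g i / 16)))"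
    proof (rule gibbs_mean_mono)
      fix g
      have "(\<Sum>i=1..n. (1 + star_energy n g i) ^ 4)\<^sup>2 \<le> (\<Sum>i=1..n. ((1 + star_energy n g i) ^ 4)\<^sup>2) * n"
        using sum_squared_le_sum_of_squares[of "\<lambda>i. (1 + star_energy n g i) ^ 4" "{1..n}"] n by simp
      hence "(RR n g)\<^sup>2 \<le> ((\<Sum>i=1..n. (1 + star_energy n g i) ^ 8) * n) / (real n)\<^sup>2"
        unfolding RR_def power_divide by (intro divide_right_mono) (simp_all flip: power_mult)
      also have "\<dots> = 1 / n * (\<Sum>i=1..n. (1 + star_energy n g i) ^ 8)"
        using n by (simp add: power2_eq_square)
      also have "\<dots> \<le> 1 / n * (\<Sum>i=1..n. c * exp (star_energy n g i / 16))"
        using * by (intro mult_left_mono sum_mono) auto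
      finally show "(RR n g)\<^sup>2 \<le> 1 / n * (\<Sum>i=1..n. c * exp (star_energy n g i / 16))" .
    qed
    also have "\<dots> = 1 / n * (\<Sum>i=1..n. c * Av n (\<lambda>g. exp (star_energy n g i / 16)))"
      by (simp only: gibbs_mean_cmult gibbs_mean_sum)
    also have "\<dots> \<le> 1 / n * (\<Sum>i=1..n. c * C)"
    proof (intro mult_left_mono sum_mono)
      fix i assume "i \<in> {1..n}"
      thus "Av n (\<lambda>g. exp (star_energy n g i / 16)) \<le> C"
        using C(2)[OF n, of i] partition_pos[of \<theta> \<beta> n] by (simp add: gibbs_mean_def field_simps)
    qed (use c in auto)
    also have "\<dots> = c * C" using n by simp
    finally show ?thesis by simp
  qed
  thus ?thesis by (intro exI[of _ "max 1 (c * C)"]) auto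
qed

lemma RR_moment_le: "n > 0 \<Longrightarrow> Av n (\<lambda>g. RR n g) \<le> Av n (\<lambda>g. (RR n g)\<^sup>2)"
proof (rule gibbs_mean_mono)
  fix g assume "n > 0"
  from RR_ge_1[OF this, of g] show "RR n g \<le> (RR n g)\<^sup>2" by (simp add: power2_eq_square)
qed

end

section \<open>The mean field equation for the average degree\<close>

context two_star
begin

definition bb :: "nat \<Rightarrow> (nat \<Rightarrow> nat \<Rightarrow> nat) \<Rightarrow> nat \<Rightarrow> nat \<Rightarrow> real" where
  "bb n g i j = ub n g i + ub n g j"

text \<open>The quantities of order n^(-1/2) or 1 / n that arise at one edge are dominated by the
  first or second power of a single local scale, so that errors can be counted in powers of
  \<open>bb\<close>.\<close>

lemma bb_bounds:
  assumes n: "n \<ge> 4" and i: "i \<in> {1..n}" and j: "j \<in> {1..n}"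
  shows "0 \<le> bb n g i j" "\<bar>yd n g i\<bar> \<le> bb n g i j" "\<bar>yd n g i + yd n g j\<bar> \<le> bb n g i j"
    "sqrt n / (real n - 1) \<le> bb n g i j" "1 / (real n - 1) \<le> bb n g i j" "1 / (real n - 1) \<le> (bb n g i j)\<^sup>2"
    "2 / real n \<le> bb n g i j" "2 / real n \<le> (bb n g i j)\<^sup>2"
proof -
  let ?b = "bb n g i j"
  have n0: "n > 0" using n by simp
  have u: "0 \<le> ub n g i" "0 \<le> ub n g j" by (rule ub_nonneg)+
  show b0: "0 \<le> ?b" using u by (simp add: bb_def)
  show "\<bar>yd n g i\<bar> \<le> ?b" using yd_abs_le[OF n0 i, of g] u by (simp add: bb_def)
  show "\<bar>yd n g i + yd n g j\<bar> \<le> ?b" using yd_abs_le[OF n0 i, of g] yd_abs_le[OF n0 j, of g] by (simp add: bb_def)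
  have s: "sqrt n \<ge> 1" "sqrt n * sqrt n = n" using n by simp_all
  have sb: "2 / sqrt n \<le> ?b" using ub_ge[OF n0, of g i] ub_ge[OF n0, of g j] by (simp add: bb_def)
  have nN: "1 / (real n - 1) \<le> 2 / real n" using n by (simp add: field_simps)
  have "sqrt n / (real n - 1) = sqrt n * (1 / (real n - 1))" by simp
  also have "\<dots> \<le> sqrt n * (2 / real n)" using nN by (intro mult_left_mono) auto
  also have "\<dots> = 2 / sqrt n" using s n by (simp add: field_simps)
  finally show "sqrt n / (real n - 1) \<le> ?b" using sb by simp
  have "2 / real n = 2 / sqrt n / sqrt n" using s by (simp add: field_simps)
  also have "\<dots> \<le> 2 / sqrt n / 1" using s by (intro divide_left_mono) auto
  finally show 2: "2 / real n \<le> ?b" using sb by simp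
  thus "1 / (real n - 1) \<le> ?b" using nN by simp
  have "2 / real n \<le> (2 / sqrt n)\<^sup>2" using n by (simp add: power_divide field_simps)
  also have "\<dots> \<le> ?b\<^sup>2" using sb by (intro power_mono) auto
  finally show "2 / real n \<le> ?b\<^sup>2" .
  thus "1 / (real n - 1) \<le> ?b\<^sup>2" using nN by simp
qed

lemma offsum_bb_2: "n > 0 \<Longrightarrow> offsum n (\<lambda>i j. (bb n g i j)\<^sup>2) \<le> 4 * real n * kap * RR n g"
  unfolding bb_def by (rule offsum_ub_2)

lemma offsum_bb_4: "n > 0 \<Longrightarrow> offsum n (\<lambda>i j. bb n g i j ^ 4) \<le> 16 * kap\<^sup>2 * RR n g"
  unfolding bb_def by (rule offsum_ub_4)

text \<open>The deviation of the field from its value \<open>2 \<theta> m + \<beta>\<close> at the mean.\<close>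
definition sd :: "nat \<Rightarrow> nat \<Rightarrow> nat \<Rightarrow> (nat \<Rightarrow> nat \<Rightarrow> nat) \<Rightarrow> real" where
  "sd n i j g = \<theta> * (yd n g i + yd n g j) - 2 * \<theta> * spin g i j / (real n - 1)"

lemma edge_field_sd: "edge_field \<theta> \<beta> n i j g = (2 * \<theta> * mz n g + \<beta>) + sd n i j g"
  by (simp add: edge_field_def sd_def yd_def algebra_simps)

lemma abs_spin: "g \<in> graphs n \<Longrightarrow> \<bar>spin g i j\<bar> = 1"
  using spin_cases[of g n i j] by auto

lemma sd_abs_le:
  assumes n: "n \<ge> 4" and g: "g \<in> graphs n" and i: "i \<in> {1..n}" and j: "j \<in> {1..n}"
  shows "\<bar>sd n i j g\<bar> \<le> 3 * \<theta> * bb n g i j"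
proof -
  note b = bb_bounds[OF n i j, of g]
  have "\<bar>sd n i j g\<bar> \<le> \<bar>\<theta> * (yd n g i + yd n g j)\<bar> + \<bar>2 * \<theta> * spin g i j / (real n - 1)\<bar>"
    unfolding sd_def by (rule abs_triangle_ineq4)
  also have "\<dots> = \<theta> * \<bar>yd n g i + yd n g j\<bar> + 2 * \<theta> * (1 / (real n - 1))"
    using \<theta>_pos n abs_spin[OF g, of i j] by (simp add: abs_mult)
  also have "\<dots> \<le> \<theta> * bb n g i j + 2 * \<theta> * bb n g i j"
    using b \<theta>_pos by (intro add_mono mult_left_mono) auto
  finally show ?thesis by simp
qed

lemma sd_square_le:
  assumes n: "n \<ge> 4" and g: "g \<in> graphs n" and i: "i \<in> {1..n}" and j: "j \<in> {1..n}"
  shows "(sd n i j g)\<^sup>2 \<le> 9 * \<theta>\<^sup>2 * (bb n g i j)\<^sup>2"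
proof -
  have "\<bar>sd n i j g\<bar>\<^sup>2 \<le> (3 * \<theta> * bb n g i j)\<^sup>2"
    by (intro power_mono sd_abs_le n g i j) auto
  thus ?thesis by (simp add: power_mult_distrib)
qed

lemma T_expand2:
  "\<bar>tanh (edge_field \<theta> \<beta> n i j g) - T0 n g - T1 n g * sd n i j g\<bar> \<le> (sd n i j g)\<^sup>2"
  unfolding edge_field_sd T0_def T1_def by (rule tanh_expand2)

lemma T_expand3:
  "\<bar>tanh (edge_field \<theta> \<beta> n i j g) - T0 n g - T1 n g * sd n i j g + T0 n g * T1 n g * (sd n i j g)\<^sup>2\<bar> \<le> \<bar>sd n i j g\<bar> ^ 3"
  unfolding edge_field_sd T0_def T1_def by (rule tanh_expand3)

lemma sech_expand1:
  "\<bar>(1 - (tanh (edge_field \<theta> \<beta> n i j g))\<^sup>2) - T1 n g\<bar> \<le> 2 * \<bar>sd n i j g\<bar>"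
  unfolding edge_field_sd T0_def T1_def
  using sech2_lipschitz[of "2 * \<theta> * mz n g + \<beta> + sd n i j g" "2 * \<theta> * mz n g + \<beta>"] by simp

lemma sech_expand2:
  "\<bar>(1 - (tanh (edge_field \<theta> \<beta> n i j g))\<^sup>2) - T1 n g + 2 * T0 n g * T1 n g * sd n i j g\<bar> \<le> 3 * (sd n i j g)\<^sup>2"
  unfolding edge_field_sd T0_def T1_def by (rule sech2_expand2)

lemma stein_offsum:
  "offsum n (\<lambda>i j. Av n (\<lambda>g. F i g * spin g i j))
   = Av n (\<lambda>g. offsum n (\<lambda>i j. F i g * tanh (edge_field \<theta> \<beta> n i j g)
        + (1 - (tanh (edge_field \<theta> \<beta> n i j g))\<^sup>2) * (spin g i j * (F i g - F i (toggle i j g)) / 2)))"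
  unfolding gibbs_mean_sum by (intro sum.cong refl stein_identity) auto

lemma zdeg_abs_le: "g \<in> graphs n \<Longrightarrow> n \<ge> 2 \<Longrightarrow> i \<in> {1..n} \<Longrightarrow> \<bar>zdeg n g i\<bar> \<le> 1"
proof -
  assume g: "g \<in> graphs n" and n: "n \<ge> 2" and i: "i \<in> {1..n}"
  have "\<bar>(real n - 1) * zdeg n g i\<bar> \<le> (\<Sum>j\<in>{1..n} - {i}. \<bar>spin g i j\<bar>)"
    unfolding zdeg_spin[OF g i] by (rule sum_abs)
  also have "\<dots> = real n - 1" using i abs_spin[OF g] by (simp add: of_nat_diff)
  finally have "(real n - 1) * \<bar>zdeg n g i\<bar> \<le> (real n - 1) * 1" using n by (simp add: abs_mult)
  thus ?thesis by (rule mult_left_le_imp_le) (use n in simp)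
qed

lemma mz_abs_le: "g \<in> graphs n \<Longrightarrow> n \<ge> 2 \<Longrightarrow> \<bar>mz n g\<bar> \<le> 1"
proof -
  assume g: "g \<in> graphs n" and n: "n \<ge> 2"
  have "\<bar>\<Sum>i=1..n. zdeg n g i\<bar> \<le> (\<Sum>i=1..n. \<bar>zdeg n g i\<bar>)" by (rule sum_abs)
  also have "\<dots> \<le> (\<Sum>i=1..n. 1)" using zdeg_abs_le[OF g n] by (intro sum_mono) auto
  finally show ?thesis using n by (simp add: mz_def field_simps)
qed

lemma mz_toggle_abs:
  assumes "g \<in> graphs n" "i \<in> {1..n}" "j \<in> {1..n}" "i \<noteq> j" "n \<ge> 4"
  shows "\<bar>mz n g - mz n (toggle i j g)\<bar> \<le> 4 / (real n * (real n - 1))"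
  using assms(5) abs_spin[OF assms(1), of i j] unfolding mz_toggle[OF assms(1-4)] by (simp add: abs_mult)

lemma T0_toggle_abs:
  assumes "g \<in> graphs n" "i \<in> {1..n}" "j \<in> {1..n}" "i \<noteq> j" "n \<ge> 4"
  shows "\<bar>T0 n g - T0 n (toggle i j g)\<bar> \<le> 8 * \<theta> / (real n * (real n - 1))"
proof -
  have "\<bar>T0 n g - T0 n (toggle i j g)\<bar> \<le> \<bar>2 * \<theta> * (mz n g - mz n (toggle i j g))\<bar>"
    unfolding T0_def by (rule order.trans[OF tanh_lipschitz]) (simp add: algebra_simps)
  also have "\<dots> = 2 * \<theta> * \<bar>mz n g - mz n (toggle i j g)\<bar>" using \<theta>_pos by (simp add: abs_mult)
  also have "\<dots> \<le> 2 * \<theta> * (4 / (real n * (real n - 1)))"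
    using mz_toggle_abs[OF assms] \<theta>_pos by (intro mult_left_mono) auto
  finally show ?thesis by simp
qed

lemma T1_toggle_abs:
  assumes "g \<in> graphs n" "i \<in> {1..n}" "j \<in> {1..n}" "i \<noteq> j" "n \<ge> 4"
  shows "\<bar>T1 n g - T1 n (toggle i j g)\<bar> \<le> 16 * \<theta> / (real n * (real n - 1))"
proof -
  have "\<bar>T1 n g - T1 n (toggle i j g)\<bar> \<le> 2 * \<bar>2 * \<theta> * (mz n g - mz n (toggle i j g))\<bar>"
    unfolding T0_def T1_def by (rule order.trans[OF sech2_lipschitz]) (simp add: algebra_simps)
  also have "\<dots> = 4 * \<theta> * \<bar>mz n g - mz n (toggle i j g)\<bar>" using \<theta>_pos by (simp add: abs_mult)
  also have "\<dots> \<le> 4 * \<theta> * (4 / (real n * (real n - 1)))"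
    using mz_toggle_abs[OF assms] \<theta>_pos by (intro mult_left_mono) auto
  finally show ?thesis by simp
qed

text \<open>The first-order deviations cancel by centring. Only the self-interaction survives, of
  order n although there are about n^2 pairs.\<close>

lemma offsum_sd:
  assumes g: "g \<in> graphs n" and n: "n \<ge> 4"
  shows "offsum n (\<lambda>i j. sd n i j g) = - 2 * \<theta> * n * mz n g"
proof -
  have "offsum n (\<lambda>i j. sd n i j g)
    = \<theta> * offsum n (\<lambda>i j. yd n g i + yd n g j) - 2 * \<theta> / (real n - 1) * offsum n (\<lambda>i j. spin g i j)"
    by (simp add: sd_def sum_subtractf sum_distrib_left)
  also have "offsum n (\<lambda>i j. yd n g i + yd n g j) = 0" using n by (intro offsum_yd_add) auto
  also have "offsum n (\<lambda>i j. spin g i j) = (real n - 1) * (real n * mz n g)"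
    using n by (intro offsum_spin_one g) auto
  finally show ?thesis using n by simp
qed

lemma pz_toggle_abs:
  assumes "g \<in> graphs n" "i \<in> {1..n}" "j \<in> {1..n}" "i \<noteq> j" "n \<ge> 4"
  shows "\<bar>pz n g - pz n (toggle i j g)\<bar> \<le> (4 + 8 * \<theta>) / (real n * (real n - 1))"
  using mz_toggle_abs[OF assms] T0_toggle_abs[OF assms] unfolding pz_def add_divide_distrib by linarith

lemma offsum_const: "offsum n (\<lambda>i j. c) = (real n - 1) * (real n * c)"
  using offsum_fst[of "\<lambda>_. c" n] by simp

lemma offsum_abs_le:
  "(\<And>i j. i \<in> {1..n} \<Longrightarrow> j \<in> {1..n} \<Longrightarrow> i \<noteq> j \<Longrightarrow> \<bar>f i j\<bar> \<le> f' i j) \<Longrightarrow> \<bar>offsum n f\<bar> \<le> offsum n f'"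
  by (rule order.trans[OF sum_abs] sum_mono order.trans[OF sum_abs])+ auto

lemma half_spin_abs: "g \<in> graphs n \<Longrightarrow> \<bar>spin g i j * x / 2\<bar> = \<bar>x\<bar> / 2"
  using abs_spin[of g n i j] by (simp add: abs_mult)

text \<open>The test function is \<open>pz\<close> itself, which puts about n^2 E(pz^2) on one side
  of the summed identity. The sum of the tanh terms differs from its mean field value only by O(n
  RR), by centring, and the increment term is O(1) in total because a toggle moves \<open>pz\<close>
  by O(n^(-2)). Young's inequality then leaves E(pz^2) = O(n^(-2)).\<close>

lemma pz_moment: "\<exists>C\<ge>0. \<forall>n\<ge>4. Av n (\<lambda>g. (pz n g)\<^sup>2) \<le> C / (real n)\<^sup>2"
proof -
  obtain C0 where C0: "C0 \<ge> 1" "\<And>n. n \<ge> 3 \<Longrightarrow> Av n (\<lambda>g. (RR n g)\<^sup>2) \<le> C0"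
    using RR_square_moment by blast
  define c1 where "c1 = 2 * \<theta> + 36 * \<theta>\<^sup>2 * kap"
  define c2 where "c2 = 2 + 4 * \<theta>"
  define C where "C = 4 * c1\<^sup>2 * C0 + 4 * c2"
  have c12: "c1 \<ge> 0" "c2 \<ge> 0" using \<theta>_pos kap_ge_1 by (simp_all add: c1_def c2_def)
  have "Av n (\<lambda>g. (pz n g)\<^sup>2) \<le> C / (real n)\<^sup>2" if n: "n \<ge> 4" for n
  proof -
    define M where "M = real n"
    define N where "N = real n - 1"
    have N: "N \<ge> 3" "M \<ge> 4" "M > 0" using n by (simp_all add: N_def M_def)
    let ?P = "\<lambda>g i j. pz n g * tanh (edge_field \<theta> \<beta> n i j g)
        + (1 - (tanh (edge_field \<theta> \<beta> n i j g))\<^sup>2) * (spin g i j * (pz n g - pz n (toggle i j g)) / 2)"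
    have "Av n (\<lambda>g. offsum n (?P g)) = offsum n (\<lambda>i j. Av n (\<lambda>g. pz n g * spin g i j))"
      by (rule stein_offsum[symmetric])
    also have "\<dots> = Av n (\<lambda>g. pz n g * offsum n (\<lambda>i j. spin g i j))"
      by (simp add: gibbs_mean_sum sum_distrib_left)
    also have "\<dots> = Av n (\<lambda>g. (N * M) * (pz n g * mz n g))"
    proof (rule gibbs_mean_cong)
      fix g assume "g \<in> graphs n"
      from offsum_spin_one[OF this] n
      show "pz n g * offsum n (\<lambda>i j. spin g i j) = (N * M) * (pz n g * mz n g)" by (simp add: N_def M_def)
    qed
    finally have P: "Av n (\<lambda>g. offsum n (?P g)) = Av n (\<lambda>g. (N * M) * (pz n g * mz n g))" .
    have "(N * M) * Av n (\<lambda>g. (pz n g)\<^sup>2) = Av n (\<lambda>g. (N * M) * (pz n g * mz n g) - (N * M) * (pz n g * T0 n g))"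
      unfolding gibbs_mean_cmult[symmetric] by (intro gibbs_mean_cong) (simp add: pz_def power2_eq_square algebra_simps)
    also have "\<dots> = Av n (\<lambda>g. offsum n (?P g) - (N * M) * (pz n g * T0 n g))"
      by (simp only: gibbs_mean_diff P)
    also have "\<dots> \<le> Av n (\<lambda>g. (N * M) * ((pz n g)\<^sup>2 / 2) + (c1\<^sup>2 * M / (2 * N) * (RR n g)\<^sup>2 + c2))"
    proof (rule gibbs_mean_mono)
      fix g assume g: "g \<in> graphs n"
      have RR1: "1 \<le> RR n g" by (rule RR_ge_1) (use n in simp)
      have e1: "\<bar>offsum n (\<lambda>i j. tanh (edge_field \<theta> \<beta> n i j g)) - N * M * T0 n g\<bar> \<le> M * (c1 * RR n g)"
      proof -
        have eq: "offsum n (\<lambda>i j. tanh (edge_field \<theta> \<beta> n i j g)) - N * M * T0 n g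
           = offsum n (\<lambda>i j. tanh (edge_field \<theta> \<beta> n i j g) - T0 n g - T1 n g * sd n i j g) + T1 n g * offsum n (\<lambda>i j. sd n i j g)"
          using offsum_const[where n = n and c = "T0 n g"] by (simp add: sum_subtractf sum_distrib_left N_def M_def)
        have "\<bar>offsum n (\<lambda>i j. tanh (edge_field \<theta> \<beta> n i j g)) - N * M * T0 n g\<bar>
            \<le> 9 * \<theta>\<^sup>2 * (4 * M * kap * RR n g) + 2 * \<theta> * M"
          unfolding eq
        proof (rule order.trans[OF abs_triangle_ineq add_mono])
          have "\<bar>offsum n (\<lambda>i j. tanh (edge_field \<theta> \<beta> n i j g) - T0 n g - T1 n g * sd n i j g)\<bar>
             \<le> offsum n (\<lambda>i j. 9 * \<theta>\<^sup>2 * (bb n g i j)\<^sup>2)"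
            by (intro offsum_abs_le order.trans[OF T_expand2] sd_square_le n g)
          also have "\<dots> = 9 * \<theta>\<^sup>2 * offsum n (\<lambda>i j. (bb n g i j)\<^sup>2)" by (simp add: sum_distrib_left)
          also have "\<dots> \<le> 9 * \<theta>\<^sup>2 * (4 * M * kap * RR n g)"
            using offsum_bb_2[of n g] n by (intro mult_left_mono) (auto simp: M_def)
          finally show "\<bar>offsum n (\<lambda>i j. tanh (edge_field \<theta> \<beta> n i j g) - T0 n g - T1 n g * sd n i j g)\<bar>
             \<le> 9 * \<theta>\<^sup>2 * (4 * M * kap * RR n g)" .
          have "\<bar>T1 n g * (- 2 * \<theta> * n * mz n g)\<bar> = T1 n g * (2 * \<theta> * M * \<bar>mz n g\<bar>)"
            using T1_bounds[of n g] \<theta>_pos by (simp add: abs_mult M_def)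
          also have "\<dots> \<le> 1 * (2 * \<theta> * M * 1)"
            using T1_bounds[of n g] \<theta>_pos mz_abs_le[OF g] n N by (intro mult_mono mult_left_mono) auto
          finally show "\<bar>T1 n g * offsum n (\<lambda>i j. sd n i j g)\<bar> \<le> 2 * \<theta> * M"
            unfolding offsum_sd[OF g n] by simp
        qed
        also have "\<dots> \<le> 9 * \<theta>\<^sup>2 * (4 * M * kap * RR n g) + 2 * \<theta> * M * RR n g"
        proof (rule add_left_mono)
          have "2 * \<theta> * M * 1 \<le> 2 * \<theta> * M * RR n g"
            by (rule mult_left_mono[OF RR1]) (use \<theta>_pos N(3) in simp)
          thus "2 * \<theta> * M \<le> 2 * \<theta> * M * RR n g" by (simp only: mult_1_right)
        qed
        also have "\<dots> = M * (c1 * RR n g)" by (simp add: c1_def algebra_simps)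
        finally show ?thesis .
      qed
      have e2: "\<bar>offsum n (\<lambda>i j. (1 - (tanh (edge_field \<theta> \<beta> n i j g))\<^sup>2) * (spin g i j * (pz n g - pz n (toggle i j g)) / 2))\<bar> \<le> c2"
      proof -
        have "\<bar>offsum n (\<lambda>i j. (1 - (tanh (edge_field \<theta> \<beta> n i j g))\<^sup>2) * (spin g i j * (pz n g - pz n (toggle i j g)) / 2))\<bar>
           \<le> offsum n (\<lambda>i j. c2 / (M * N))"
        proof (rule offsum_abs_le)
          fix i j assume ij: "i \<in> {1..n}" "j \<in> {1..n}" "i \<noteq> j"
          have "\<bar>(1 - (tanh (edge_field \<theta> \<beta> n i j g))\<^sup>2) * (spin g i j * (pz n g - pz n (toggle i j g)) / 2)\<bar>
            = (1 - (tanh (edge_field \<theta> \<beta> n i j g))\<^sup>2) * (\<bar>pz n g - pz n (toggle i j g)\<bar> / 2)"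
            unfolding abs_mult half_spin_abs[OF g] using sech2_bounds by simp
          also have "\<dots> \<le> 1 * (((4 + 8 * \<theta>) / (M * N)) / 2)"
            using pz_toggle_abs[OF g ij n] sech2_bounds unfolding M_def N_def by (intro mult_mono divide_right_mono) auto
          also have "\<dots> = c2 / (M * N)" using N by (simp add: c2_def field_simps)
          finally show "\<bar>(1 - (tanh (edge_field \<theta> \<beta> n i j g))\<^sup>2) * (spin g i j * (pz n g - pz n (toggle i j g)) / 2)\<bar> \<le> c2 / (M * N)" .
        qed
        also have "\<dots> = c2" unfolding offsum_const using N by (simp add: N_def M_def)
        finally show ?thesis .
      qed
      have "offsum n (?P g) - (N * M) * (pz n g * T0 n g)
        = pz n g * (offsum n (\<lambda>i j. tanh (edge_field \<theta> \<beta> n i j g)) - N * M * T0 n g)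
          + offsum n (\<lambda>i j. (1 - (tanh (edge_field \<theta> \<beta> n i j g))\<^sup>2) * (spin g i j * (pz n g - pz n (toggle i j g)) / 2))"
        by (simp add: sum.distrib sum_distrib_left algebra_simps)
      also have "\<dots> \<le> \<bar>pz n g\<bar> * (M * (c1 * RR n g)) + c2"
        using mult_left_mono[OF e1, of "\<bar>pz n g\<bar>"] e2 abs_ge_self[of "pz n g * (offsum n (\<lambda>i j. tanh (edge_field \<theta> \<beta> n i j g)) - N * M * T0 n g)"]
        unfolding abs_mult by linarith
      \<comment> \<open>The weights are chosen so that half of
        \<open>(N * M) * (pz n g)\<^sup>2\<close> appears, to be absorbed into the left
        side.\<close>
      also have "\<bar>pz n g\<bar> * (M * (c1 * RR n g)) \<le> (N * M) * ((pz n g)\<^sup>2 / 2) + c1\<^sup>2 * M / (2 * N) * (RR n g)\<^sup>2"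
      proof -
        have "0 \<le> M / (2 * N) * (N * \<bar>pz n g\<bar> - c1 * RR n g)\<^sup>2" using N by simp
        also have "\<dots> = (N * M) * (\<bar>pz n g\<bar>\<^sup>2 / 2) + c1\<^sup>2 * M / (2 * N) * (RR n g)\<^sup>2 - \<bar>pz n g\<bar> * (M * (c1 * RR n g))"
          using N by (simp add: power2_eq_square field_simps)
        finally show ?thesis by simp
      qed
      finally show "offsum n (?P g) - (N * M) * (pz n g * T0 n g)
         \<le> (N * M) * ((pz n g)\<^sup>2 / 2) + (c1\<^sup>2 * M / (2 * N) * (RR n g)\<^sup>2 + c2)" by simp
    qed
    also have "\<dots> = (N * M) * (1 / 2 * Av n (\<lambda>g. (pz n g)\<^sup>2)) + (c1\<^sup>2 * M / (2 * N) * Av n (\<lambda>g. (RR n g)\<^sup>2) + c2)"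
      by (simp only: gibbs_mean_add gibbs_mean_cmult gibbs_mean_const) (simp add: gibbs_mean_cmult[of _ _ _ "1/2", simplified])
    also have "\<dots> \<le> (N * M) * (1 / 2 * Av n (\<lambda>g. (pz n g)\<^sup>2)) + (c1\<^sup>2 * M / (2 * N) * C0 + c2)"
      using C0(2)[of n] n N by (intro add_left_mono add_right_mono mult_left_mono) auto
    finally have "Av n (\<lambda>g. (pz n g)\<^sup>2) \<le> 2 / (N * M) * (c1\<^sup>2 * M / (2 * N) * C0 + c2)"
      using N by (simp add: field_simps)
    also have "\<dots> = (c1\<^sup>2 * C0) * (1 / N)\<^sup>2 + (2 * c2) * (1 / N) * (1 / M)"
      using N by (simp add: field_simps power2_eq_square)
    also have "\<dots> \<le> (c1\<^sup>2 * C0) * (2 / M)\<^sup>2 + (2 * c2) * (2 / M) * (1 / M)"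
    proof -
      have "1 / N \<le> 2 / M" using n by (simp add: N_def M_def field_simps)
      thus ?thesis using N c12 C0(1) by (intro add_mono mult_left_mono mult_right_mono power_mono) auto
    qed
    also have "\<dots> = C / M\<^sup>2" using N by (simp add: C_def power2_eq_square field_simps)
    finally show ?thesis unfolding M_def .
  qed
  moreover have "C \<ge> 0" using c12 C0(1) by (simp add: C_def)
  ultimately show ?thesis by blast
qed

end

section \<open>Bounds for a single edge\<close>

text \<open>Split at x = \<epsilon> r. Above it, r \<ge> 1 forces x / \<epsilon> \<ge> 1, and this
  spare factor raises the power to 3. The inequality trades a third moment of x for a second moment
  of r.\<close>

lemma young_cube:
  fixes x r \<epsilon> :: real
  assumes "x \<ge> 0" "r \<ge> 1" "\<epsilon> > 0"
  shows "x * r \<le> \<epsilon> * r\<^sup>2 + x ^ 3 / \<epsilon>\<^sup>2"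
proof (cases "x \<le> \<epsilon> * r")
  case True
  have "x * r \<le> \<epsilon> * r * r" using True assms by (intro mult_right_mono) auto
  moreover have "0 \<le> x ^ 3 / \<epsilon>\<^sup>2" using assms by simp
  ultimately show ?thesis by (simp add: power2_eq_square mult_ac)
next
  case False
  hence r: "r \<le> x / \<epsilon>" using assms by (simp add: field_simps)
  hence 1: "1 \<le> x / \<epsilon>" using assms by linarith
  have "x * r \<le> x * (x / \<epsilon>)" using r assms by (intro mult_left_mono) auto
  also have "\<dots> \<le> x * (x / \<epsilon>) * (x / \<epsilon>)" using 1 assms mult_left_mono[OF 1, of "x * (x / \<epsilon>)"] by simp
  also have "\<dots> = x ^ 3 / \<epsilon>\<^sup>2" by (simp add: power2_eq_square power3_eq_cube)
  also have "\<dots> \<le> \<epsilon> * r\<^sup>2 + x ^ 3 / \<epsilon>\<^sup>2" using assms by simp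
  finally show ?thesis .
qed

lemma abs_mult_le: "\<bar>a\<bar> \<le> A \<Longrightarrow> \<bar>b\<bar> \<le> B \<Longrightarrow> \<bar>a * b\<bar> \<le> A * (B::real)"
  unfolding abs_mult by (intro mult_mono) auto

text \<open>The balancing choice of \<epsilon> in \<open>young_cube\<close> for x = sqrt n * y when
  y^3 has mean of order n^(-2): by \<open>rate_balance\<close> both terms then have the same
  order.\<close>

definition rate :: "nat \<Rightarrow> real" where
  "rate n = real n powr (- 1 / 6)"

lemma rate_pos: "n > 0 \<Longrightarrow> rate n > 0"
  by (simp add: rate_def)

lemma inverse_sqrt_le_rate: "n > 0 \<Longrightarrow> 1 / sqrt n \<le> rate n"
proof -
  assume n: "n > 0"
  have "1 / sqrt n = real n powr (- 1 / 2)"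
    using n by (simp add: powr_half_sqrt[symmetric] powr_minus_divide)
  also have "\<dots> \<le> rate n" unfolding rate_def using n by (intro powr_mono) auto
  finally show ?thesis .
qed

lemma rate_balance: "n > 0 \<Longrightarrow> (sqrt n) ^ 3 / (rate n)\<^sup>2 / (real n)\<^sup>2 = rate n"
proof -
  assume n: "n > 0"
  have 1: "(sqrt n) ^ 3 = real n powr (3 / 2)"
    using n by (simp add: powr_half_sqrt[symmetric] powr_powr flip: powr_numeral)
  have 2: "(rate n)\<^sup>2 = real n powr (- 1 / 3)"
    using n by (simp add: rate_def powr_powr flip: powr_numeral)
  have 3: "(real n)\<^sup>2 = real n powr 2" using n by (simp add: powr_numeral)
  show ?thesis unfolding 1 2 3 unfolding rate_def powr_diff[symmetric] by simp
qed

lemma abs_sum5_le: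
  fixes a b c d e :: real
  assumes "\<bar>a\<bar> \<le> A" "\<bar>b\<bar> \<le> B" "\<bar>c\<bar> \<le> C" "\<bar>d\<bar> \<le> D" "\<bar>e\<bar> \<le> E"
  shows "\<bar>a - b + c - d + e / 2\<bar> \<le> A + B + C + D + E / 2"
  using assms by linarith

lemma abs_sum6_le:
  fixes a b c d e f :: real
  assumes "\<bar>a\<bar> \<le> A" "\<bar>b\<bar> \<le> B" "\<bar>c\<bar> \<le> C" "\<bar>d\<bar> \<le> D" "\<bar>e\<bar> \<le> E" "\<bar>f\<bar> \<le> F"
  shows "\<bar>a + b / 2 + c + d + e + f\<bar> \<le> A + B / 2 + C + D + E + F"
  using assms by linarith

text \<open>One edge of Stein's identity for the test function \<open>G * y\<^sup>2\<close>, where G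
  is nearly invariant under toggling. The factor y^2 is already of second order, so expanding tanh
  up to a quadratic remainder gives an error of fourth order, 1 / M counting as second order. Plain
  real variables keep the algebra free of graph terms.\<close>

lemma S3_pair_bound:
  fixes y v Y b T T0 T1 s \<eta> N M \<theta> V c G G' B y' :: real
  assumes y: "\<bar>y\<bar> \<le> b" and Y: "\<bar>Y\<bar> = 1" "Y * Y = 1"
    and s: "s = \<theta> * v - c * Y" "\<bar>s\<bar> \<le> 3 * \<theta> * b" and c: "0 \<le> c" "c \<le> 4 * \<theta> / M"
    and \<eta>: "0 \<le> \<eta>" "\<eta> \<le> 1 / M" and b: "2 / M \<le> b" and M: "M > 0" and \<theta>: "\<theta> > 0"
    and T: "\<bar>T - T0 - T1 * s\<bar> \<le> 9 * \<theta>\<^sup>2 * b\<^sup>2" and V: "\<bar>V - T1\<bar> \<le> 2 * \<bar>s\<bar>" "0 \<le> V" "V \<le> 1"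
    and T1: "0 \<le> T1" "T1 \<le> 1"
    and G: "\<bar>G\<bar> \<le> B" "\<bar>G - G'\<bar> \<le> B * b\<^sup>2" and y': "y' = y - 2 * Y * \<eta>"
  shows "\<bar>(G * y\<^sup>2) * T + V * (Y * (G * y\<^sup>2 - G' * y'\<^sup>2) / 2)
      - G * (T0 * y\<^sup>2 + \<theta> * T1 * (y\<^sup>2 * v) + 2 * \<eta> * T1 * y)\<bar>
    \<le> B * ((9 * \<theta>\<^sup>2 + 2) * b ^ 4 + 16 * \<theta> / M * b\<^sup>2 + 2 / M\<^sup>2)"
proof -
  have b0: "b \<ge> 0" and B0: "B \<ge> 0" using y G(1) by linarith+
  have "Y * (G * y\<^sup>2 - G' * y'\<^sup>2) / 2 = G * (2 * \<eta> * (y * (Y * Y) - Y * \<eta> * (Y * Y))) + Y * ((G - G') * y'\<^sup>2) / 2"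
    unfolding y' by (simp add: power2_eq_square algebra_simps add_divide_distrib diff_divide_distrib)
  hence D: "Y * (G * y\<^sup>2 - G' * y'\<^sup>2) / 2 = G * (2 * \<eta> * (y - Y * \<eta>)) + Y * ((G - G') * y'\<^sup>2) / 2"
    unfolding Y(2) by simp
  have y2: "\<bar>y\<^sup>2\<bar> \<le> b\<^sup>2" using power_mono[OF y, of 2] by simp
  have e1: "\<bar>G * (y\<^sup>2 * (T - T0 - T1 * s))\<bar> \<le> B * (b\<^sup>2 * (9 * \<theta>\<^sup>2 * b\<^sup>2))"
    by (intro abs_mult_le G y2 T)
  have cY: "\<bar>c * Y\<bar> \<le> 4 * \<theta> / M * 1" using c Y by (intro abs_mult_le) auto
  have e2: "\<bar>G * (y\<^sup>2 * (T1 * (c * Y)))\<bar> \<le> B * (b\<^sup>2 * (1 * (4 * \<theta> / M * 1)))"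
    using T1 by (intro abs_mult_le G y2 cY) auto
  have V1: "\<bar>V - T1\<bar> \<le> 2 * (3 * \<theta> * b)" using V s by linarith
  have et: "\<bar>2 * \<eta>\<bar> \<le> 2 * (1 / M)" using \<eta> by simp
  have e3: "\<bar>G * (2 * \<eta> * (y * (V - T1)))\<bar> \<le> B * (2 * (1 / M) * (b * (2 * (3 * \<theta> * b))))"
    by (intro abs_mult_le G y V1 et)
  have e4: "\<bar>G * (2 * \<eta> * (\<eta> * (V * Y)))\<bar> \<le> B * (2 * (1 / M) * (1 / M * (1 * 1)))"
    using \<eta> V Y by (intro abs_mult_le G et) auto
  have ya: "\<bar>y'\<bar> \<le> 2 * b"
  proof -
    have "\<bar>2 * Y * \<eta>\<bar> \<le> 2 * (1 / M)" using Y \<eta> by (simp add: abs_mult)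
    thus ?thesis using y b unfolding y' by linarith
  qed
  have y'2: "\<bar>y'\<^sup>2\<bar> \<le> (2 * b)\<^sup>2" using power_mono[OF ya, of 2] by simp
  have e5: "\<bar>V * (Y * ((G - G') * y'\<^sup>2))\<bar> \<le> 1 * (1 * ((B * b\<^sup>2) * (2 * b)\<^sup>2))"
    using V Y by (intro abs_mult_le G y'2) auto
  have "(G * y\<^sup>2) * T + V * (Y * (G * y\<^sup>2 - G' * y'\<^sup>2) / 2)
      - G * (T0 * y\<^sup>2 + \<theta> * T1 * (y\<^sup>2 * v) + 2 * \<eta> * T1 * y)
    = G * (y\<^sup>2 * (T - T0 - T1 * s)) - G * (y\<^sup>2 * (T1 * (c * Y)))
      + G * (2 * \<eta> * (y * (V - T1))) - G * (2 * \<eta> * (\<eta> * (V * Y))) + V * (Y * ((G - G') * y'\<^sup>2)) / 2"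
    unfolding D s(1) by (simp add: algebra_simps)
  hence "\<bar>(G * y\<^sup>2) * T + V * (Y * (G * y\<^sup>2 - G' * y'\<^sup>2) / 2)
      - G * (T0 * y\<^sup>2 + \<theta> * T1 * (y\<^sup>2 * v) + 2 * \<eta> * T1 * y)\<bar>
    \<le> B * (b\<^sup>2 * (9 * \<theta>\<^sup>2 * b\<^sup>2)) + B * (b\<^sup>2 * (1 * (4 * \<theta> / M * 1))) + B * (2 * (1 / M) * (b * (2 * (3 * \<theta> * b))))
      + B * (2 * (1 / M) * (1 / M * (1 * 1))) + (1 * (1 * ((B * b\<^sup>2) * (2 * b)\<^sup>2))) / 2"
    by (simp only: abs_sum5_le[OF e1 e2 e3 e4 e5])
  also have "\<dots> = B * ((9 * \<theta>\<^sup>2 + 2) * b ^ 4 + 16 * \<theta> / M * b\<^sup>2 + 2 / M\<^sup>2)"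
    using M by (simp add: power2_eq_square power4_eq_xxxx field_simps)
  finally show ?thesis .
qed

text \<open>The analogue for f(W) y. With only one factor y the expansion of tanh must go one order
  further to reach \<open>b ^ 4\<close>, and the increment of f must be resolved to first order
  since it supplies the derivative term of the limit equation. Here q is sqrt n / (n - 1) and v is
  y_i + y_j.\<close>

lemma main_pair_bound:
  fixes y v Y b T T0 T1 s \<eta> \<theta> V c f f' f1 L y' q r :: real
  assumes y: "\<bar>y\<bar> \<le> b" and v: "\<bar>v\<bar> \<le> b" and Y: "\<bar>Y\<bar> = 1" "Y * Y = 1"
    and s: "s = \<theta> * v - c * Y" "\<bar>s\<bar> \<le> 3 * \<theta> * b" and c: "0 \<le> c" "c \<le> 2 * \<theta> * b\<^sup>2"
    and \<eta>: "0 \<le> \<eta>" "2 * \<eta> \<le> b\<^sup>2" "2 * \<eta> \<le> b" and q: "0 \<le> q" "q \<le> b" and \<theta>: "\<theta> > 0"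
    and T: "\<bar>T - T0 - T1 * s + T0 * T1 * s\<^sup>2\<bar> \<le> \<bar>s\<bar> ^ 3"
    and V: "\<bar>V - T1\<bar> \<le> 2 * \<bar>s\<bar>" "\<bar>V - T1 + 2 * T0 * T1 * s\<bar> \<le> 27 * \<theta>\<^sup>2 * b\<^sup>2" "0 \<le> V" "V \<le> 1"
    and T01: "0 \<le> T1" "T1 \<le> 1" "\<bar>T0\<bar> \<le> 1"
    and f: "\<bar>f\<bar> \<le> L" "\<bar>f1\<bar> \<le> L" and y': "y' = y - 2 * Y * \<eta>" "\<bar>y'\<bar> \<le> 2"
    and r: "f - f' = f1 * (4 * q * (Y * (v - 2 * Y * \<eta>))) + r" "\<bar>r\<bar> \<le> 32 * L * b ^ 4"
  shows "\<bar>(f * y) * T + V * (Y * (f * y - f' * y') / 2)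
      - (f * (T0 * y + T1 * (\<theta> * (y * v) - c * (y * Y)) - T0 * T1 * \<theta>\<^sup>2 * (y * v\<^sup>2))
         + f * \<eta> * T1 - 2 * \<theta> * T0 * T1 * f * \<eta> * v + 2 * q * f1 * T1 * (y * v))\<bar>
    \<le> L * ((38 + 14 * \<theta> + 22 * \<theta>\<^sup>2 + 27 * \<theta> ^ 3) * b ^ 4)"
proof -
  have b0: "b \<ge> 0" and L0: "L \<ge> 0" using y f(1) by linarith+
  define D where "D = Y * (f * y - f' * y') / 2"
  \<comment> \<open>Discrete product rule: the increment of y multiplies f, the increment of f
    multiplies the toggled value \<open>y'\<close>.\<close>
  have "D = f * \<eta> * (Y * Y) + Y * (f - f') * y' / 2"
    unfolding D_def y'(1) by (simp add: algebra_simps add_divide_distrib diff_divide_distrib)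
  also have "\<dots> = f * \<eta> + Y * (f - f') * y' / 2" unfolding Y(2) by simp
  also have "Y * (f - f') * y' / 2 = f1 * (2 * q * (Y * Y) * ((v - 2 * Y * \<eta>) * y')) + Y * (r * y') / 2"
    unfolding r(1) by (simp add: algebra_simps add_divide_distrib diff_divide_distrib)
  also have "\<dots> = f1 * (2 * q * ((v - 2 * Y * \<eta>) * y')) + Y * (r * y') / 2" unfolding Y(2) by simp
  also have "(v - 2 * Y * \<eta>) * y' = v * y - Y * (2 * \<eta> * (y + v)) + (2 * \<eta>) * (2 * \<eta>) * (Y * Y)"
    unfolding y'(1) by (simp add: algebra_simps)
  also have "\<dots> = v * y - Y * (2 * \<eta> * (y + v)) + (2 * \<eta>) * (2 * \<eta>)" unfolding Y(2) by simp
  finally have D: "D - f * \<eta> - 2 * q * f1 * (v * y)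
     = f1 * (2 * q * ((2 * \<eta>) * (2 * \<eta>) - Y * (2 * \<eta> * (y + v)))) + Y * (r * y') / 2"
    by (simp add: algebra_simps)
  have q2: "\<bar>2 * q\<bar> \<le> 2 * b" using q by simp
  have et: "\<bar>2 * \<eta>\<bar> \<le> b\<^sup>2" "\<bar>2 * \<eta>\<bar> \<le> b" using \<eta> by simp_all
  have yv: "\<bar>y + v\<bar> \<le> 2 * b" using y v by linarith
  have d1: "\<bar>(2 * \<eta>) * (2 * \<eta>) - Y * (2 * \<eta> * (y + v))\<bar> \<le> 3 * (b\<^sup>2 * b)"
  proof -
    have "\<bar>(2 * \<eta>) * (2 * \<eta>)\<bar> \<le> b\<^sup>2 * b" by (intro abs_mult_le et)
    moreover have "\<bar>Y * (2 * \<eta> * (y + v))\<bar> \<le> 1 * (b\<^sup>2 * (2 * b))"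
      using Y by (intro abs_mult_le et yv) auto
    ultimately have "\<bar>(2 * \<eta>) * (2 * \<eta>) - Y * (2 * \<eta> * (y + v))\<bar> \<le> b\<^sup>2 * b + 1 * (b\<^sup>2 * (2 * b))"
      by linarith
    also have "\<dots> = 3 * (b\<^sup>2 * b)" by simp
    finally show ?thesis .
  qed
  have "\<bar>f1 * (2 * q * ((2 * \<eta>) * (2 * \<eta>) - Y * (2 * \<eta> * (y + v))))\<bar> \<le> L * (2 * b * (3 * (b\<^sup>2 * b)))"
    by (intro abs_mult_le f q2 d1)
  moreover have "\<bar>Y * (r * y')\<bar> \<le> 1 * (32 * L * b ^ 4 * 2)"
    using Y by (intro abs_mult_le r y') auto
  ultimately have "\<bar>D - f * \<eta> - 2 * q * f1 * (v * y)\<bar> \<le> L * (2 * b * (3 * (b\<^sup>2 * b))) + 32 * L * b ^ 4"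
    unfolding D by linarith
  hence D': "\<bar>D - f * \<eta> - 2 * q * f1 * (v * y)\<bar> \<le> 38 * L * b ^ 4"
    by (simp add: power2_eq_square power4_eq_xxxx algebra_simps)
  have e1: "\<bar>V * (D - f * \<eta> - 2 * q * f1 * (v * y))\<bar> \<le> 1 * (38 * L * b ^ 4)"
    using V by (intro abs_mult_le D') auto
  have e2: "\<bar>f * (2 * \<eta> * (V - T1 + 2 * T0 * T1 * s))\<bar> \<le> L * (b\<^sup>2 * (27 * \<theta>\<^sup>2 * b\<^sup>2))"
    by (intro abs_mult_le f et V)
  have cY: "\<bar>c * Y\<bar> \<le> 2 * \<theta> * b\<^sup>2 * 1" using c Y by (intro abs_mult_le) auto
  have e3: "\<bar>f * (2 * \<eta> * (T0 * (T1 * (c * Y))))\<bar> \<le> L * (b\<^sup>2 * (1 * (1 * (2 * \<theta> * b\<^sup>2 * 1))))"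
    using T01 by (intro abs_mult_le f et cY) auto
  have V1: "\<bar>V - T1\<bar> \<le> 2 * (3 * \<theta> * b)" using V s by linarith
  have e4: "\<bar>2 * q * (f1 * (v * (y * (V - T1))))\<bar> \<le> 2 * b * (L * (b * (b * (2 * (3 * \<theta> * b)))))"
    by (intro abs_mult_le q2 f v y V1)
  have s3: "\<bar>T - T0 - T1 * s + T0 * T1 * s\<^sup>2\<bar> \<le> (3 * \<theta> * b) ^ 3"
    using T power_mono[OF s(2), of 3] by simp
  have e5: "\<bar>f * (y * (T - T0 - T1 * s + T0 * T1 * s\<^sup>2))\<bar> \<le> L * (b * (3 * \<theta> * b) ^ 3)"
    by (intro abs_mult_le f y s3)
  have sv: "\<bar>s + \<theta> * v\<bar> \<le> 4 * \<theta> * b"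
  proof -
    have "\<bar>\<theta> * v\<bar> \<le> \<theta> * b" using v \<theta> by (simp add: abs_mult)
    thus ?thesis using s(2) by linarith
  qed
  have e6: "\<bar>f * (y * (T0 * (T1 * ((c * Y) * (s + \<theta> * v)))))\<bar> \<le> L * (b * (1 * (1 * ((2 * \<theta> * b\<^sup>2 * 1) * (4 * \<theta> * b)))))"
    using T01 by (intro abs_mult_le f y cY sv) auto
  have "(f * y) * T + V * D
      - (f * (T0 * y + T1 * (\<theta> * (y * v) - c * (y * Y)) - T0 * T1 * \<theta>\<^sup>2 * (y * v\<^sup>2))
         + f * \<eta> * T1 - 2 * \<theta> * T0 * T1 * f * \<eta> * v + 2 * q * f1 * T1 * (y * v))
    = V * (D - f * \<eta> - 2 * q * f1 * (v * y)) + f * (2 * \<eta> * (V - T1 + 2 * T0 * T1 * s)) / 2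
      + f * (2 * \<eta> * (T0 * (T1 * (c * Y)))) + 2 * q * (f1 * (v * (y * (V - T1))))
      + f * (y * (T - T0 - T1 * s + T0 * T1 * s\<^sup>2)) + f * (y * (T0 * (T1 * ((c * Y) * (s + \<theta> * v)))))"
    unfolding s(1) by (simp add: power2_eq_square algebra_simps add_divide_distrib diff_divide_distrib)
  hence "\<bar>(f * y) * T + V * D
      - (f * (T0 * y + T1 * (\<theta> * (y * v) - c * (y * Y)) - T0 * T1 * \<theta>\<^sup>2 * (y * v\<^sup>2))
         + f * \<eta> * T1 - 2 * \<theta> * T0 * T1 * f * \<eta> * v + 2 * q * f1 * T1 * (y * v))\<bar>
    \<le> 1 * (38 * L * b ^ 4) + (L * (b\<^sup>2 * (27 * \<theta>\<^sup>2 * b\<^sup>2))) / 2 + L * (b\<^sup>2 * (1 * (1 * (2 * \<theta> * b\<^sup>2 * 1))))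
      + 2 * b * (L * (b * (b * (2 * (3 * \<theta> * b))))) + L * (b * (3 * \<theta> * b) ^ 3)
      + L * (b * (1 * (1 * ((2 * \<theta> * b\<^sup>2 * 1) * (4 * \<theta> * b)))))"
    by (simp only: abs_sum6_le[OF e1 e2 e3 e4 e5 e6])
  also have "\<dots> = L * ((38 + 14 * \<theta> + (43/2) * \<theta>\<^sup>2 + 27 * \<theta> ^ 3) * b ^ 4)"
    by (simp add: power2_eq_square power3_eq_cube power4_eq_xxxx field_simps)
  also have "\<dots> \<le> L * ((38 + 14 * \<theta> + 22 * \<theta>\<^sup>2 + 27 * \<theta> ^ 3) * b ^ 4)"
    using L0 by (intro mult_left_mono mult_right_mono) auto
  finally show ?thesis unfolding D_def .
qed

context two_star
begin

section \<open>Concentration of the squared mean field value\<close>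

text \<open>\<open>Qt\<close> at z_i is at most six times the interaction with each j, hence of
  order star energy over n after averaging, and \<open>Qt_shift\<close> carries it to the mean.
  Every vertex i yields such a bound.\<close>

lemma Qt_mean_le:
  assumes g: "g \<in> graphs n" and n: "n \<ge> 4" and i: "i \<in> {1..n}"
  shows "Qt (mz n g) \<le> (24 + 2 * \<theta> * kap) * (1 + star_energy n g i) / n"
proof -
  let ?A = "star_energy n g i" and ?z = "zdeg n g"
  have "(real n - 1) * Qt (?z i) = (\<Sum>j\<in>{1..n} - {i}. Qt (?z i))" using i by (simp add: of_nat_diff)
  also have "\<dots> \<le> (\<Sum>j\<in>{1..n} - {i}. 6 * h (?z i) (?z j))" by (intro sum_mono Qt_le_h)
  also have "\<dots> = 6 * ?A" by (simp add: star_energy_def sum_distrib_left)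
  finally have "Qt (?z i) \<le> 6 * ?A * (1 / (real n - 1))" using n by (simp add: field_simps)
  also have "\<dots> \<le> 6 * ?A * (2 / n)"
    using n star_energy_nonneg[of n g i] by (intro mult_left_mono) (auto simp: field_simps)
  finally have 1: "Qt (?z i) \<le> 12 * ?A / n" by simp
  have "Qt (mz n g) \<le> 2 * Qt (?z i) + 2 * \<theta> * (mz n g - ?z i)\<^sup>2" by (rule Qt_shift)
  also have "(mz n g - ?z i)\<^sup>2 = (yd n g i)\<^sup>2" by (simp add: yd_def power2_commute)
  also have "2 * Qt (?z i) + 2 * \<theta> * (yd n g i)\<^sup>2 \<le> 2 * (12 * (1 + ?A) / n) + 2 * \<theta> * (kap * (1 + ?A) / n)"
    using 1 yd_square_le[of n i g] n i \<theta>_pos unfolding ub_square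
    by (intro add_mono mult_left_mono order.trans[OF 1] divide_right_mono) auto
  also have "\<dots> = (24 + 2 * \<theta> * kap) * (1 + ?A) / n"
    by (simp add: algebra_simps add_divide_distrib)
  finally show ?thesis .
qed

text \<open>The left side does not depend on i, so the cubed bounds of all vertices may be averaged,
  which brings in \<open>RR\<close>.\<close>

lemma Qt_mean_cube_le:
  assumes g: "g \<in> graphs n" and n: "n \<ge> 4"
  shows "Qt (mz n g) ^ 3 \<le> (24 + 2 * \<theta> * kap) ^ 3 * RR n g / real n ^ 3"
proof -
  define c where "c = 24 + 2 * \<theta> * kap"
  have c: "c \<ge> 0" using \<theta>_pos kap_ge_1 by (simp add: c_def)
  have "real n * Qt (mz n g) ^ 3 = (\<Sum>i=1..n. Qt (mz n g) ^ 3)" by simp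
  also have "\<dots> \<le> (\<Sum>i=1..n. (c * (1 + star_energy n g i) / n) ^ 3)"
    unfolding c_def using g n by (intro sum_mono power_mono Qt_mean_le Qt_nonneg) auto
  also have "\<dots> = c ^ 3 / real n ^ 3 * (\<Sum>i=1..n. (1 + star_energy n g i) ^ 3)"
    by (simp add: power_divide power_mult_distrib sum_distrib_left)
  also have "\<dots> \<le> c ^ 3 / real n ^ 3 * (n * RR n g)"
    using c by (intro mult_left_mono star_power_le) auto
  also have "\<dots> = real n * (c ^ 3 * RR n g / real n ^ 3)" by simp
  finally have "real n * Qt (mz n g) ^ 3 \<le> real n * (c ^ 3 * RR n g / real n ^ 3)" .
  thus ?thesis unfolding c_def by (rule mult_left_le_imp_le) (use n in simp)
qed

text \<open>\<open>K_bound\<close> is applied at x = m, where the residual is \<open>pz\<close>. Its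
  square contributes n^(-2), the potential term only n^(-3).\<close>

lemma ez_moment: "\<exists>C\<ge>0. \<forall>n\<ge>4. Av n (\<lambda>g. ez n g ^ 3) \<le> C / (real n)\<^sup>2"
proof -
  obtain C0 where C0: "C0 \<ge> 1" "\<And>n. n \<ge> 3 \<Longrightarrow> Av n (\<lambda>g. (RR n g)\<^sup>2) \<le> C0"
    using RR_square_moment by blast
  obtain C1 where C1: "C1 \<ge> 0" "\<And>n. n \<ge> 4 \<Longrightarrow> Av n (\<lambda>g. (pz n g)\<^sup>2) \<le> C1 / (real n)\<^sup>2"
    using pz_moment by blast
  define c where "c = (24 + 2 * \<theta> * kap) ^ 3"
  have c: "c \<ge> 0" using \<theta>_pos kap_ge_1 by (simp add: c_def)
  have "Av n (\<lambda>g. ez n g ^ 3) \<le> (\<bar>K\<bar> * (C1 + c * C0)) / (real n)\<^sup>2" if n: "n \<ge> 4" for n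
  proof -
    have "Av n (\<lambda>g. ez n g ^ 3) \<le> Av n (\<lambda>g. \<bar>K\<bar> * ((pz n g)\<^sup>2 + c / real n ^ 3 * RR n g))"
    proof (rule gibbs_mean_mono)
      fix g assume g: "g \<in> graphs n"
      have "ez n g ^ 3 \<le> K * ((pz n g)\<^sup>2 + Qt (mz n g) ^ 3)"
        using K_bound[OF mz_abs_le[OF g]] n unfolding ez_def T0_def pz_def Qt_def by simp
      also have "\<dots> \<le> \<bar>K\<bar> * ((pz n g)\<^sup>2 + Qt (mz n g) ^ 3)"
        using Qt_nonneg[of "mz n g"] by (intro mult_right_mono) auto
      also have "\<dots> \<le> \<bar>K\<bar> * ((pz n g)\<^sup>2 + c / real n ^ 3 * RR n g)"
        using Qt_mean_cube_le[OF g n] by (intro mult_left_mono add_left_mono) (auto simp: c_def)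
      finally show "ez n g ^ 3 \<le> \<bar>K\<bar> * ((pz n g)\<^sup>2 + c / real n ^ 3 * RR n g)" .
    qed
    also have "\<dots> = \<bar>K\<bar> * (Av n (\<lambda>g. (pz n g)\<^sup>2) + c / real n ^ 3 * Av n (\<lambda>g. RR n g))"
      by (simp only: gibbs_mean_cmult gibbs_mean_add)
    also have "\<dots> \<le> \<bar>K\<bar> * (C1 / (real n)\<^sup>2 + c / (real n)\<^sup>2 * C0)"
    proof (intro mult_left_mono add_mono C1 mult_mono n)
      have "(real n)\<^sup>2 \<le> real n ^ 3" using n by (intro power_increasing) auto
      thus "c / real n ^ 3 \<le> c / (real n)\<^sup>2" using c n by (intro divide_left_mono) auto
      show "Av n (\<lambda>g. RR n g) \<le> C0" using RR_moment_le[of n] C0(2)[of n] n by simp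
      have "0 \<le> RR n g" for g using RR_ge_1[of n g] n by simp
      thus "0 \<le> Av n (\<lambda>g. RR n g)" by (intro gibbs_mean_nonneg)
    qed (use c in auto)
    also have "\<dots> = (\<bar>K\<bar> * (C1 + c * C0)) / (real n)\<^sup>2" by (simp add: algebra_simps add_divide_distrib)
    finally show ?thesis .
  qed
  moreover have "\<bar>K\<bar> * (C1 + c * C0) \<ge> 0" using C0 C1 c by simp
  ultimately show ?thesis by blast
qed

lemma ez_nonneg: "ez n g \<ge> 0"
  by (simp add: ez_def)

lemma ez_RR_moment: "\<exists>C\<ge>0. \<forall>n\<ge>4. sqrt n * Av n (\<lambda>g. ez n g * RR n g) \<le> C * rate n"
proof -
  obtain C0 where C0: "C0 \<ge> 1" "\<And>n. n \<ge> 3 \<Longrightarrow> Av n (\<lambda>g. (RR n g)\<^sup>2) \<le> C0"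
    using RR_square_moment by blast
  obtain C1 where C1: "C1 \<ge> 0" "\<And>n. n \<ge> 4 \<Longrightarrow> Av n (\<lambda>g. ez n g ^ 3) \<le> C1 / (real n)\<^sup>2"
    using ez_moment by blast
  have "sqrt n * Av n (\<lambda>g. ez n g * RR n g) \<le> (C0 + C1) * rate n" if n: "n \<ge> 4" for n
  proof -
    have n0: "n > 0" using n by simp
    have "sqrt n * Av n (\<lambda>g. ez n g * RR n g) = Av n (\<lambda>g. (sqrt n * ez n g) * RR n g)"
      by (simp only: gibbs_mean_cmult mult.assoc)
    also have "\<dots> \<le> Av n (\<lambda>g. rate n * (RR n g)\<^sup>2 + (sqrt n) ^ 3 / (rate n)\<^sup>2 * ez n g ^ 3)"
    proof (rule gibbs_mean_mono)
      fix g
      show "(sqrt n * ez n g) * RR n g \<le> rate n * (RR n g)\<^sup>2 + (sqrt n) ^ 3 / (rate n)\<^sup>2 * ez n g ^ 3"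
        using young_cube[of "sqrt n * ez n g" "RR n g" "rate n"] RR_ge_1[OF n0, of g] rate_pos[OF n0] ez_nonneg[of n g]
        by (simp add: power_mult_distrib)
    qed
    also have "\<dots> = rate n * Av n (\<lambda>g. (RR n g)\<^sup>2) + (sqrt n) ^ 3 / (rate n)\<^sup>2 * Av n (\<lambda>g. ez n g ^ 3)"
      by (simp only: gibbs_mean_cmult gibbs_mean_add)
    also have "\<dots> \<le> rate n * C0 + (sqrt n) ^ 3 / (rate n)\<^sup>2 * (C1 / (real n)\<^sup>2)"
      using C0(2)[of n] C1(2)[of n] n rate_pos[OF n0] by (intro add_mono mult_left_mono) auto
    also have "(sqrt n) ^ 3 / (rate n)\<^sup>2 * (C1 / (real n)\<^sup>2) = C1 * ((sqrt n) ^ 3 / (rate n)\<^sup>2 / (real n)\<^sup>2)"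
      by simp
    also have "\<dots> = C1 * rate n" unfolding rate_balance[OF n0] ..
    finally show ?thesis by (simp add: algebra_simps)
  qed
  thus ?thesis using C0 C1 by (intro exI[of _ "C0 + C1"]) auto
qed

text \<open>The weight n in the quadratic inequality is the inverse size of \<open>pz\<close>; what
  remains after scaling is n^(-1/2), which \<open>rate\<close> dominates.\<close>

lemma S2_pz_moment: "\<exists>C\<ge>0. \<forall>n\<ge>4. sqrt n * Av n (\<lambda>g. S2 n g * \<bar>pz n g\<bar>) \<le> C * rate n"
proof -
  obtain C0 where C0: "C0 \<ge> 1" "\<And>n. n \<ge> 3 \<Longrightarrow> Av n (\<lambda>g. (RR n g)\<^sup>2) \<le> C0"
    using RR_square_moment by blast
  obtain C1 where C1: "C1 \<ge> 0" "\<And>n. n \<ge> 4 \<Longrightarrow> Av n (\<lambda>g. (pz n g)\<^sup>2) \<le> C1 / (real n)\<^sup>2"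
    using pz_moment by blast
  have "sqrt n * Av n (\<lambda>g. S2 n g * \<bar>pz n g\<bar>) \<le> (kap\<^sup>2 * C0 + C1) * rate n" if n: "n \<ge> 4" for n
  proof -
    have n0: "n > 0" "real n > 0" using n by simp_all
    have "Av n (\<lambda>g. S2 n g * \<bar>pz n g\<bar>) \<le> Av n (\<lambda>g. kap\<^sup>2 / n * (RR n g)\<^sup>2 + n * (pz n g)\<^sup>2)"
    proof (rule gibbs_mean_mono)
      fix g
      have "0 \<le> (S2 n g - n * \<bar>pz n g\<bar>)\<^sup>2 / n + (S2 n g)\<^sup>2 / n + n * (pz n g)\<^sup>2"
        by simp
      also have "\<dots> = 2 * ((S2 n g)\<^sup>2 / n + n * (pz n g)\<^sup>2 - S2 n g * \<bar>pz n g\<bar>)"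
        using n0 by (simp add: power2_eq_square field_simps)
      finally have "S2 n g * \<bar>pz n g\<bar> \<le> (S2 n g)\<^sup>2 / n + n * (pz n g)\<^sup>2" by simp
      also have "(S2 n g)\<^sup>2 \<le> (kap * RR n g)\<^sup>2" using S2_le[OF n0(1), of g] S2_nonneg by (intro power_mono) auto
      finally show "S2 n g * \<bar>pz n g\<bar> \<le> kap\<^sup>2 / n * (RR n g)\<^sup>2 + n * (pz n g)\<^sup>2"
        using n0 by (simp add: power_mult_distrib divide_right_mono)
    qed
    also have "\<dots> = kap\<^sup>2 / n * Av n (\<lambda>g. (RR n g)\<^sup>2) + n * Av n (\<lambda>g. (pz n g)\<^sup>2)"
      by (simp only: gibbs_mean_cmult gibbs_mean_add)
    also have "\<dots> \<le> kap\<^sup>2 / n * C0 + n * (C1 / (real n)\<^sup>2)"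
      using C0(2)[of n] C1(2)[of n] n by (intro add_mono mult_left_mono) auto
    also have "\<dots> = (kap\<^sup>2 * C0 + C1) * (1 / n)" using n0 by (simp add: power2_eq_square field_simps)
    finally have "sqrt n * Av n (\<lambda>g. S2 n g * \<bar>pz n g\<bar>) \<le> sqrt n * ((kap\<^sup>2 * C0 + C1) * (1 / n))"
      by (rule mult_left_mono) simp
    also have "\<dots> = (kap\<^sup>2 * C0 + C1) * (1 / sqrt n)" using n0 by (simp add: field_simps)
    also have "\<dots> \<le> (kap\<^sup>2 * C0 + C1) * rate n"
      using C0 C1 by (intro mult_left_mono inverse_sqrt_le_rate n0) auto
    finally show ?thesis .
  qed
  moreover have "kap\<^sup>2 * C0 + C1 \<ge> 0" using C0 C1 by simp
  ultimately show ?thesis by blast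
qed

end

section \<open>Summation over edges\<close>

context two_star
begin

definition \<tau>1 :: real where "\<tau>1 = 1 - t\<^sup>2"

definition \<tau> :: real where "\<tau> = \<tau>1 / (1 - \<theta> * \<tau>1)"

text \<open>A toggle moves the rescaled degree at an endpoint by 2 Y / (n - 1) and the mean by 4 Y /
  (n (n - 1)); the centred degree moves by the difference, which is 2 Y times this number.\<close>

definition \<eta> :: "nat \<Rightarrow> real" where
  "\<eta> n = (real n - 2) / (real n * (real n - 1))"

text \<open>The last bound restates \<open>t_stable\<close>. It keeps 1 - \<theta> \<tau>1 at least
  1/2, so that dividing by this factor is harmless even at criticality.\<close>

lemma \<tau>1_bounds: "0 < \<tau>1" "\<tau>1 \<le> 1" "\<theta> * \<tau>1 \<le> 1 / 2"
proof -
  have "t\<^sup>2 < 1" using tanh_square_less[of "2 * \<theta> * t + \<beta>"] unfolding t_fix .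
  thus "0 < \<tau>1" "\<tau>1 \<le> 1" by (simp_all add: \<tau>1_def)
  show "\<theta> * \<tau>1 \<le> 1 / 2" using t_stable by (simp add: \<tau>1_def)
qed

lemma \<tau>_pos: "\<tau> > 0"
  using \<tau>1_bounds unfolding \<tau>_def by (intro divide_pos_pos) auto

lemma T1_ez: "\<bar>T1 n g - \<tau>1\<bar> = ez n g"
  by (simp add: T1_def \<tau>1_def ez_def abs_minus_commute)

lemma \<eta>_bounds:
  assumes n: "n \<ge> 4"
  shows "0 \<le> \<eta> n" "\<eta> n \<le> 1 / n" "(real n - 1) * (real n * \<eta> n) = real n - 2"
proof -
  define N where "N = real n - 1"
  have N: "N > 0" "real n > 0" using n by (simp_all add: N_def)
  show "0 \<le> \<eta> n" using n by (simp add: \<eta>_def)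
  have "(real n - 2) / N \<le> 1" using N by (simp add: N_def)
  hence "(real n - 2) / N / real n \<le> 1 / real n" using N by (intro divide_right_mono) auto
  thus "\<eta> n \<le> 1 / n" by (simp add: \<eta>_def N_def mult.commute)
  show "(real n - 1) * (real n * \<eta> n) = real n - 2"
    using N by (simp add: \<eta>_def flip: N_def)
qed

lemma sqrt_ratio:
  assumes n: "n \<ge> 4"
  shows "sqrt n / (real n - 1) \<le> 2 * rate n" "sqrt n / (real n - 1) \<le> 1"
    "1 / (real n - 1) \<le> sqrt n / (real n - 1)"
proof -
  have s: "sqrt n \<ge> 2" using n real_sqrt_le_mono[of 4 "real n"] by simp
  have "sqrt n / (real n - 1) = sqrt n * (1 / (real n - 1))" by simp
  also have "\<dots> \<le> sqrt n * (2 / real n)" using n by (intro mult_left_mono) (auto simp: field_simps)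
  also have "\<dots> = 2 * (1 / sqrt n)" using n by (simp add: field_simps)
  finally have 1: "sqrt n / (real n - 1) \<le> 2 * (1 / sqrt n)" .
  also have "\<dots> \<le> 2 * rate n" using inverse_sqrt_le_rate[of n] n by (intro mult_left_mono) auto
  finally show "sqrt n / (real n - 1) \<le> 2 * rate n" .
  have "2 * (1 / sqrt n) \<le> 2 * (1 / 2)" using s using n by (intro mult_left_mono divide_left_mono) auto
  with 1 show "sqrt n / (real n - 1) \<le> 1" by linarith
  show "1 / (real n - 1) \<le> sqrt n / (real n - 1)" using s n by (intro divide_right_mono) auto
qed

lemma yd_toggle': 
  assumes "g \<in> graphs n" "i \<in> {1..n}" "j \<in> {1..n}" "i \<noteq> j"
  shows "yd n (toggle i j g) i = yd n g i - 2 * spin g i j * \<eta> n"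
  unfolding yd_toggle[OF assms] \<eta>_def ..

lemma sd_eq: "sd n i j g = \<theta> * (yd n g i + yd n g j) - 2 * \<theta> / (real n - 1) * spin g i j"
  by (simp add: sd_def)

lemma spin_square: "g \<in> graphs n \<Longrightarrow> spin g i j * spin g i j = 1"
  using spin_cases[of g n i j] by auto

lemma offsum_S3_main:
  assumes n: "n > 0"
  shows "offsum n (\<lambda>i j. G * (T * (yd n g i)\<^sup>2 + c * ((yd n g i)\<^sup>2 * (yd n g i + yd n g j)) + d * yd n g i))
    = G * (T * ((real n - 1) * S2 n g) + c * ((real n - 2) * S3 n g))"
proof -
  have "offsum n (\<lambda>i j. G * (T * (yd n g i)\<^sup>2 + c * ((yd n g i)\<^sup>2 * (yd n g i + yd n g j)) + d * yd n g i))
    = G * (T * offsum n (\<lambda>i j. (yd n g i)\<^sup>2) + c * offsum n (\<lambda>i j. (yd n g i)\<^sup>2 * (yd n g i + yd n g j))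
        + d * offsum n (\<lambda>i j. yd n g i))"
    by (simp only: sum.distrib sum_distrib_left distrib_left)
  also have "offsum n (\<lambda>i j. (yd n g i)\<^sup>2) = (real n - 1) * S2 n g"
    unfolding offsum_fst S2_def ..
  finally show ?thesis unfolding offsum_yd_square_linear[OF n] offsum_yd[OF n] by simp
qed

lemma S3_offsum_bound:
  assumes n: "n \<ge> 4" and g: "g \<in> graphs n" and GB: "\<bar>G g\<bar> \<le> B"
    and GG: "\<And>i j. i \<in> {1..n} \<Longrightarrow> j \<in> {1..n} \<Longrightarrow> i \<noteq> j \<Longrightarrow> \<bar>G g - G (toggle i j g)\<bar> \<le> B * (bb n g i j)\<^sup>2"
  shows "\<bar>offsum n (\<lambda>i j. (G g * (yd n g i)\<^sup>2) * tanh (edge_field \<theta> \<beta> n i j g)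
        + (1 - (tanh (edge_field \<theta> \<beta> n i j g))\<^sup>2)
          * (spin g i j * (G g * (yd n g i)\<^sup>2 - G (toggle i j g) * (yd n (toggle i j g) i)\<^sup>2) / 2))
      - G g * (T0 n g * ((real n - 1) * S2 n g) + \<theta> * T1 n g * ((real n - 2) * S3 n g))\<bar>
    \<le> B * (((9 * \<theta>\<^sup>2 + 2) * (16 * kap\<^sup>2) + 64 * \<theta> * kap + 2) * RR n g)"
proof -
  have n0: "n > 0" "real n > 0" using n by simp_all
  have B0: "B \<ge> 0" using GB by linarith
  have R1: "1 \<le> RR n g" using RR_ge_1 n0 by blast
  let ?P = "\<lambda>i j. (G g * (yd n g i)\<^sup>2) * tanh (edge_field \<theta> \<beta> n i j g)
        + (1 - (tanh (edge_field \<theta> \<beta> n i j g))\<^sup>2)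
          * (spin g i j * (G g * (yd n g i)\<^sup>2 - G (toggle i j g) * (yd n (toggle i j g) i)\<^sup>2) / 2)"
  let ?Q = "\<lambda>i j. G g * (T0 n g * (yd n g i)\<^sup>2 + \<theta> * T1 n g * ((yd n g i)\<^sup>2 * (yd n g i + yd n g j))
        + 2 * \<eta> n * T1 n g * yd n g i)"
  have "\<bar>offsum n (\<lambda>i j. ?P i j - ?Q i j)\<bar>
    \<le> offsum n (\<lambda>i j. B * ((9 * \<theta>\<^sup>2 + 2) * bb n g i j ^ 4 + 16 * \<theta> / n * (bb n g i j)\<^sup>2 + 2 / (real n)\<^sup>2))"
  proof (rule offsum_abs_le)
    fix i j assume ij: "i \<in> {1..n}" "j \<in> {1..n}" "i \<noteq> j"
    note b = bb_bounds[OF n ij(1,2), of g]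
    show "\<bar>?P i j - ?Q i j\<bar> \<le> B * ((9 * \<theta>\<^sup>2 + 2) * bb n g i j ^ 4 + 16 * \<theta> / n * (bb n g i j)\<^sup>2 + 2 / (real n)\<^sup>2)"
    proof (rule S3_pair_bound[where s = "sd n i j g" and Y = "spin g i j" and c = "2 * \<theta> / (real n - 1)"])
      show "2 * \<theta> / (real n - 1) \<le> 4 * \<theta> / n" using n \<theta>_pos by (simp add: field_simps)
      have "(sd n i j g)\<^sup>2 \<le> 9 * \<theta>\<^sup>2 * (bb n g i j)\<^sup>2" by (rule sd_square_le[OF n g ij(1,2)])
      thus "\<bar>tanh (edge_field \<theta> \<beta> n i j g) - T0 n g - T1 n g * sd n i j g\<bar> \<le> 9 * \<theta>\<^sup>2 * (bb n g i j)\<^sup>2"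
        using T_expand2[of n i j g] by linarith
      show "\<bar>1 - (tanh (edge_field \<theta> \<beta> n i j g))\<^sup>2 - T1 n g\<bar> \<le> 2 * \<bar>sd n i j g\<bar>" by (rule sech_expand1)
      show "\<bar>G g - G (toggle i j g)\<bar> \<le> B * (bb n g i j)\<^sup>2" by (rule GG[OF ij])
    qed (rule b abs_spin[OF g] spin_square[OF g] sd_eq sd_abs_le[OF n g ij(1,2)] \<eta>_bounds[OF n] \<theta>_pos
           sech2_bounds T1_bounds GB yd_toggle'[OF g ij] | (use n \<theta>_pos in simp))+
  qed
  also have "\<dots> = B * ((9 * \<theta>\<^sup>2 + 2) * offsum n (\<lambda>i j. bb n g i j ^ 4) + 16 * \<theta> / n * offsum n (\<lambda>i j. (bb n g i j)\<^sup>2)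
      + offsum n (\<lambda>i j. 2 / (real n)\<^sup>2))"
    by (simp only: sum.distrib sum_distrib_left distrib_left)
  also have "\<dots> \<le> B * ((9 * \<theta>\<^sup>2 + 2) * (16 * kap\<^sup>2 * RR n g) + 16 * \<theta> / n * (4 * real n * kap * RR n g) + 2 * RR n g)"
  proof (intro mult_left_mono[OF _ B0] add_mono)
    show "(9 * \<theta>\<^sup>2 + 2) * offsum n (\<lambda>i j. bb n g i j ^ 4) \<le> (9 * \<theta>\<^sup>2 + 2) * (16 * kap\<^sup>2 * RR n g)"
      by (rule mult_left_mono[OF offsum_bb_4[OF n0(1)]]) simp
    show "16 * \<theta> / n * offsum n (\<lambda>i j. (bb n g i j)\<^sup>2) \<le> 16 * \<theta> / n * (4 * real n * kap * RR n g)"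
      by (rule mult_left_mono[OF offsum_bb_2[OF n0(1)]]) (use \<theta>_pos in simp)
    have "(real n - 1) * (real n * (2 / (real n)\<^sup>2)) \<le> real n * (real n * (2 / (real n)\<^sup>2))"
      using n0 by (intro mult_right_mono) auto
    also have "\<dots> = 2" using n0 by (simp add: power2_eq_square)
    finally show "offsum n (\<lambda>i j. 2 / (real n)\<^sup>2) \<le> 2 * RR n g" unfolding offsum_const using R1 by linarith
  qed
  also have "\<dots> = B * (((9 * \<theta>\<^sup>2 + 2) * (16 * kap\<^sup>2) + 64 * \<theta> * kap + 2) * RR n g)"
    using n0 by (simp add: algebra_simps)
  finally show ?thesis unfolding sum_subtractf offsum_S3_main[OF n0(1)] .
qed

text \<open>With test function G y_i^2 the summed identity equates N (S3 + m S2) with N (T0 S2 +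
  \<theta> T1 S3), up to O(RR). Hence (1 - \<theta> \<tau>1) S3 is a combination of
  \<open>S2 * pz\<close>, \<open>ez * S3\<close> and O(1 / n), all negligible against n^(-1/2). The
  multiplier G is present because S3 later occurs weighted by a function of the graph.\<close>

lemma S3_estimate:
  "\<exists>C\<ge>0. \<forall>n\<ge>4. \<forall>B G. (\<forall>g\<in>graphs n. \<bar>G g\<bar> \<le> B) \<longrightarrow>
     (\<forall>g\<in>graphs n. \<forall>i\<in>{1..n}. \<forall>j\<in>{1..n}. i \<noteq> j \<longrightarrow> \<bar>G g - G (toggle i j g)\<bar> \<le> B * (bb n g i j)\<^sup>2) \<longrightarrow>
     sqrt n * \<bar>Av n (\<lambda>g. G g * S3 n g)\<bar> \<le> B * (C * rate n)"
proof -
  obtain C0 where C0: "C0 \<ge> 1" "\<And>n. n \<ge> 3 \<Longrightarrow> Av n (\<lambda>g. (RR n g)\<^sup>2) \<le> C0"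
    using RR_square_moment by blast
  obtain C1 where C1: "C1 \<ge> 0" "\<And>n. n \<ge> 4 \<Longrightarrow> sqrt n * Av n (\<lambda>g. S2 n g * \<bar>pz n g\<bar>) \<le> C1 * rate n"
    using S2_pz_moment by blast
  obtain C2 where C2: "C2 \<ge> 0" "\<And>n. n \<ge> 4 \<Longrightarrow> sqrt n * Av n (\<lambda>g. ez n g * RR n g) \<le> C2 * rate n"
    using ez_RR_moment by blast
  define k1 where "k1 = (9 * \<theta>\<^sup>2 + 2) * (16 * kap\<^sup>2) + 64 * \<theta> * kap + 2"
  define k2 where "k2 = \<theta> * kap\<^sup>2"
  have k: "k1 \<ge> 0" "k2 \<ge> 0" using \<theta>_pos kap_ge_1 by (simp_all add: k1_def k2_def)
  define C where "C = 2 * (C1 + 2 * (k1 + k2) * C0 + k2 * C2)"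
  have "sqrt n * \<bar>Av n (\<lambda>g. G g * S3 n g)\<bar> \<le> B * (C * rate n)"
    if n: "n \<ge> 4" and GB: "\<forall>g\<in>graphs n. \<bar>G g\<bar> \<le> B"
      and GG: "\<forall>g\<in>graphs n. \<forall>i\<in>{1..n}. \<forall>j\<in>{1..n}. i \<noteq> j \<longrightarrow> \<bar>G g - G (toggle i j g)\<bar> \<le> B * (bb n g i j)\<^sup>2"
    for n B G
  proof -
    define N where "N = real n - 1"
    have N: "N \<ge> 3" and n0: "n > 0" "real n > 0" using n by (simp_all add: N_def)
    have "(\<lambda>i j. 0) \<in> graphs n" by (simp add: graphs_def)
    hence B0: "B \<ge> 0" using GB by force
    define P where "P g = offsum n (\<lambda>i j. (G g * (yd n g i)\<^sup>2) * tanh (edge_field \<theta> \<beta> n i j g)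
        + (1 - (tanh (edge_field \<theta> \<beta> n i j g))\<^sup>2)
          * (spin g i j * (G g * (yd n g i)\<^sup>2 - G (toggle i j g) * (yd n (toggle i j g) i)\<^sup>2) / 2))" for g
    have "Av n P = offsum n (\<lambda>i j. Av n (\<lambda>g. (G g * (yd n g i)\<^sup>2) * spin g i j))"
      unfolding P_def [abs_def] by (rule stein_offsum[symmetric])
    also have "\<dots> = Av n (\<lambda>g. G g * offsum n (\<lambda>i j. (yd n g i)\<^sup>2 * spin g i j))"
      by (simp add: gibbs_mean_sum sum_distrib_left mult.assoc)
    also have "\<dots> = Av n (\<lambda>g. G g * (N * (S3 n g + mz n g * S2 n g)))"
      unfolding N_def by (intro gibbs_mean_cong) (simp only: offsum_spin_yd_square[OF _ n0(1)])
    finally have P: "Av n P = Av n (\<lambda>g. G g * (N * (S3 n g + mz n g * S2 n g)))" .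
    have "(N * (1 - \<theta> * \<tau>1)) * Av n (\<lambda>g. G g * S3 n g)
       = Av n (\<lambda>g. G g * (N * (S3 n g + mz n g * S2 n g)) - G g * (N * (mz n g * S2 n g) + \<theta> * \<tau>1 * (N * S3 n g)))"
      unfolding gibbs_mean_cmult[symmetric] by (intro gibbs_mean_cong) (simp add: algebra_simps)
    also have "\<dots> = Av n (\<lambda>g. P g - G g * (N * (mz n g * S2 n g) + \<theta> * \<tau>1 * (N * S3 n g)))"
      by (simp only: gibbs_mean_diff P)
    finally have eq: "(N * (1 - \<theta> * \<tau>1)) * Av n (\<lambda>g. G g * S3 n g)
       = Av n (\<lambda>g. P g - G g * (N * (mz n g * S2 n g) + \<theta> * \<tau>1 * (N * S3 n g)))" .
    have "\<bar>(N * (1 - \<theta> * \<tau>1)) * Av n (\<lambda>g. G g * S3 n g)\<bar> \<le> Av n (\<lambda>g. B * (N * (S2 n g * \<bar>pz n g\<bar>) + (k1 + k2) * RR n g + k2 * N / sqrt n * (ez n g * RR n g)))"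
      unfolding eq
    proof (rule gibbs_mean_abs_le)
      fix g assume g: "g \<in> graphs n"
      have GBg: "\<bar>G g\<bar> \<le> B" using GB g by blast
      have R1: "1 \<le> RR n g" using RR_ge_1 n0 by blast
      define X where "X = P g - G g * (T0 n g * (N * S2 n g) + \<theta> * T1 n g * ((real n - 2) * S3 n g))"
      have X: "\<bar>X\<bar> \<le> B * (k1 * RR n g)"
        unfolding X_def P_def N_def k1_def by (rule S3_offsum_bound) (use n g GB GG in auto)
      have Y: "\<bar>G g * (S3 n g * (\<theta> * (N * (T1 n g - \<tau>1) - T1 n g)))\<bar>
          \<le> B * (kap\<^sup>2 * RR n g / sqrt n * (\<theta> * (N * ez n g + 1)))"
      proof (intro abs_mult_le GBg S3_le n0)
        have "\<bar>N * (T1 n g - \<tau>1) - T1 n g\<bar> \<le> \<bar>N * (T1 n g - \<tau>1)\<bar> + \<bar>T1 n g\<bar>" by (rule abs_triangle_ineq4)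
        also have "\<dots> \<le> N * ez n g + 1" using T1_bounds[of n g] N by (simp add: abs_mult T1_ez)
        finally show "\<bar>N * (T1 n g - \<tau>1) - T1 n g\<bar> \<le> N * ez n g + 1" .
      qed (use \<theta>_pos in simp)
      have "kap\<^sup>2 * RR n g / sqrt n * (\<theta> * (N * ez n g + 1)) = k2 * N / sqrt n * (ez n g * RR n g) + k2 * RR n g / sqrt n"
        by (simp add: k2_def algebra_simps add_divide_distrib)
      also have "k2 * RR n g / sqrt n \<le> k2 * RR n g / 1"
        using k R1 n by (intro divide_left_mono) auto
      finally have Y': "B * (kap\<^sup>2 * RR n g / sqrt n * (\<theta> * (N * ez n g + 1)))
          \<le> B * (k2 * N / sqrt n * (ez n g * RR n g) + k2 * RR n g)"
        using B0 by (intro mult_left_mono) auto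
      have Z: "\<bar>G g * (N * (S2 n g * pz n g))\<bar> \<le> B * (N * (S2 n g * \<bar>pz n g\<bar>))"
        using N S2_nonneg[of n g] by (intro abs_mult_le GBg) (auto simp: abs_mult)
      have nN: "real n - 2 = N - 1" by (simp add: N_def)
      have "P g - G g * (N * (mz n g * S2 n g) + \<theta> * \<tau>1 * (N * S3 n g))
         = X + G g * (S3 n g * (\<theta> * (N * (T1 n g - \<tau>1) - T1 n g))) - G g * (N * (S2 n g * pz n g))"
        unfolding X_def nN pz_def by (simp add: algebra_simps)
      hence "\<bar>P g - G g * (N * (mz n g * S2 n g) + \<theta> * \<tau>1 * (N * S3 n g))\<bar>
         \<le> B * (k1 * RR n g) + B * (k2 * N / sqrt n * (ez n g * RR n g) + k2 * RR n g) + B * (N * (S2 n g * \<bar>pz n g\<bar>))"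
        using X Y Y' Z by linarith
      also have "\<dots> = B * (N * (S2 n g * \<bar>pz n g\<bar>) + (k1 + k2) * RR n g + k2 * N / sqrt n * (ez n g * RR n g))"
        by (simp add: algebra_simps)
      finally show "\<bar>P g - G g * (N * (mz n g * S2 n g) + \<theta> * \<tau>1 * (N * S3 n g))\<bar>
         \<le> B * (N * (S2 n g * \<bar>pz n g\<bar>) + (k1 + k2) * RR n g + k2 * N / sqrt n * (ez n g * RR n g))" .
    qed
    also have "\<dots> = B * (N * Av n (\<lambda>g. S2 n g * \<bar>pz n g\<bar>) + (k1 + k2) * Av n (\<lambda>g. RR n g) + k2 * N / sqrt n * Av n (\<lambda>g. ez n g * RR n g))"
      by (simp only: gibbs_mean_cmult gibbs_mean_add)
    finally have 1: "\<bar>(N * (1 - \<theta> * \<tau>1)) * Av n (\<lambda>g. G g * S3 n g)\<bar>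
      \<le> B * (N * Av n (\<lambda>g. S2 n g * \<bar>pz n g\<bar>) + (k1 + k2) * Av n (\<lambda>g. RR n g) + k2 * N / sqrt n * Av n (\<lambda>g. ez n g * RR n g))" .
    have "N / 2 * \<bar>Av n (\<lambda>g. G g * S3 n g)\<bar> \<le> \<bar>(N * (1 - \<theta> * \<tau>1)) * Av n (\<lambda>g. G g * S3 n g)\<bar>"
      unfolding abs_mult using N \<tau>1_bounds(3) by (intro mult_right_mono) auto
    from order.trans[OF this 1]
    have "2 * sqrt n / N * (N / 2 * \<bar>Av n (\<lambda>g. G g * S3 n g)\<bar>) \<le> 2 * sqrt n / N *
       (B * (N * Av n (\<lambda>g. S2 n g * \<bar>pz n g\<bar>) + (k1 + k2) * Av n (\<lambda>g. RR n g) + k2 * N / sqrt n * Av n (\<lambda>g. ez n g * RR n g)))"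
      by (rule mult_left_mono) (use N in simp)
    also have "2 * sqrt n / N * (N / 2 * \<bar>Av n (\<lambda>g. G g * S3 n g)\<bar>) = sqrt n * \<bar>Av n (\<lambda>g. G g * S3 n g)\<bar>" using N by simp
    also have "2 * sqrt n / N * (B * (N * Av n (\<lambda>g. S2 n g * \<bar>pz n g\<bar>) + (k1 + k2) * Av n (\<lambda>g. RR n g) + k2 * N / sqrt n * Av n (\<lambda>g. ez n g * RR n g)))
      = B * (2 * (sqrt n * Av n (\<lambda>g. S2 n g * \<bar>pz n g\<bar>) + (k1 + k2) * (sqrt n / N * Av n (\<lambda>g. RR n g)) + k2 * Av n (\<lambda>g. ez n g * RR n g)))"
      using N n0 by (simp add: field_simps)
    also have "\<dots> \<le> B * (2 * (C1 * rate n + (k1 + k2) * (2 * rate n * C0) + k2 * (C2 * rate n)))"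
    proof (intro mult_left_mono add_mono C1 n B0 mult_mono)
      show "sqrt n / N \<le> 2 * rate n" unfolding N_def by (rule sqrt_ratio[OF n])
      show "Av n (\<lambda>g. RR n g) \<le> C0" using RR_moment_le[of n] C0(2)[of n] n by simp
      have "0 \<le> RR n g" for g using RR_ge_1[of n g] n by simp
      thus "0 \<le> Av n (\<lambda>g. RR n g)" by (intro gibbs_mean_nonneg)
      have "0 \<le> Av n (\<lambda>g. ez n g * RR n g)" using \<open>\<And>g. 0 \<le> RR n g\<close> by (intro gibbs_mean_nonneg mult_nonneg_nonneg ez_nonneg)
      hence "1 * Av n (\<lambda>g. ez n g * RR n g) \<le> sqrt n * Av n (\<lambda>g. ez n g * RR n g)"
        using n by (intro mult_right_mono) auto
      thus "Av n (\<lambda>g. ez n g * RR n g) \<le> C2 * rate n" using C2(2)[OF n] by simp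
    qed (use k rate_pos[of n] n in auto)
    also have "\<dots> = B * (C * rate n)" by (simp add: C_def algebra_simps)
    finally show ?thesis .
  qed
  moreover have "C \<ge> 0" using C0 C1 C2 k by (simp add: C_def)
  ultimately show ?thesis by (intro exI[of _ C]) auto
qed


section \<open>The rescaled fluctuation and the expansion of its Stein identity\<close>

text \<open>Built from \<open>S2\<close>, which differs from the statistic of the theorem by the
  factor ((n - 1) / n)^2; this discrepancy is treated in
  \<open>degree_statistic_close\<close>.\<close>

definition Wn :: "nat \<Rightarrow> (nat \<Rightarrow> nat \<Rightarrow> nat) \<Rightarrow> real" where
  "Wn n g = sqrt n * (S2 n g - \<tau>)"

lemma Wn_toggle:
  assumes g: "g \<in> graphs n" and ij: "i \<in> {1..n}" "j \<in> {1..n}" "i \<noteq> j"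
  shows "Wn n g - Wn n (toggle i j g)
    = 4 * (sqrt n / (real n - 1)) * (spin g i j * (yd n g i + yd n g j - 2 * spin g i j * \<eta> n))"
proof -
  have "Wn n g - Wn n (toggle i j g) = sqrt n * (S2 n g - S2 n (toggle i j g))"
    by (simp add: Wn_def algebra_simps)
  thus ?thesis unfolding S2_toggle[OF assms] \<eta>_def by simp
qed

lemma Wn_toggle_abs:
  assumes g: "g \<in> graphs n" and ij: "i \<in> {1..n}" "j \<in> {1..n}" "i \<noteq> j" and n: "n \<ge> 4"
  shows "\<bar>Wn n g - Wn n (toggle i j g)\<bar> \<le> 8 * (bb n g i j)\<^sup>2"
proof -
  note b = bb_bounds[OF n ij(1,2), of g]
  have "\<bar>2 * spin g i j * \<eta> n\<bar> = 2 * \<eta> n" using abs_spin[OF g, of i j] \<eta>_bounds[OF n] by (simp add: abs_mult)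
  also have "\<dots> \<le> 2 * (1 / n)" by (intro mult_left_mono \<eta>_bounds n) auto
  also have "\<dots> \<le> bb n g i j" using b(7) by simp
  finally have 1: "\<bar>yd n g i + yd n g j - 2 * spin g i j * \<eta> n\<bar> \<le> 2 * bb n g i j"
    using b(3) by linarith
  have "\<bar>4 * (sqrt n / (real n - 1)) * (spin g i j * (yd n g i + yd n g j - 2 * spin g i j * \<eta> n))\<bar>
    \<le> 4 * bb n g i j * (1 * (2 * bb n g i j))"
    using b(4) n abs_spin[OF g, of i j] by (intro abs_mult_le 1) auto
  thus ?thesis unfolding Wn_toggle[OF g ij] by (simp add: power2_eq_square)
qed

lemma yd_abs_le_2: "g \<in> graphs n \<Longrightarrow> n \<ge> 2 \<Longrightarrow> i \<in> {1..n} \<Longrightarrow> \<bar>yd n g i\<bar> \<le> 2"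
  using zdeg_abs_le[of g n i] mz_abs_le[of g n] unfolding yd_def by linarith

lemma offsum_main:
  assumes n: "n \<ge> 4" and g: "g \<in> graphs n"
  shows "offsum n (\<lambda>i j. f * (T * yd n g i + T' * (\<theta> * (yd n g i * (yd n g i + yd n g j)) - c * (yd n g i * spin g i j))
        - d * (yd n g i * (yd n g i + yd n g j)\<^sup>2))
      + k - l * (yd n g i + yd n g j) + r * (yd n g i * (yd n g i + yd n g j)))
    = f * (T' * (\<theta> * ((real n - 2) * S2 n g) - c * ((real n - 1) * S2 n g)) - d * ((real n - 4) * S3 n g))
      + (real n - 1) * (real n * k) + r * ((real n - 2) * S2 n g)"
proof -
  have n0: "n > 0" using n by simp
  have "offsum n (\<lambda>i j. f * (T * yd n g i + T' * (\<theta> * (yd n g i * (yd n g i + yd n g j)) - c * (yd n g i * spin g i j))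
        - d * (yd n g i * (yd n g i + yd n g j)\<^sup>2))
      + k - l * (yd n g i + yd n g j) + r * (yd n g i * (yd n g i + yd n g j)))
    = f * (T * offsum n (\<lambda>i j. yd n g i) + T' * (\<theta> * offsum n (\<lambda>i j. yd n g i * (yd n g i + yd n g j))
        - c * offsum n (\<lambda>i j. yd n g i * spin g i j)) - d * offsum n (\<lambda>i j. yd n g i * (yd n g i + yd n g j)\<^sup>2))
      + offsum n (\<lambda>i j. k) - l * offsum n (\<lambda>i j. yd n g i + yd n g j) + r * offsum n (\<lambda>i j. yd n g i * (yd n g i + yd n g j))"
    by (simp only: sum.distrib sum_subtractf sum_distrib_left distrib_left right_diff_distrib)
  thus ?thesis
    unfolding offsum_yd[OF n0] offsum_yd_linear[OF n0] offsum_spin_yd[OF g n0] offsum_yd_quadratic[OF n0]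
      offsum_yd_add[OF n0] offsum_const by simp
qed

text \<open>Summing \<open>main_pair_bound\<close> produces fourth powers of \<open>bb\<close>,
  hence O(RR). The Taylor remainder of f has constant 32 = 8^2 / 2, the 8 coming from
  \<open>Wn_toggle_abs\<close>.\<close>

lemma main_offsum_bound:
  fixes f f1 f2 :: "real \<Rightarrow> real"
  assumes n: "n \<ge> 4" and g: "g \<in> graphs n"
    and df: "\<And>x. (f has_real_derivative f1 x) (at x)" "\<And>x. (f1 has_real_derivative f2 x) (at x)"
    and L: "\<And>x. \<bar>f x\<bar> \<le> L" "\<And>x. \<bar>f1 x\<bar> \<le> L" "\<And>x. \<bar>f2 x\<bar> \<le> L"
  shows "\<bar>offsum n (\<lambda>i j. (f (Wn n g) * yd n g i) * tanh (edge_field \<theta> \<beta> n i j g)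
        + (1 - (tanh (edge_field \<theta> \<beta> n i j g))\<^sup>2)
          * (spin g i j * (f (Wn n g) * yd n g i - f (Wn n (toggle i j g)) * yd n (toggle i j g) i) / 2))
      - (f (Wn n g) * (T1 n g * (\<theta> * ((real n - 2) * S2 n g) - 2 * \<theta> / (real n - 1) * ((real n - 1) * S2 n g))
           - T0 n g * T1 n g * \<theta>\<^sup>2 * ((real n - 4) * S3 n g))
         + (real n - 1) * (real n * (f (Wn n g) * \<eta> n * T1 n g))
         + 2 * (sqrt n / (real n - 1)) * f1 (Wn n g) * T1 n g * ((real n - 2) * S2 n g))\<bar>
    \<le> L * ((38 + 14 * \<theta> + 22 * \<theta>\<^sup>2 + 27 * \<theta> ^ 3) * (16 * kap\<^sup>2 * RR n g))"
proof -
  have n0: "n > 0" "real n > 0" using n by simp_all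
  have L0: "L \<ge> 0" using L(1)[of 0] by linarith
  let ?P = "\<lambda>i j. (f (Wn n g) * yd n g i) * tanh (edge_field \<theta> \<beta> n i j g)
        + (1 - (tanh (edge_field \<theta> \<beta> n i j g))\<^sup>2)
          * (spin g i j * (f (Wn n g) * yd n g i - f (Wn n (toggle i j g)) * yd n (toggle i j g) i) / 2)"
  let ?Q = "\<lambda>i j. f (Wn n g) * (T0 n g * yd n g i + T1 n g * (\<theta> * (yd n g i * (yd n g i + yd n g j)) - 2 * \<theta> / (real n - 1) * (yd n g i * spin g i j))
        - T0 n g * T1 n g * \<theta>\<^sup>2 * (yd n g i * (yd n g i + yd n g j)\<^sup>2))
      + f (Wn n g) * \<eta> n * T1 n g - 2 * \<theta> * T0 n g * T1 n g * f (Wn n g) * \<eta> n * (yd n g i + yd n g j)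
      + 2 * (sqrt n / (real n - 1)) * f1 (Wn n g) * T1 n g * (yd n g i * (yd n g i + yd n g j))"
  let ?k = "38 + 14 * \<theta> + 22 * \<theta>\<^sup>2 + 27 * \<theta> ^ 3"
  have "\<bar>offsum n (\<lambda>i j. ?P i j - ?Q i j)\<bar> \<le> offsum n (\<lambda>i j. L * (?k * bb n g i j ^ 4))"
  proof (rule offsum_abs_le)
    fix i j assume ij: "i \<in> {1..n}" "j \<in> {1..n}" "i \<noteq> j"
    note b = bb_bounds[OF n ij(1,2), of g]
    define r where "r = f (Wn n g) - f (Wn n (toggle i j g)) - f1 (Wn n g) * (Wn n g - Wn n (toggle i j g))"
    show "\<bar>?P i j - ?Q i j\<bar> \<le> L * (?k * bb n g i j ^ 4)"
    proof (rule main_pair_bound[where s = "sd n i j g" and r = r])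
      have "2 * \<theta> * (1 / (real n - 1)) \<le> 2 * \<theta> * (bb n g i j)\<^sup>2"
        using b(6) \<theta>_pos by (intro mult_left_mono) auto
      thus "2 * \<theta> / (real n - 1) \<le> 2 * \<theta> * (bb n g i j)\<^sup>2" by simp
      have "2 * \<eta> n \<le> 2 / n" using \<eta>_bounds(2)[OF n] by simp
      thus "2 * \<eta> n \<le> (bb n g i j)\<^sup>2" "2 * \<eta> n \<le> bb n g i j" using b(7,8) by linarith+
      show "\<bar>tanh (edge_field \<theta> \<beta> n i j g) - T0 n g - T1 n g * sd n i j g + T0 n g * T1 n g * (sd n i j g)\<^sup>2\<bar> \<le> \<bar>sd n i j g\<bar> ^ 3"
        by (rule T_expand3)
      show "\<bar>1 - (tanh (edge_field \<theta> \<beta> n i j g))\<^sup>2 - T1 n g\<bar> \<le> 2 * \<bar>sd n i j g\<bar>" by (rule sech_expand1)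
      have "(sd n i j g)\<^sup>2 \<le> 9 * \<theta>\<^sup>2 * (bb n g i j)\<^sup>2" by (rule sd_square_le[OF n g ij(1,2)])
      thus "\<bar>1 - (tanh (edge_field \<theta> \<beta> n i j g))\<^sup>2 - T1 n g + 2 * T0 n g * T1 n g * sd n i j g\<bar> \<le> 27 * \<theta>\<^sup>2 * (bb n g i j)\<^sup>2"
        using sech_expand2[of n i j g] by linarith
      show "\<bar>yd n (toggle i j g) i\<bar> \<le> 2"
        using n by (intro yd_abs_le_2 toggle_graph g ij) auto
      show "f (Wn n g) - f (Wn n (toggle i j g)) = f1 (Wn n g) * (4 * (sqrt n / (real n - 1))
            * (spin g i j * (yd n g i + yd n g j - 2 * spin g i j * \<eta> n))) + r"
        unfolding r_def Wn_toggle[OF g ij] by simp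
      have "\<bar>r\<bar> \<le> L / 2 * (Wn n g - Wn n (toggle i j g))\<^sup>2"
        using taylor2_bound[OF df L(3), of "Wn n g" "Wn n (toggle i j g) - Wn n g"]
        by (simp add: r_def power2_commute abs_minus_commute algebra_simps)
      also have "(Wn n g - Wn n (toggle i j g))\<^sup>2 \<le> (8 * (bb n g i j)\<^sup>2)\<^sup>2"
        using power_mono[OF Wn_toggle_abs[OF g ij n], of 2] by simp
      finally show "\<bar>r\<bar> \<le> 32 * L * bb n g i j ^ 4"
        using L0 by (simp add: power_mult_distrib mult_left_mono flip: power_mult)
    qed (rule b abs_spin[OF g] spin_square[OF g] sd_eq sd_abs_le[OF n g ij(1,2)] \<eta>_bounds[OF n] \<theta>_pos
           sech2_bounds T1_bounds T0_bound L yd_toggle'[OF g ij] | (use n \<theta>_pos in simp))+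
  qed
  also have "\<dots> = L * (?k * offsum n (\<lambda>i j. bb n g i j ^ 4))"
    by (simp only: sum_distrib_left)
  also have "\<dots> \<le> L * (?k * (16 * kap\<^sup>2 * RR n g))"
    using \<theta>_pos by (intro mult_left_mono offsum_bb_4 n0 L0) auto
  finally show ?thesis unfolding sum_subtractf offsum_main[OF n g] .
qed

text \<open>Simplifies the summed expansion after multiplication by q = sqrt n / (n - 1): offsets
  such as n - 2 are removed at cost q, and the random variance T' is replaced by \<tau>1 at cost e.
  The cubic term keeps its random coefficient, since \<open>S3_estimate\<close> disposes of it as a
  whole.\<close>

lemma leading_terms_bound:
  fixes F F1 L T T' S C N M q e R s :: real
  assumes F: "\<bar>F\<bar> \<le> L" "\<bar>F1\<bar> \<le> L" and T: "\<bar>T\<bar> \<le> 1" "0 \<le> T'" "T' \<le> 1" "\<bar>T' - \<tau>1\<bar> \<le> e"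
    and S: "0 \<le> S" "S \<le> kap * R" and C: "\<bar>C\<bar> \<le> kap\<^sup>2 * R" and R: "1 \<le> R"
    and q: "q = s / N" "0 \<le> q" "q \<le> 1" "1 / N \<le> q" and N: "N > 0" "M = N + 1" "s * s = M" and s: "1 \<le> s"
  shows "\<bar>q * (F * (T' * (\<theta> * ((M - 2) * S) - 2 * \<theta> / N * (N * S)) - T * T' * \<theta>\<^sup>2 * ((M - 4) * C))
         + (M - 2) * (F * T') + 2 * q * F1 * T' * ((M - 2) * S))
       - (s * \<theta> * \<tau>1 * (F * S) + s * \<tau>1 * F + 2 * \<tau>1 * (F1 * S) - \<theta>\<^sup>2 * s * (F * T * T' * C))\<bar>
    \<le> L * ((1 + \<theta> * kap + 2 * kap) * (s * (e * R)) + (1 + 3 * \<theta> * kap + 3 * \<theta>\<^sup>2 * kap\<^sup>2 + 4 * kap) * (q * R))"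
proof -
  have L0: "L \<ge> 0" and e0: "e \<ge> 0" using F T by linarith+
  have qN: "q * (M - 2) = s - q" "q * (M - 4) = s - 3 * q" using N q by (simp_all add: field_simps)
  have "q * s = s * s / N" unfolding q(1) by simp
  hence qq: "q * s = 1 + 1 / N" unfolding N(3) N(2) using N(1) by (simp add: add_divide_distrib)
  have q2: "2 * q * (q * (M - 2)) = 2 + (2 / N - 2 * (q * q))"
  proof -
    have "2 * q * (q * (M - 2)) = 2 * (q * s) - 2 * (q * q)" unfolding qN by (simp add: algebra_simps)
    thus ?thesis unfolding qq by simp
  qed
  have "q * (F * (T' * (\<theta> * ((M - 2) * S) - 2 * \<theta> / N * (N * S)) - T * T' * \<theta>\<^sup>2 * ((M - 4) * C))
         + (M - 2) * (F * T') + 2 * q * F1 * T' * ((M - 2) * S))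
    = F * (T' * (\<theta> * ((q * (M - 2)) * S) - q * (2 * \<theta> * S)) - T * T' * \<theta>\<^sup>2 * ((q * (M - 4)) * C))
         + (q * (M - 2)) * (F * T') + F1 * T' * ((2 * q * (q * (M - 2))) * S)"
    using N by (simp add: algebra_simps)
  also have "\<dots> = F * (T' * (\<theta> * ((s - q) * S) - q * (2 * \<theta> * S)) - T * T' * \<theta>\<^sup>2 * ((s - 3 * q) * C))
         + (s - q) * (F * T') + F1 * T' * ((2 + (2 / N - 2 * (q * q))) * S)"
    unfolding q2 unfolding qN ..
  finally have eq: "q * (F * (T' * (\<theta> * ((M - 2) * S) - 2 * \<theta> / N * (N * S)) - T * T' * \<theta>\<^sup>2 * ((M - 4) * C))
         + (M - 2) * (F * T') + 2 * q * F1 * T' * ((M - 2) * S))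
       - (s * \<theta> * \<tau>1 * (F * S) + s * \<tau>1 * F + 2 * \<tau>1 * (F1 * S) - \<theta>\<^sup>2 * s * (F * T * T' * C))
     = F * (\<theta> * S * (s * (T' - \<tau>1) - 3 * (q * T'))) + F * (3 * \<theta>\<^sup>2 * (q * (T * (T' * C))))
       + F * (s * (T' - \<tau>1) - q * T') + F1 * (S * (2 * (T' - \<tau>1) + T' * (2 / N - 2 * (q * q))))"
    by (simp add: algebra_simps)
  have sT: "\<bar>s * (T' - \<tau>1)\<bar> \<le> s * e" using s T by (intro abs_mult_le) auto
  have qT: "\<bar>q * T'\<bar> \<le> q * 1" using q T by (intro abs_mult_le) auto
  have S': "\<bar>\<theta> * S\<bar> \<le> \<theta> * (kap * R)" using S \<theta>_pos by (intro abs_mult_le) auto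
  have e1: "\<bar>F * (\<theta> * S * (s * (T' - \<tau>1) - 3 * (q * T')))\<bar> \<le> L * (\<theta> * (kap * R) * (s * e + 3 * q))"
    using sT qT by (intro abs_mult_le F S') linarith
  have e2: "\<bar>F * (3 * \<theta>\<^sup>2 * (q * (T * (T' * C))))\<bar> \<le> L * (3 * \<theta>\<^sup>2 * (q * (1 * (1 * (kap\<^sup>2 * R)))))"
    using q T C by (intro abs_mult_le F) auto
  have "\<bar>F * (s * (T' - \<tau>1) - q * T')\<bar> \<le> L * (s * e + q)"
    using sT qT by (intro abs_mult_le F) linarith
  also have "L * (s * e + q) \<le> L * (s * e * R + q * R)"
    using mult_left_mono[OF R, of "s * e"] mult_left_mono[OF R, of q] L0 e0 s q by (intro mult_left_mono add_mono) auto
  finally have e3: "\<bar>F * (s * (T' - \<tau>1) - q * T')\<bar> \<le> L * (s * e * R + q * R)" .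
  have qq1: "q * q \<le> q" "0 \<le> q * q" using q mult_left_mono[of q 1 q] by auto
  have "0 \<le> 1 / N" using N by simp
  moreover have "2 / N = 2 * (1 / N)" by simp
  ultimately have "\<bar>2 / N - 2 * (q * q)\<bar> \<le> 4 * q" using q(4) qq1 by linarith
  hence "\<bar>T' * (2 / N - 2 * (q * q))\<bar> \<le> 1 * (4 * q)" using T by (intro abs_mult_le) auto
  moreover have "\<bar>2 * (T' - \<tau>1)\<bar> \<le> 2 * (s * e)"
    using T(4) mult_right_mono[OF s e0] by (simp add: abs_mult)
  ultimately have "\<bar>2 * (T' - \<tau>1) + T' * (2 / N - 2 * (q * q))\<bar> \<le> 2 * (s * e) + 4 * q" by linarith
  hence e4: "\<bar>F1 * (S * (2 * (T' - \<tau>1) + T' * (2 / N - 2 * (q * q))))\<bar> \<le> L * (kap * R * (2 * (s * e) + 4 * q))"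
    using S by (intro abs_mult_le F) auto
  have sum4: "\<bar>a + b + c + d\<bar> \<le> A + B + C + D" if "\<bar>a\<bar> \<le> A" "\<bar>b\<bar> \<le> B" "\<bar>c\<bar> \<le> C" "\<bar>d\<bar> \<le> D" for a b c d A B C D :: real
    using that by linarith
  show ?thesis unfolding eq
    by (rule order.trans[OF sum4[OF e1 e2 e3 e4]]) (simp add: algebra_simps)
qed

end

section \<open>The Stein equation for the degree fluctuation\<close>

context two_star
begin

lemma RR_mean_bounds:
  assumes "Av n (\<lambda>g. (RR n g)\<^sup>2) \<le> C0" "n \<ge> 4"
  shows "0 \<le> Av n (\<lambda>g. RR n g)" "Av n (\<lambda>g. RR n g) \<le> C0"
proof -
  have "0 \<le> RR n g" for g using RR_ge_1[of n g] assms by simp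
  thus "0 \<le> Av n (\<lambda>g. RR n g)" by (intro gibbs_mean_nonneg)
  show "Av n (\<lambda>g. RR n g) \<le> C0" using RR_moment_le[of n] assms by simp
qed

text \<open>The weight f(W) T0 T1 in front of S3 thereby qualifies as a multiplier G in
  \<open>S3_estimate\<close>.\<close>

lemma test_function_toggle:
  fixes f f1 :: "real \<Rightarrow> real"
  assumes n: "n \<ge> 4" and g: "g \<in> graphs n" and ij: "i \<in> {1..n}" "j \<in> {1..n}" "i \<noteq> j"
    and df: "\<And>x. (f has_real_derivative f1 x) (at x)" and L: "\<And>x. \<bar>f x\<bar> \<le> L" "\<And>x. \<bar>f1 x\<bar> \<le> L"
  shows "\<bar>f (Wn n g) * T0 n g * T1 n g - f (Wn n (toggle i j g)) * T0 n (toggle i j g) * T1 n (toggle i j g)\<bar>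
     \<le> (L * (8 + 24 * \<theta>)) * (bb n g i j)\<^sup>2"
proof -
  let ?g' = "toggle i j g"
  note b = bb_bounds[OF n ij(1,2), of g]
  have L0: "L \<ge> 0" using L(1)[of 0] by linarith
  have "\<bar>f (Wn n g) - f (Wn n ?g')\<bar> \<le> L * \<bar>Wn n g - Wn n ?g'\<bar>"
    by (rule lipschitz_from_deriv[OF df L(2)])
  also have "\<dots> \<le> L * (8 * (bb n g i j)\<^sup>2)"
    using L0 by (intro mult_left_mono Wn_toggle_abs[OF g ij n]) auto
  finally have f: "\<bar>f (Wn n g) - f (Wn n ?g')\<bar> \<le> L * (8 * (bb n g i j)\<^sup>2)" .
  have mn: "c / (real n * (real n - 1)) \<le> c * (bb n g i j)\<^sup>2" if "c \<ge> 0" for c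
  proof -
    have "c / (real n * (real n - 1)) \<le> c / (1 * (real n - 1))"
      using n that by (intro divide_left_mono mult_right_mono mult_pos_pos) auto
    also have "\<dots> = c * (1 / (real n - 1))" by simp
    also have "\<dots> \<le> c * (bb n g i j)\<^sup>2" using b(6) that by (intro mult_left_mono) auto
    finally show ?thesis .
  qed
  have t0: "\<bar>T0 n g - T0 n ?g'\<bar> \<le> 8 * \<theta> * (bb n g i j)\<^sup>2"
    using T0_toggle_abs[OF g ij n] mn[of "8 * \<theta>"] \<theta>_pos by linarith
  have t1: "\<bar>T1 n g - T1 n ?g'\<bar> \<le> 16 * \<theta> * (bb n g i j)\<^sup>2"
    using T1_toggle_abs[OF g ij n] mn[of "16 * \<theta>"] \<theta>_pos by linarith
  have T1a: "\<bar>T1 n g\<bar> \<le> 1" for g using T1_bounds[of n g] by simp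
  have e1: "\<bar>(f (Wn n g) - f (Wn n ?g')) * (T0 n g * T1 n g)\<bar> \<le> L * (8 * (bb n g i j)\<^sup>2) * (1 * 1)"
    by (intro abs_mult_le f T0_bound T1a)
  have e2: "\<bar>f (Wn n ?g') * ((T0 n g - T0 n ?g') * T1 n g)\<bar> \<le> L * (8 * \<theta> * (bb n g i j)\<^sup>2 * 1)"
    by (intro abs_mult_le L t0 T1a)
  have e3: "\<bar>f (Wn n ?g') * (T0 n ?g' * (T1 n g - T1 n ?g'))\<bar> \<le> L * (1 * (16 * \<theta> * (bb n g i j)\<^sup>2))"
    by (intro abs_mult_le L T0_bound t1)
  have eq: "f (Wn n g) * T0 n g * T1 n g - f (Wn n ?g') * T0 n ?g' * T1 n ?g'
    = (f (Wn n g) - f (Wn n ?g')) * (T0 n g * T1 n g) + f (Wn n ?g') * ((T0 n g - T0 n ?g') * T1 n g)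
      + f (Wn n ?g') * (T0 n ?g' * (T1 n g - T1 n ?g'))"
    by (simp add: algebra_simps)
  have sum3: "\<bar>a + b + c\<bar> \<le> A + B + C" if "\<bar>a\<bar> \<le> A" "\<bar>b\<bar> \<le> B" "\<bar>c\<bar> \<le> C" for a b c A B C :: real
    using that by linarith
  show ?thesis unfolding eq
    by (rule order.trans[OF sum3[OF e1 e2 e3]]) (simp add: algebra_simps)
qed

text \<open>With test function f(W) y_i, F = f(W), F1 = f1(W) and scaling q the expansion says that
  sqrt n E(F S2) equals \<theta> \<tau>1 sqrt n E(F S2) + \<tau>1 sqrt n E(F) + 2 \<tau>1 E(F1 S2),
  up to small terms. Solving for S2 yields its centre \<tau> = \<tau>1 / (1 - \<theta> \<tau>1). The
  derivative still carries the random factor S2; replacing it by \<tau> requires a first moment of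
  W, which is itself derived from this estimate.\<close>

lemma main_estimate:
  "\<exists>C\<ge>0. \<forall>n\<ge>4. \<forall>L f f1 f2. (\<forall>x. (f has_real_derivative f1 x) (at x)) \<longrightarrow> (\<forall>x. (f1 has_real_derivative f2 x) (at x)) \<longrightarrow>
     (\<forall>x. \<bar>f x\<bar> \<le> L \<and> \<bar>f1 x\<bar> \<le> L \<and> \<bar>f2 x\<bar> \<le> L) \<longrightarrow>
     \<bar>Av n (\<lambda>g. f (Wn n g) * Wn n g) - 2 * \<tau> * Av n (\<lambda>g. f1 (Wn n g) * S2 n g)\<bar> \<le> L * (C * rate n)"
proof -
  obtain C0 where C0: "C0 \<ge> 1" "\<And>n. n \<ge> 3 \<Longrightarrow> Av n (\<lambda>g. (RR n g)\<^sup>2) \<le> C0"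
    using RR_square_moment by blast
  obtain C2 where C2: "C2 \<ge> 0" "\<And>n. n \<ge> 4 \<Longrightarrow> sqrt n * Av n (\<lambda>g. ez n g * RR n g) \<le> C2 * rate n"
    using ez_RR_moment by blast
  obtain C3 where C3: "C3 \<ge> 0" and C3_le: "\<forall>n\<ge>4. \<forall>B G. (\<forall>g\<in>graphs n. \<bar>G g\<bar> \<le> B) \<longrightarrow>
     (\<forall>g\<in>graphs n. \<forall>i\<in>{1..n}. \<forall>j\<in>{1..n}. i \<noteq> j \<longrightarrow> \<bar>G g - G (toggle i j g)\<bar> \<le> B * (bb n g i j)\<^sup>2) \<longrightarrow>
     sqrt n * \<bar>Av n (\<lambda>g. G g * S3 n g)\<bar> \<le> B * (C3 * rate n)"
    using S3_estimate by (elim exE conjE) (rule that)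
  define k1 where "k1 = (38 + 14 * \<theta> + 22 * \<theta>\<^sup>2 + 27 * \<theta> ^ 3) * (16 * kap\<^sup>2)"
  define k2 where "k2 = 1 + \<theta> * kap + 2 * kap"
  define k3 where "k3 = 1 + 3 * \<theta> * kap + 3 * \<theta>\<^sup>2 * kap\<^sup>2 + 4 * kap"
  have k: "k1 \<ge> 0" "k2 \<ge> 0" "k3 \<ge> 0" using \<theta>_pos kap_ge_1 by (simp_all add: k1_def k2_def k3_def)
  define C where "C = 2 * (2 * (k1 + k3) * C0 + k2 * C2 + \<theta>\<^sup>2 * ((8 + 24 * \<theta>) * C3))"
  have "\<bar>Av n (\<lambda>g. f (Wn n g) * Wn n g) - 2 * \<tau> * Av n (\<lambda>g. f1 (Wn n g) * S2 n g)\<bar> \<le> L * (C * rate n)"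
    if n: "n \<ge> 4" and df: "\<forall>x. (f has_real_derivative f1 x) (at x)" "\<forall>x. (f1 has_real_derivative f2 x) (at x)"
      and L: "\<forall>x. \<bar>f x\<bar> \<le> L \<and> \<bar>f1 x\<bar> \<le> L \<and> \<bar>f2 x\<bar> \<le> L" for n L f f1 f2
  proof -
    define N where "N = real n - 1"
    define s where "s = sqrt n"
    define q where "q = sqrt n / N"
    have N: "N \<ge> 3" and n0: "n > 0" "real n > 0" using n by (simp_all add: N_def)
    have L0: "L \<ge> 0" using L[rule_format, of 0] by linarith
    define F where "F g = f (Wn n g)" for g
    define F1 where "F1 g = f1 (Wn n g)" for g
    have FL: "\<bar>F g\<bar> \<le> L" "\<bar>F1 g\<bar> \<le> L" for g using L by (simp_all add: F_def F1_def)
    have q: "q = s / N" "0 \<le> q" "q \<le> 1" "1 / N \<le> q" "q \<le> 2 * rate n" "q * N = s"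
      using sqrt_ratio[OF n] N unfolding q_def N_def[symmetric] s_def by simp_all
    have s1: "1 \<le> s" "s * s = real n" using n by (simp_all add: s_def)
    define P where "P g = offsum n (\<lambda>i j. (f (Wn n g) * yd n g i) * tanh (edge_field \<theta> \<beta> n i j g)
        + (1 - (tanh (edge_field \<theta> \<beta> n i j g))\<^sup>2)
          * (spin g i j * (f (Wn n g) * yd n g i - f (Wn n (toggle i j g)) * yd n (toggle i j g) i) / 2))" for g
    define Tg where "Tg g = s * \<theta> * \<tau>1 * (F g * S2 n g) + s * \<tau>1 * F g + 2 * \<tau>1 * (F1 g * S2 n g)
        - \<theta>\<^sup>2 * s * (F g * T0 n g * T1 n g * S3 n g)" for g
    have "Av n P = offsum n (\<lambda>i j. Av n (\<lambda>g. (f (Wn n g) * yd n g i) * spin g i j))"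
      unfolding P_def [abs_def] by (rule stein_offsum[symmetric])
    also have "\<dots> = Av n (\<lambda>g. F g * offsum n (\<lambda>i j. yd n g i * spin g i j))"
      by (simp add: gibbs_mean_sum sum_distrib_left mult.assoc F_def)
    also have "\<dots> = Av n (\<lambda>g. N * (F g * S2 n g))"
      unfolding N_def by (intro gibbs_mean_cong) (simp only: offsum_spin_yd[OF _ n0(1)] mult.left_commute)
    finally have P: "Av n P = N * Av n (\<lambda>g. F g * S2 n g)" unfolding gibbs_mean_cmult .
    have bound: "\<bar>Av n (\<lambda>g. q * P g - Tg g)\<bar> \<le> Av n (\<lambda>g. L * ((k1 + k3) * (q * RR n g) + k2 * (s * (ez n g * RR n g))))"
    proof (rule gibbs_mean_abs_le)
      fix g assume g: "g \<in> graphs n"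
      have R1: "1 \<le> RR n g" using RR_ge_1 n0 by blast
      define X where "X = F g * (T1 n g * (\<theta> * ((real n - 2) * S2 n g) - 2 * \<theta> / N * (N * S2 n g))
           - T0 n g * T1 n g * \<theta>\<^sup>2 * ((real n - 4) * S3 n g))
         + (real n - 2) * (F g * T1 n g) + 2 * q * F1 g * T1 n g * ((real n - 2) * S2 n g)"
      have "(real n - 1) * (real n * (f (Wn n g) * \<eta> n * T1 n g)) = ((real n - 1) * (real n * \<eta> n)) * (F g * T1 n g)"
        by (simp add: F_def mult_ac)
      hence eta: "(real n - 1) * (real n * (f (Wn n g) * \<eta> n * T1 n g)) = (real n - 2) * (F g * T1 n g)"
        unfolding \<eta>_bounds(3)[OF n] .
      have "\<bar>P g - X\<bar> \<le> L * (k1 * RR n g)"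
        using main_offsum_bound[OF n g, of f f1 f2 L] df L
        unfolding P_def[symmetric] eta X_def k1_def F_def F1_def q_def N_def by (simp add: mult.assoc)
      hence "q * \<bar>P g - X\<bar> \<le> q * (L * (k1 * RR n g))" using q by (intro mult_left_mono) auto
      hence 1: "\<bar>q * P g - q * X\<bar> \<le> L * (k1 * (q * RR n g))"
        unfolding right_diff_distrib[symmetric] abs_mult using q(2) by (simp add: mult_ac)
      have S3: "\<bar>S3 n g\<bar> \<le> kap\<^sup>2 * RR n g"
      proof -
        have "\<bar>S3 n g\<bar> \<le> kap\<^sup>2 * RR n g / sqrt n" by (rule S3_le[OF n0(1)])
        also have "\<dots> \<le> kap\<^sup>2 * RR n g / 1" using n R1 by (intro divide_left_mono) auto
        finally show ?thesis by simp
      qed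
      have 2: "\<bar>q * X - Tg g\<bar> \<le> L * (k2 * (s * (ez n g * RR n g)) + k3 * (q * RR n g))"
        unfolding X_def Tg_def k2_def k3_def
        by (rule leading_terms_bound[where M = "real n"])
           (use FL T0_bound T1_bounds T1_ez S2_nonneg S2_le[OF n0(1)] S3 R1 q s1 N in \<open>simp_all add: N_def\<close>)
      have "\<bar>q * P g - Tg g\<bar> \<le> L * (k1 * (q * RR n g)) + L * (k2 * (s * (ez n g * RR n g)) + k3 * (q * RR n g))"
        using 1 2 by linarith
      also have "\<dots> = L * ((k1 + k3) * (q * RR n g) + k2 * (s * (ez n g * RR n g)))" by (simp add: algebra_simps)
      finally show "\<bar>q * P g - Tg g\<bar> \<le> L * ((k1 + k3) * (q * RR n g) + k2 * (s * (ez n g * RR n g)))" .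
    qed
    also have "\<dots> = L * ((k1 + k3) * (q * Av n (\<lambda>g. RR n g)) + k2 * (s * Av n (\<lambda>g. ez n g * RR n g)))"
      by (simp only: gibbs_mean_cmult gibbs_mean_add)
    also have "\<dots> \<le> L * ((k1 + k3) * (2 * rate n * C0) + k2 * (C2 * rate n))"
    proof (intro mult_left_mono add_mono L0)
      show "q * Av n (\<lambda>g. RR n g) \<le> 2 * rate n * C0"
        using RR_mean_bounds[OF C0(2)[of n] n] n q(2,5) rate_pos[OF n0(1)] by (intro mult_mono) auto
      show "s * Av n (\<lambda>g. ez n g * RR n g) \<le> C2 * rate n" unfolding s_def by (rule C2(2)[OF n])
    qed (use k in auto)
    finally have b1: "\<bar>Av n (\<lambda>g. q * P g - Tg g)\<bar> \<le> L * ((k1 + k3) * (2 * rate n * C0) + k2 * (C2 * rate n))" .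
    have TB: "\<bar>F g * T0 n g * T1 n g\<bar> \<le> L * (8 + 24 * \<theta>)" for g
    proof -
      have "\<bar>F g * (T0 n g * T1 n g)\<bar> \<le> L * (1 * 1)"
        using T1_bounds[of n g] by (intro abs_mult_le FL T0_bound) auto
      also have "\<dots> \<le> L * (8 + 24 * \<theta>)" using L0 \<theta>_pos by (intro mult_left_mono) auto
      finally show ?thesis by (simp add: mult.assoc)
    qed
    have b2: "s * \<bar>Av n (\<lambda>g. (F g * T0 n g * T1 n g) * S3 n g)\<bar> \<le> (L * (8 + 24 * \<theta>)) * (C3 * rate n)"
      unfolding s_def
      by (rule C3_le[rule_format, OF n])
         (use TB test_function_toggle[OF n, of _ _ _ f f1 L] df L in \<open>auto simp: F_def\<close>)
    have "(1 - \<theta> * \<tau>1) * (Av n (\<lambda>g. F g * Wn n g) - 2 * \<tau> * Av n (\<lambda>g. F1 g * S2 n g))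
       = Av n (\<lambda>g. q * P g - Tg g) - \<theta>\<^sup>2 * (s * Av n (\<lambda>g. (F g * T0 n g * T1 n g) * S3 n g))"
    proof -
      have W: "Av n (\<lambda>g. F g * Wn n g) = s * Av n (\<lambda>g. F g * S2 n g) - s * \<tau> * Av n F"
      proof -
        have "Av n (\<lambda>g. F g * Wn n g) = Av n (\<lambda>g. s * (F g * S2 n g) - s * \<tau> * F g)"
          by (intro gibbs_mean_cong) (simp add: Wn_def s_def algebra_simps)
        thus ?thesis by (simp only: gibbs_mean_diff gibbs_mean_cmult)
      qed
      have \<tau>: "(1 - \<theta> * \<tau>1) * \<tau> = \<tau>1" using \<tau>1_bounds by (simp add: \<tau>_def)
      have "Av n (\<lambda>g. q * P g - Tg g) = s * Av n (\<lambda>g. F g * S2 n g)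
         - (s * \<theta> * \<tau>1 * Av n (\<lambda>g. F g * S2 n g) + s * \<tau>1 * Av n F + 2 * \<tau>1 * Av n (\<lambda>g. F1 g * S2 n g)
            - \<theta>\<^sup>2 * s * Av n (\<lambda>g. F g * T0 n g * T1 n g * S3 n g))"
        unfolding Tg_def gibbs_mean_diff gibbs_mean_add gibbs_mean_cmult P by (simp add: q(6) flip: mult.assoc)
      moreover have "(1 - \<theta> * \<tau>1) * (Av n (\<lambda>g. F g * Wn n g) - 2 * \<tau> * Av n (\<lambda>g. F1 g * S2 n g))
         = (1 - \<theta> * \<tau>1) * s * Av n (\<lambda>g. F g * S2 n g) - s * ((1 - \<theta> * \<tau>1) * \<tau>) * Av n F
           - 2 * ((1 - \<theta> * \<tau>1) * \<tau>) * Av n (\<lambda>g. F1 g * S2 n g)"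
        unfolding W by (simp add: algebra_simps)
      ultimately show ?thesis unfolding \<tau> by (simp add: algebra_simps)
    qed
    hence "\<bar>(1 - \<theta> * \<tau>1) * (Av n (\<lambda>g. F g * Wn n g) - 2 * \<tau> * Av n (\<lambda>g. F1 g * S2 n g))\<bar>
       \<le> \<bar>Av n (\<lambda>g. q * P g - Tg g)\<bar> + \<theta>\<^sup>2 * (s * \<bar>Av n (\<lambda>g. (F g * T0 n g * T1 n g) * S3 n g)\<bar>)"
      using abs_triangle_ineq4[of "Av n (\<lambda>g. q * P g - Tg g)" "\<theta>\<^sup>2 * (s * Av n (\<lambda>g. (F g * T0 n g * T1 n g) * S3 n g))"] s1
      by (simp add: abs_mult)
    also have "\<dots> \<le> L * ((k1 + k3) * (2 * rate n * C0) + k2 * (C2 * rate n)) + \<theta>\<^sup>2 * ((L * (8 + 24 * \<theta>)) * (C3 * rate n))"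
      by (intro add_mono b1 mult_left_mono b2) auto
    also have "\<dots> = L * (C * rate n) / 2" by (simp add: C_def algebra_simps)
    finally have 1: "\<bar>(1 - \<theta> * \<tau>1) * (Av n (\<lambda>g. F g * Wn n g) - 2 * \<tau> * Av n (\<lambda>g. F1 g * S2 n g))\<bar> \<le> L * (C * rate n) / 2" .
    have "1 / 2 * \<bar>Av n (\<lambda>g. F g * Wn n g) - 2 * \<tau> * Av n (\<lambda>g. F1 g * S2 n g)\<bar>
      \<le> \<bar>(1 - \<theta> * \<tau>1) * (Av n (\<lambda>g. F g * Wn n g) - 2 * \<tau> * Av n (\<lambda>g. F1 g * S2 n g))\<bar>"
      unfolding abs_mult using \<tau>1_bounds(3) by (intro mult_right_mono) auto
    from order.trans[OF this 1] show ?thesis unfolding F_def F1_def by simp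
  qed
  moreover have "C \<ge> 0" using C0 C2 C3 k \<theta>_pos by (simp add: C_def)
  ultimately show ?thesis by (intro exI[of _ C]) auto
qed

end

text \<open>tanh is a smooth bounded substitute for the sign function.\<close>

lemma abs_le_times_tanh: "\<bar>x\<bar> \<le> x * tanh x + (1::real)"
proof -
  have *: "y \<le> y * tanh y + 1" if y: "y \<ge> 0" for y :: real
  proof -
    have "1 - tanh y = 2 * exp (- 2 * y) / (1 + exp (- 2 * y))"
      using add_pos_pos[OF zero_less_one exp_gt_zero[of "- 2 * y"]] by (simp add: tanh_real_altdef field_simps)
    also have "\<dots> \<le> 2 * exp (- 2 * y) / 1" by (intro divide_left_mono) (auto intro: add_pos_pos)
    finally have "y * (1 - tanh y) \<le> y * (2 * exp (- 2 * y))" using y by (intro mult_left_mono) auto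
    also have "\<dots> = (2 * y) * exp (- (2 * y))" by simp
    also have "\<dots> \<le> exp (2 * y) * exp (- (2 * y))"
    proof (rule mult_right_mono)
      have "2 * y \<le> 1 + 2 * y" by simp
      also have "\<dots> \<le> exp (2 * y)" by (rule exp_ge_add_one_self)
      finally show "2 * y \<le> exp (2 * y)" .
    qed simp
    also have "\<dots> = 1" by (simp flip: exp_add)
    finally show ?thesis by (simp add: algebra_simps)
  qed
  show ?thesis using *[of x] *[of "- x"] by (cases "x \<ge> 0") auto
qed

context two_star
begin

text \<open>\<open>main_estimate\<close> admits only bounded test functions, but f = tanh is enough
  to bound E \<bar>W\<bar>.\<close>

lemma Wn_abs_moment: "\<exists>C\<ge>0. \<forall>n\<ge>4. Av n (\<lambda>g. \<bar>Wn n g\<bar>) \<le> C"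
proof -
  obtain C0 where C0: "C0 \<ge> 1" "\<And>n. n \<ge> 3 \<Longrightarrow> Av n (\<lambda>g. (RR n g)\<^sup>2) \<le> C0"
    using RR_square_moment by blast
  obtain C1 where C1: "C1 \<ge> 0" and C1_le: "\<forall>n\<ge>4. \<forall>L f f1 f2. (\<forall>x. (f has_real_derivative f1 x) (at x)) \<longrightarrow> (\<forall>x. (f1 has_real_derivative f2 x) (at x)) \<longrightarrow>
     (\<forall>x. \<bar>f x\<bar> \<le> L \<and> \<bar>f1 x\<bar> \<le> L \<and> \<bar>f2 x\<bar> \<le> L) \<longrightarrow>
     \<bar>Av n (\<lambda>g. f (Wn n g) * Wn n g) - 2 * \<tau> * Av n (\<lambda>g. f1 (Wn n g) * S2 n g)\<bar> \<le> L * (C1 * rate n)"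
    using main_estimate by (elim exE conjE) (rule that)
  have "Av n (\<lambda>g. \<bar>Wn n g\<bar>) \<le> 2 * C1 + 2 * \<tau> * (kap * C0) + 1" if n: "n \<ge> 4" for n
  proof -
    have n0: "n > 0" using n by simp
    have r1: "rate n \<le> 1"
    proof -
      have "real n powr (- 1 / 6) \<le> real n powr 0" using n by (intro powr_mono) auto
      thus ?thesis using n by (simp add: rate_def)
    qed
    have "Av n (\<lambda>g. \<bar>Wn n g\<bar>) \<le> Av n (\<lambda>g. tanh (Wn n g) * Wn n g + 1)"
      using abs_le_times_tanh by (intro gibbs_mean_mono) (simp add: mult.commute)
    also have "\<dots> = Av n (\<lambda>g. tanh (Wn n g) * Wn n g) + 1" by (simp only: gibbs_mean_add gibbs_mean_const)
    also have "Av n (\<lambda>g. tanh (Wn n g) * Wn n g) \<le> 2 * (C1 * rate n) + 2 * \<tau> * Av n (\<lambda>g. (1 - (tanh (Wn n g))\<^sup>2) * S2 n g)"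
    proof -
      have b: "\<bar>tanh x\<bar> \<le> 2 \<and> \<bar>1 - (tanh x)\<^sup>2\<bar> \<le> 2 \<and> \<bar>- 2 * tanh x * (1 - (tanh x)\<^sup>2)\<bar> \<le> 2" for x :: real
      proof (intro conjI tanh_deriv2_bound)
        show "\<bar>tanh x\<bar> \<le> 2" using abs_tanh_less[of x] by linarith
        show "\<bar>1 - (tanh x)\<^sup>2\<bar> \<le> 2" using sech2_bounds[of x] by linarith
      qed
      have "\<bar>Av n (\<lambda>g. tanh (Wn n g) * Wn n g) - 2 * \<tau> * Av n (\<lambda>g. (1 - (tanh (Wn n g))\<^sup>2) * S2 n g)\<bar> \<le> 2 * (C1 * rate n)"
        using C1_le[rule_format, OF n, of tanh "\<lambda>x. 1 - (tanh x)\<^sup>2" "\<lambda>x. - 2 * tanh x * (1 - (tanh x)\<^sup>2)" 2]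
          tanh_has_deriv tanh_has_deriv2 b by blast
      thus ?thesis by linarith
    qed
    also have "Av n (\<lambda>g. (1 - (tanh (Wn n g))\<^sup>2) * S2 n g) \<le> Av n (\<lambda>g. kap * RR n g)"
    proof (rule gibbs_mean_mono)
      fix g
      have "(1 - (tanh (Wn n g))\<^sup>2) * S2 n g \<le> 1 * (kap * RR n g)"
        using sech2_bounds[of "Wn n g"] S2_le[OF n0, of g] S2_nonneg[of n g] by (intro mult_mono) auto
      thus "(1 - (tanh (Wn n g))\<^sup>2) * S2 n g \<le> kap * RR n g" by simp
    qed
    also have "\<dots> = kap * Av n (\<lambda>g. RR n g)" by (rule gibbs_mean_cmult)
    also have "\<dots> \<le> kap * C0" using RR_mean_bounds[OF C0(2)[of n] n] n kap_ge_1 by (intro mult_left_mono) auto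
    also have "C1 * rate n \<le> C1 * 1" using C1 r1 by (intro mult_left_mono) auto
    finally show ?thesis using \<tau>_pos by simp
  qed
  moreover have "2 * C1 + 2 * \<tau> * (kap * C0) + 1 \<ge> 0" using C1 \<tau>_pos kap_ge_1 C0 by simp
  ultimately show ?thesis by blast
qed

text \<open>S2 - \<tau> is W / sqrt n, so replacing S2 by \<tau> costs E \<bar>W\<bar> / sqrt n.
  What results is the Stein equation of the centred normal law with variance 2 \<tau>^2, up to
  \<open>rate\<close>.\<close>

lemma stein_equation:
  "\<exists>C\<ge>0. \<forall>n\<ge>4. \<forall>L f f1 f2. (\<forall>x. (f has_real_derivative f1 x) (at x)) \<longrightarrow> (\<forall>x. (f1 has_real_derivative f2 x) (at x)) \<longrightarrow>
     (\<forall>x. \<bar>f x\<bar> \<le> L \<and> \<bar>f1 x\<bar> \<le> L \<and> \<bar>f2 x\<bar> \<le> L) \<longrightarrow>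
     \<bar>Av n (\<lambda>g. f (Wn n g) * Wn n g) - 2 * \<tau>\<^sup>2 * Av n (\<lambda>g. f1 (Wn n g))\<bar> \<le> L * (C * rate n)"
proof -
  obtain C0 where C0: "C0 \<ge> 0" "\<And>n. n \<ge> 4 \<Longrightarrow> Av n (\<lambda>g. \<bar>Wn n g\<bar>) \<le> C0"
    using Wn_abs_moment by blast
  obtain C1 where C1: "C1 \<ge> 0" and C1_le: "\<forall>n\<ge>4. \<forall>L f f1 f2. (\<forall>x. (f has_real_derivative f1 x) (at x)) \<longrightarrow> (\<forall>x. (f1 has_real_derivative f2 x) (at x)) \<longrightarrow>
     (\<forall>x. \<bar>f x\<bar> \<le> L \<and> \<bar>f1 x\<bar> \<le> L \<and> \<bar>f2 x\<bar> \<le> L) \<longrightarrow>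
     \<bar>Av n (\<lambda>g. f (Wn n g) * Wn n g) - 2 * \<tau> * Av n (\<lambda>g. f1 (Wn n g) * S2 n g)\<bar> \<le> L * (C1 * rate n)"
    using main_estimate by (elim exE conjE) (rule that)
  have "\<bar>Av n (\<lambda>g. f (Wn n g) * Wn n g) - 2 * \<tau>\<^sup>2 * Av n (\<lambda>g. f1 (Wn n g))\<bar> \<le> L * ((C1 + 2 * \<tau> * C0) * rate n)"
    if n: "n \<ge> 4" and df: "\<forall>x. (f has_real_derivative f1 x) (at x)" "\<forall>x. (f1 has_real_derivative f2 x) (at x)"
      and L: "\<forall>x. \<bar>f x\<bar> \<le> L \<and> \<bar>f1 x\<bar> \<le> L \<and> \<bar>f2 x\<bar> \<le> L" for n L f f1 f2
  proof -
    have n0: "n > 0" using n by simp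
    have L0: "L \<ge> 0" using L[rule_format, of 0] by linarith
    have 1: "\<bar>Av n (\<lambda>g. f (Wn n g) * Wn n g) - 2 * \<tau> * Av n (\<lambda>g. f1 (Wn n g) * S2 n g)\<bar> \<le> L * (C1 * rate n)"
      by (rule C1_le[rule_format, OF n, of f f1 f2 L]) (use df L in auto)
    have "Av n (\<lambda>g. f1 (Wn n g) * S2 n g) - \<tau> * Av n (\<lambda>g. f1 (Wn n g)) = Av n (\<lambda>g. f1 (Wn n g) * (S2 n g - \<tau>))"
      unfolding right_diff_distrib gibbs_mean_diff by (simp add: gibbs_mean_cmult mult.commute)
    also have "\<dots> = Av n (\<lambda>g. 1 / sqrt n * (f1 (Wn n g) * Wn n g))"
      using n0 by (intro gibbs_mean_cong) (simp add: Wn_def)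
    finally have eq: "Av n (\<lambda>g. f1 (Wn n g) * S2 n g) - \<tau> * Av n (\<lambda>g. f1 (Wn n g))
      = 1 / sqrt n * Av n (\<lambda>g. f1 (Wn n g) * Wn n g)" unfolding gibbs_mean_cmult .
    have "\<bar>Av n (\<lambda>g. f1 (Wn n g) * Wn n g)\<bar> \<le> Av n (\<lambda>g. L * \<bar>Wn n g\<bar>)"
      using L by (intro gibbs_mean_abs_le abs_mult_le) auto
    also have "\<dots> \<le> L * C0" unfolding gibbs_mean_cmult by (rule mult_left_mono[OF C0(2)[OF n] L0])
    finally have "1 / sqrt n * \<bar>Av n (\<lambda>g. f1 (Wn n g) * Wn n g)\<bar> \<le> rate n * (L * C0)"
      using inverse_sqrt_le_rate[OF n0] rate_pos[OF n0] by (intro mult_mono) auto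
    hence "\<bar>Av n (\<lambda>g. f1 (Wn n g) * S2 n g) - \<tau> * Av n (\<lambda>g. f1 (Wn n g))\<bar> \<le> rate n * (L * C0)"
      unfolding eq by (simp add: abs_mult)
    hence 2: "\<bar>2 * \<tau> * (Av n (\<lambda>g. f1 (Wn n g) * S2 n g) - \<tau> * Av n (\<lambda>g. f1 (Wn n g)))\<bar> \<le> 2 * \<tau> * (rate n * (L * C0))"
      using \<tau>_pos by (intro abs_mult_le) auto
    have "Av n (\<lambda>g. f (Wn n g) * Wn n g) - 2 * \<tau>\<^sup>2 * Av n (\<lambda>g. f1 (Wn n g))
       = (Av n (\<lambda>g. f (Wn n g) * Wn n g) - 2 * \<tau> * Av n (\<lambda>g. f1 (Wn n g) * S2 n g))
         + 2 * \<tau> * (Av n (\<lambda>g. f1 (Wn n g) * S2 n g) - \<tau> * Av n (\<lambda>g. f1 (Wn n g)))"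
      by (simp add: power2_eq_square algebra_simps)
    hence "\<bar>Av n (\<lambda>g. f (Wn n g) * Wn n g) - 2 * \<tau>\<^sup>2 * Av n (\<lambda>g. f1 (Wn n g))\<bar>
       \<le> L * (C1 * rate n) + 2 * \<tau> * (rate n * (L * C0))"
      using 1 2 by linarith
    also have "\<dots> = L * ((C1 + 2 * \<tau> * C0) * rate n)" by (simp add: algebra_simps)
    finally show ?thesis .
  qed
  moreover have "C1 + 2 * \<tau> * C0 \<ge> 0" using C0 C1 \<tau>_pos by simp
  ultimately show ?thesis by (intro exI[of _ "C1 + 2 * \<tau> * C0"]) auto
qed


section \<open>Convergence of the characteristic function\<close>

definition cosav :: "nat \<Rightarrow> real \<Rightarrow> real" where
  "cosav n v = Av n (\<lambda>g. cos (v * Wn n g))"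

definition sinav :: "nat \<Rightarrow> real \<Rightarrow> real" where
  "sinav n v = Av n (\<lambda>g. sin (v * Wn n g))"

lemma cosav_deriv: "(cosav n has_real_derivative Av n (\<lambda>g. - sin (v * Wn n g) * Wn n g)) (at v)"
  unfolding cosav_def [abs_def] gibbs_mean_def using partition_pos[of \<theta> \<beta> n]
  by (auto intro!: derivative_eq_intros sum.cong simp: mult_ac sum_divide_distrib)

lemma sinav_deriv: "(sinav n has_real_derivative Av n (\<lambda>g. cos (v * Wn n g) * Wn n g)) (at v)"
  unfolding sinav_def [abs_def] gibbs_mean_def using partition_pos[of \<theta> \<beta> n]
  by (auto intro!: derivative_eq_intros sum.cong simp: mult_ac sum_divide_distrib)

text \<open>Gronwall-type argument for \<open>\<psi>' = - 2 \<tau>\<^sup>2 v \<psi>\<close> with a small error: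
  the derivative of \<open>\<psi> exp (\<tau>\<^sup>2 v\<^sup>2)\<close> is small.\<close>
lemma ode_perturbation:
  fixes \<psi> \<psi>' :: "real \<Rightarrow> real" and c u :: real
  assumes d: "\<And>v. (\<psi> has_real_derivative \<psi>' v) (at v)"
    and e: "\<And>v. \<bar>v\<bar> \<le> \<bar>u\<bar> \<Longrightarrow> \<bar>\<psi>' v + 2 * c * v * \<psi> v\<bar> \<le> \<epsilon>" and c: "c \<ge> 0"
  shows "\<bar>\<psi> u - \<psi> 0 * exp (- (c * u\<^sup>2))\<bar> \<le> \<bar>u\<bar> * (\<epsilon> * exp (c * u\<^sup>2))"
proof -
  let ?A = "\<lambda>v. \<psi> v * exp (c * v\<^sup>2)"
  have \<epsilon>: "\<epsilon> \<ge> 0" using e[of 0] by simp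
  have der: "(?A has_real_derivative (\<psi>' v + 2 * c * v * \<psi> v) * exp (c * v\<^sup>2)) (at v)" for v
    by (auto intro!: derivative_eq_intros d simp: algebra_simps)
  have "norm (?A u - ?A 0) \<le> (\<epsilon> * exp (c * u\<^sup>2)) * norm (u - 0)"
  proof (rule field_differentiable_bound[of "{v. \<bar>v\<bar> \<le> \<bar>u\<bar>}"])
    have "{v. \<bar>v\<bar> \<le> \<bar>u\<bar>} = {- \<bar>u\<bar>..\<bar>u\<bar>}" by auto
    thus "convex {v. \<bar>v\<bar> \<le> \<bar>u\<bar>}" by simp
    fix v assume v: "v \<in> {v. \<bar>v\<bar> \<le> \<bar>u\<bar>}"
    show "(?A has_field_derivative (\<psi>' v + 2 * c * v * \<psi> v) * exp (c * v\<^sup>2)) (at v within {v. \<bar>v\<bar> \<le> \<bar>u\<bar>})"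
      using der by (rule has_field_derivative_at_within)
    have "v\<^sup>2 \<le> u\<^sup>2" using v by (simp add: abs_le_square_iff)
    hence "\<bar>exp (c * v\<^sup>2)\<bar> \<le> exp (c * u\<^sup>2)" using c by (simp add: mult_left_mono)
    thus "norm ((\<psi>' v + 2 * c * v * \<psi> v) * exp (c * v\<^sup>2)) \<le> \<epsilon> * exp (c * u\<^sup>2)"
      using e[of v] v unfolding real_norm_def by (intro abs_mult_le) auto
  qed auto
  hence 1: "\<bar>?A u - \<psi> 0\<bar> \<le> \<bar>u\<bar> * (\<epsilon> * exp (c * u\<^sup>2))" by (simp add: mult.commute)
  have ee: "exp (c * u\<^sup>2) * exp (- (c * u\<^sup>2)) = 1" by (simp flip: exp_add)
  have "\<psi> u - \<psi> 0 * exp (- (c * u\<^sup>2)) = \<psi> u * (exp (c * u\<^sup>2) * exp (- (c * u\<^sup>2))) - \<psi> 0 * exp (- (c * u\<^sup>2))"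
    unfolding ee by simp
  also have "\<dots> = (?A u - \<psi> 0) * exp (- (c * u\<^sup>2))" by (simp add: algebra_simps)
  finally have eq: "\<psi> u - \<psi> 0 * exp (- (c * u\<^sup>2)) = (?A u - \<psi> 0) * exp (- (c * u\<^sup>2))" .
  have "\<bar>(?A u - \<psi> 0) * exp (- (c * u\<^sup>2))\<bar> \<le> \<bar>u\<bar> * (\<epsilon> * exp (c * u\<^sup>2)) * 1"
    using c by (intro abs_mult_le 1) auto
  thus ?thesis unfolding eq by simp
qed

lemma abs_le_one_plus_square: "\<bar>v\<bar> \<le> 1 + (v::real)\<^sup>2"
  using zero_le_power2[of "\<bar>v\<bar> - 1 / 2"] by (simp add: power2_eq_square algebra_simps)

lemma rate_tendsto: "rate \<longlonglongrightarrow> 0"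
  unfolding rate_def [abs_def] by (rule tendsto_neg_powr) (auto intro: filterlim_real_sequentially)

text \<open>The test functions sin (v x) and cos (v x) give the perturbed equation \<psi>' = - 2
  \<tau>^2 v \<psi> for the real and the imaginary part, uniformly in \<bar>v\<bar> \<le>
  \<bar>u\<bar>; the values 1 and 0 at v = 0 select the limits. The common bound L = 1 + v^2 covers
  the factors v and v^2 produced by differentiation.\<close>

lemma cosav_sinav_limit:
  "(\<lambda>n. cosav n u) \<longlonglongrightarrow> exp (- (\<tau>\<^sup>2 * u\<^sup>2))" "(\<lambda>n. sinav n u) \<longlonglongrightarrow> 0"
proof -
  obtain C where C: "C \<ge> 0" and C_le: "\<forall>n\<ge>4. \<forall>L f f1 f2. (\<forall>x. (f has_real_derivative f1 x) (at x)) \<longrightarrow> (\<forall>x. (f1 has_real_derivative f2 x) (at x)) \<longrightarrow>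
     (\<forall>x. \<bar>f x\<bar> \<le> L \<and> \<bar>f1 x\<bar> \<le> L \<and> \<bar>f2 x\<bar> \<le> L) \<longrightarrow>
     \<bar>Av n (\<lambda>g. f (Wn n g) * Wn n g) - 2 * \<tau>\<^sup>2 * Av n (\<lambda>g. f1 (Wn n g))\<bar> \<le> L * (C * rate n)"
    using stein_equation by (elim exE conjE) (rule that)
  have bnd: "\<bar>a * b\<bar> \<le> 1 + v\<^sup>2" if "\<bar>b\<bar> \<le> 1" "\<bar>a\<bar> \<le> 1 + v\<^sup>2" for a b v :: real
    using abs_mult_le[OF that(2,1)] by simp
  have sc: "\<bar>sin x\<bar> \<le> 1" "\<bar>cos x\<bar> \<le> 1" for x :: real by (simp_all add: abs_sin_le_one abs_cos_le_one)
  have sq: "\<bar>- (v * v)\<bar> \<le> 1 + v\<^sup>2" "\<bar>v * v\<bar> \<le> 1 + v\<^sup>2" for v :: real by (simp_all add: power2_eq_square)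
  have mono: "(1 + v\<^sup>2) * (C * rate n) \<le> (1 + u\<^sup>2) * (C * rate n)" if "\<bar>v\<bar> \<le> \<bar>u\<bar>" "n > 0" for v n
    using C rate_pos[OF that(2)] that(1) by (intro mult_right_mono) (auto simp: abs_le_square_iff)
  have cos_eq: "\<bar>Av n (\<lambda>g. - sin (v * Wn n g) * Wn n g) + 2 * \<tau>\<^sup>2 * v * cosav n v\<bar> \<le> (1 + u\<^sup>2) * (C * rate n)"
    if n: "n \<ge> 4" and v: "\<bar>v\<bar> \<le> \<bar>u\<bar>" for n v
  proof -
    have "\<bar>Av n (\<lambda>g. sin (v * Wn n g) * Wn n g) - 2 * \<tau>\<^sup>2 * Av n (\<lambda>g. v * cos (v * Wn n g))\<bar> \<le> (1 + v\<^sup>2) * (C * rate n)"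
    proof (rule C_le[rule_format, OF n, where f = "\<lambda>x. sin (v * x)" and ?f1.0 = "\<lambda>x. v * cos (v * x)" and ?f2.0 = "\<lambda>x. - (v * v) * sin (v * x)"])
      fix x
      show "((\<lambda>x. sin (v * x)) has_real_derivative v * cos (v * x)) (at x)"
        by (auto intro!: derivative_eq_intros)
      show "((\<lambda>x. v * cos (v * x)) has_real_derivative - (v * v) * sin (v * x)) (at x)"
        by (auto intro!: derivative_eq_intros)
      show "\<bar>sin (v * x)\<bar> \<le> 1 + v\<^sup>2 \<and> \<bar>v * cos (v * x)\<bar> \<le> 1 + v\<^sup>2 \<and> \<bar>- (v * v) * sin (v * x)\<bar> \<le> 1 + v\<^sup>2"
        using sc(1)[of "v * x"] by (intro conjI bnd sc sq abs_le_one_plus_square) (simp add: add_increasing2)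
    qed
    moreover have "Av n (\<lambda>g. - sin (v * Wn n g) * Wn n g) + 2 * \<tau>\<^sup>2 * v * cosav n v
      = - (Av n (\<lambda>g. sin (v * Wn n g) * Wn n g) - 2 * \<tau>\<^sup>2 * Av n (\<lambda>g. v * cos (v * Wn n g)))"
      using gibbs_mean_cmult[of \<theta> \<beta> n "-1" "\<lambda>g. sin (v * Wn n g) * Wn n g"] by (simp add: gibbs_mean_cmult cosav_def)
    ultimately show ?thesis using mono[OF v, of n] n by simp
  qed
  have sin_eq: "\<bar>Av n (\<lambda>g. cos (v * Wn n g) * Wn n g) + 2 * \<tau>\<^sup>2 * v * sinav n v\<bar> \<le> (1 + u\<^sup>2) * (C * rate n)"
    if n: "n \<ge> 4" and v: "\<bar>v\<bar> \<le> \<bar>u\<bar>" for n v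
  proof -
    have b: "\<bar>Av n (\<lambda>g. cos (v * Wn n g) * Wn n g) - 2 * \<tau>\<^sup>2 * Av n (\<lambda>g. - v * sin (v * Wn n g))\<bar> \<le> (1 + v\<^sup>2) * (C * rate n)"
    proof (rule C_le[rule_format, OF n, where f = "\<lambda>x. cos (v * x)" and ?f1.0 = "\<lambda>x. - v * sin (v * x)" and ?f2.0 = "\<lambda>x. - (v * v) * cos (v * x)"])
      fix x
      show "((\<lambda>x. cos (v * x)) has_real_derivative - v * sin (v * x)) (at x)"
        by (auto intro!: derivative_eq_intros)
      show "((\<lambda>x. - v * sin (v * x)) has_real_derivative - (v * v) * cos (v * x)) (at x)"
        by (auto intro!: derivative_eq_intros)
      show "\<bar>cos (v * x)\<bar> \<le> 1 + v\<^sup>2 \<and> \<bar>- v * sin (v * x)\<bar> \<le> 1 + v\<^sup>2 \<and> \<bar>- (v * v) * cos (v * x)\<bar> \<le> 1 + v\<^sup>2"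
        using sc(2)[of "v * x"] abs_le_one_plus_square[of v] by (intro conjI bnd sc sq) (simp_all add: add_increasing2)
    qed
    have m: "Av n (\<lambda>g. cos (v * Wn n g) * Wn n g) + 2 * \<tau>\<^sup>2 * v * sinav n v
      = Av n (\<lambda>g. cos (v * Wn n g) * Wn n g) - 2 * \<tau>\<^sup>2 * Av n (\<lambda>g. - v * sin (v * Wn n g))"
      unfolding gibbs_mean_cmult sinav_def by simp
    show ?thesis unfolding m by (rule order.trans[OF b mono[OF v]]) (use n in simp)
  qed
  define B where "B n = \<bar>u\<bar> * (((1 + u\<^sup>2) * (C * rate n)) * exp (\<tau>\<^sup>2 * u\<^sup>2))" for n
  have B: "B \<longlonglongrightarrow> 0" unfolding B_def [abs_def]
    by (auto intro!: tendsto_eq_intros rate_tendsto)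
  have c0: "cosav n 0 = 1" "sinav n 0 = 0" for n by (simp_all add: cosav_def sinav_def gibbs_mean_const)
  have 1: "\<forall>\<^sub>F n in sequentially. norm (cosav n u - exp (- (\<tau>\<^sup>2 * u\<^sup>2))) \<le> B n"
    using eventually_ge_at_top[of 4]
  proof eventually_elim
    case (elim n)
    show ?case using ode_perturbation[OF cosav_deriv cos_eq[OF elim]] unfolding c0 B_def by simp
  qed
  have 2: "\<forall>\<^sub>F n in sequentially. norm (sinav n u) \<le> B n"
    using eventually_ge_at_top[of 4]
  proof eventually_elim
    case (elim n)
    show ?case using ode_perturbation[OF sinav_deriv sin_eq[OF elim]] unfolding c0 B_def by simp
  qed
  show "(\<lambda>n. cosav n u) \<longlonglongrightarrow> exp (- (\<tau>\<^sup>2 * u\<^sup>2))"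
    using Lim_null_comparison[OF 1 B] by (simp add: LIM_zero_iff)
  show "(\<lambda>n. sinav n u) \<longlonglongrightarrow> 0"
    by (rule Lim_null_comparison[OF 2 B])
qed

end

section \<open>The central limit theorem\<close>

lemma char_centered_normal:
  assumes \<sigma>: "\<sigma> > 0"
  shows "char (density lborel (normal_density 0 \<sigma>)) u = complex_of_real (exp (- (\<sigma>\<^sup>2 * u\<^sup>2) / 2))"
    and "real_distribution (density lborel (normal_density 0 \<sigma>))"
proof -
  interpret S: real_distribution std_normal_distribution by (rule real_dist_normal_dist)
  have "distributed std_normal_distribution lborel (\<lambda>x. x) std_normal_density"
    unfolding distributed_def by (auto simp: distr_id2)
  from S.normal_density_affine[OF this, of \<sigma> 0] \<sigma>
  have d: "distributed std_normal_distribution lborel (\<lambda>x. \<sigma> * x) (normal_density 0 \<sigma>)" by simp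
  have eq: "density lborel (normal_density 0 \<sigma>) = distr std_normal_distribution borel (\<lambda>x. \<sigma> * x)"
    using distributed_distr_eq_density[OF d] by (metis distr_cong sets_lborel)
  have "char (density lborel (normal_density 0 \<sigma>)) u = char std_normal_distribution (\<sigma> * u)"
    unfolding eq char_def by (subst integral_distr) (auto simp: mult_ac)
  thus "char (density lborel (normal_density 0 \<sigma>)) u = complex_of_real (exp (- (\<sigma>\<^sup>2 * u\<^sup>2) / 2))"
    unfolding char_std_normal_distribution by (simp add: power_mult_distrib)
  show "real_distribution (density lborel (normal_density 0 \<sigma>))"
    unfolding eq by (rule S.real_distribution_distr) simp
qed

text \<open>The prefactor of \<open>two_star_weight_energy\<close> cancels against the normalizing
  constant. Values in a Banach space are allowed so that complex exponentials are covered.\<close>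

lemma expectation_two_star:
  fixes X :: "(nat \<Rightarrow> nat \<Rightarrow> nat) \<Rightarrow> 'a :: {banach, second_countable_topology}"
  assumes \<omega>: "\<theta> = \<omega>1 / 4" "\<beta> = (\<omega>1 + \<omega>2) / 2" and n: "n \<ge> 2"
  shows "measure_pmf.expectation (two_star_pmf \<omega>1 \<omega>2 n) X
    = (\<Sum>g\<in>graphs n. (exp (energy \<theta> \<beta> n g) / (\<Sum>g\<in>graphs n. exp (energy \<theta> \<beta> n g))) *\<^sub>R X g)"
proof -
  have "measure_pmf.expectation (two_star_pmf \<omega>1 \<omega>2 n) X
     = (\<Sum>g\<in>graphs n. pmf (two_star_pmf \<omega>1 \<omega>2 n) g *\<^sub>R X g)"
    by (rule integral_measure_pmf[OF finite_graphs]) (auto simp: set_pmf_iff pmf_two_star split: if_splits)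
  also have "\<dots> = (\<Sum>g\<in>graphs n. (exp (energy \<theta> \<beta> n g) / (\<Sum>g\<in>graphs n. exp (energy \<theta> \<beta> n g))) *\<^sub>R X g)"
  proof (intro sum.cong refl)
    fix g assume g: "g \<in> graphs n"
    have "pmf (two_star_pmf \<omega>1 \<omega>2 n) g = exp (energy \<theta> \<beta> n g) / (\<Sum>g\<in>graphs n. exp (energy \<theta> \<beta> n g))"
      using g by (simp add: pmf_two_star two_star_Z_def two_star_weight_energy[OF \<omega> n] flip: sum_distrib_left)
    thus "pmf (two_star_pmf \<omega>1 \<omega>2 n) g *\<^sub>R X g
      = (exp (energy \<theta> \<beta> n g) / (\<Sum>g\<in>graphs n. exp (energy \<theta> \<beta> n g))) *\<^sub>R X g" by simp
  qed
  finally show ?thesis .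
qed

text \<open>The centring is a parameter because \<open>\<tau>\<close> of the locale is identified
  with \<open>two_star_tau\<close> only in the final step.\<close>

definition degree_statistic :: "real \<Rightarrow> nat \<Rightarrow> (nat \<Rightarrow> nat \<Rightarrow> nat) \<Rightarrow> real" where
  "degree_statistic c n g = sqrt (real n) *
     (4 / (real n)\<^sup>2 * (\<Sum>i=1..n. (real (vdeg n g i) - avg_deg n g)\<^sup>2) - c)"

lemma degree_statistic_S2:
  assumes n: "n \<ge> 2"
  shows "degree_statistic c n g = sqrt n * (((real n - 1) / n)\<^sup>2 * S2 n g - c)"
proof -
  define N where "N = real n - 1"
  have N: "N > 0" using n by (simp add: N_def)
  have d: "real (vdeg n g i) = N / 2 * (1 + zdeg n g i)" for i
    using N by (simp add: zdeg_def N_def field_simps)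
  have "avg_deg n g = 1 / n * (N / 2 * (\<Sum>i=1..n. 1 + zdeg n g i))"
    unfolding avg_deg_def d sum_distrib_left[symmetric] ..
  also have "\<dots> = N / 2 * (1 + mz n g)"
    using n by (simp add: mz_def sum.distrib field_simps)
  finally have a: "avg_deg n g = N / 2 * (1 + mz n g)" .
  have "(\<Sum>i=1..n. (real (vdeg n g i) - avg_deg n g)\<^sup>2) = (\<Sum>i=1..n. (N / 2)\<^sup>2 * (yd n g i)\<^sup>2)"
    unfolding d a yd_def by (intro sum.cong refl) (simp add: power_mult_distrib[symmetric] algebra_simps add_divide_distrib)
  also have "\<dots> = (N / 2)\<^sup>2 * S2 n g" by (simp add: S2_def sum_distrib_left)
  finally show ?thesis using n unfolding degree_statistic_def N_def by (simp add: power_divide)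
qed

context two_star
begin

text \<open>Normalizing by n^2 instead of (n - 1)^2 changes S2 by a relative O(1 / n), which is
  O(n^(-1/2)) after multiplication by sqrt n.\<close>

lemma degree_statistic_close:
  assumes n: "n \<ge> 4"
  shows "\<bar>degree_statistic \<tau> n g - Wn n g\<bar> \<le> 2 * kap * (rate n * RR n g)"
proof -
  have n0: "n > 0" "real n > 0" using n by simp_all
  define x where "x = 1 / real n"
  have x: "0 \<le> x" "x \<le> 1" "(real n - 1) / n = 1 - x" using n by (simp_all add: x_def field_simps)
  have "degree_statistic \<tau> n g - Wn n g = - (sqrt n * (S2 n g * (2 * x - x\<^sup>2)))"
    using n unfolding Wn_def by (subst degree_statistic_S2) (simp_all add: x(3) power2_eq_square algebra_simps)
  hence "\<bar>degree_statistic \<tau> n g - Wn n g\<bar> = sqrt n * (S2 n g * \<bar>2 * x - x\<^sup>2\<bar>)"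
    using S2_nonneg[of n g] by (simp add: abs_mult)
  also have "\<dots> \<le> sqrt n * ((kap * RR n g) * (2 * x))"
  proof (intro mult_left_mono mult_mono S2_le n0)
    have "x\<^sup>2 \<le> x" using x mult_left_mono[of x 1 x] by (simp add: power2_eq_square)
    thus "\<bar>2 * x - x\<^sup>2\<bar> \<le> 2 * x" using x zero_le_power2[of x] by linarith
  qed (use kap_ge_1 RR_ge_1[OF n0(1), of g] in auto)
  also have "\<dots> = 2 * kap * ((1 / sqrt n) * RR n g)" using n0 by (simp add: x_def field_simps)
  also have "\<dots> \<le> 2 * kap * (rate n * RR n g)"
    using kap_ge_1 RR_ge_1[OF n0(1), of g]
    by (intro mult_left_mono mult_right_mono inverse_sqrt_le_rate n0) auto
  finally show ?thesis .
qed

text \<open>cos and sin are 1-Lipschitz, so a bound on the mean distance of the two statistics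
  transfers the limits.\<close>

lemma degree_statistic_trig_limits:
  "(\<lambda>n. Av n (\<lambda>g. cos (u * degree_statistic \<tau> n g))) \<longlonglongrightarrow> exp (- (\<tau>\<^sup>2 * u\<^sup>2))"
  "(\<lambda>n. Av n (\<lambda>g. sin (u * degree_statistic \<tau> n g))) \<longlonglongrightarrow> 0"
proof -
  obtain C0 where C0: "C0 \<ge> 1" "\<And>n. n \<ge> 3 \<Longrightarrow> Av n (\<lambda>g. (RR n g)\<^sup>2) \<le> C0"
    using RR_square_moment by blast
  let ?B = "\<lambda>n. \<bar>u\<bar> * (2 * kap) * (rate n * C0)"
  have B: "?B \<longlonglongrightarrow> 0" by (auto intro!: tendsto_eq_intros rate_tendsto)
  have diff: "\<bar>Av n (\<lambda>g. f (u * degree_statistic \<tau> n g)) - Av n (\<lambda>g. f (u * Wn n g))\<bar> \<le> ?B n"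
    if n: "n \<ge> 4" and f: "\<And>x y. \<bar>f x - f y\<bar> \<le> \<bar>x - y\<bar>" for n and f :: "real \<Rightarrow> real"
  proof -
    have "\<bar>Av n (\<lambda>g. f (u * degree_statistic \<tau> n g) - f (u * Wn n g))\<bar> \<le> Av n (\<lambda>g. \<bar>u\<bar> * (2 * kap) * (rate n * RR n g))"
    proof (rule gibbs_mean_abs_le)
      fix g
      have "\<bar>f (u * degree_statistic \<tau> n g) - f (u * Wn n g)\<bar> \<le> \<bar>u * (degree_statistic \<tau> n g - Wn n g)\<bar>"
        using f[of "u * degree_statistic \<tau> n g" "u * Wn n g"] by (simp add: right_diff_distrib)
      also have "\<dots> \<le> \<bar>u\<bar> * (2 * kap * (rate n * RR n g))"
        by (intro abs_mult_le degree_statistic_close n) auto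
      finally show "\<bar>f (u * degree_statistic \<tau> n g) - f (u * Wn n g)\<bar> \<le> \<bar>u\<bar> * (2 * kap) * (rate n * RR n g)"
        by (simp add: mult_ac)
    qed
    also have "\<dots> = \<bar>u\<bar> * (2 * kap) * (rate n * Av n (\<lambda>g. RR n g))" by (simp only: gibbs_mean_cmult)
    also have "\<dots> \<le> ?B n"
      using RR_mean_bounds[OF C0(2)[of n] n] n kap_ge_1 rate_pos[of n] by (intro mult_left_mono) auto
    finally show ?thesis unfolding gibbs_mean_diff .
  qed
  have lim: "(\<lambda>n. Av n (\<lambda>g. f (u * degree_statistic \<tau> n g))) \<longlonglongrightarrow> l"
    if f: "\<And>x y. \<bar>f x - f y\<bar> \<le> \<bar>x - y\<bar>" and l: "(\<lambda>n. Av n (\<lambda>g. f (u * Wn n g))) \<longlonglongrightarrow> l" for f :: "real \<Rightarrow> real" and l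
  proof -
    have "\<forall>\<^sub>F n in sequentially. norm (Av n (\<lambda>g. f (u * degree_statistic \<tau> n g)) - Av n (\<lambda>g. f (u * Wn n g))) \<le> ?B n"
      using eventually_ge_at_top[of 4] by eventually_elim (use diff[OF _ f] in simp)
    from tendsto_add[OF Lim_null_comparison[OF this B] l] show ?thesis by simp
  qed
  have lip: "\<bar>cos x - cos y\<bar> \<le> \<bar>x - y\<bar>" "\<bar>sin x - sin y\<bar> \<le> \<bar>x - y\<bar>" for x y :: real
    using lipschitz_from_deriv[of cos "\<lambda>x. - sin x" 1 x y] lipschitz_from_deriv[of sin cos 1 x y] DERIV_cos DERIV_sin
    by auto
  show "(\<lambda>n. Av n (\<lambda>g. cos (u * degree_statistic \<tau> n g))) \<longlonglongrightarrow> exp (- (\<tau>\<^sup>2 * u\<^sup>2))"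
    using cosav_sinav_limit(1)[of u] unfolding cosav_def by (rule lim[OF lip(1)])
  show "(\<lambda>n. Av n (\<lambda>g. sin (u * degree_statistic \<tau> n g))) \<longlonglongrightarrow> 0"
    using cosav_sinav_limit(2)[of u] unfolding sinav_def by (rule lim[OF lip(2)])
qed

lemma degree_statistic_CLT:
  assumes \<omega>: "\<theta> = \<omega>1 / 4" "\<beta> = (\<omega>1 + \<omega>2) / 2"
  shows "weak_conv_m
     (\<lambda>n. distr (measure_pmf (two_star_pmf \<omega>1 \<omega>2 n)) borel (degree_statistic \<tau> n))
     (density lborel (normal_density 0 (sqrt (2 * \<tau>\<^sup>2))))"
proof (rule levy_continuity)
  have \<sigma>: "sqrt (2 * \<tau>\<^sup>2) > 0" using \<tau>_pos by simp
  show "real_distribution (density lborel (normal_density 0 (sqrt (2 * \<tau>\<^sup>2))))"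
    by (rule char_centered_normal[OF \<sigma>])
  let ?M = "\<lambda>n. distr (measure_pmf (two_star_pmf \<omega>1 \<omega>2 n)) borel (degree_statistic \<tau> n)"
  show "real_distribution (?M n)" for n
    by (rule prob_space.real_distribution_distr[OF measure_pmf.prob_space_axioms]) simp
  fix u :: real
  have ch: "char (?M n) u = complex_of_real (Av n (\<lambda>g. cos (u * degree_statistic \<tau> n g)))
      + \<i> * complex_of_real (Av n (\<lambda>g. sin (u * degree_statistic \<tau> n g)))" if n: "n \<ge> 2" for n
  proof -
    have "char (?M n) u = measure_pmf.expectation (two_star_pmf \<omega>1 \<omega>2 n) (\<lambda>g. iexp (u * degree_statistic \<tau> n g))"
      unfolding char_def by (subst integral_distr) auto
    also have "\<dots> = (\<Sum>g\<in>graphs n. (exp (energy \<theta> \<beta> n g) / (\<Sum>g\<in>graphs n. exp (energy \<theta> \<beta> n g)))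
        *\<^sub>R iexp (u * degree_statistic \<tau> n g))" by (rule expectation_two_star[OF \<omega> n])
    also have "\<dots> = complex_of_real (Av n (\<lambda>g. cos (u * degree_statistic \<tau> n g)))
      + \<i> * complex_of_real (Av n (\<lambda>g. sin (u * degree_statistic \<tau> n g)))"
      by (simp add: complex_eq_iff gibbs_mean_def sum_divide_distrib Re_exp Im_exp)
    finally show ?thesis .
  qed
  \<comment> \<open>The representation by the energy requires n \<ge> 2, so the limit is transferred
    along an eventual equality.\<close>
  have ev: "\<forall>\<^sub>F n in sequentially. complex_of_real (Av n (\<lambda>g. cos (u * degree_statistic \<tau> n g)))
      + \<i> * complex_of_real (Av n (\<lambda>g. sin (u * degree_statistic \<tau> n g))) = char (?M n) u"
    by (rule eventually_mono[OF eventually_ge_at_top[of 2]]) (rule ch[symmetric])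
  have "char (density lborel (normal_density 0 (sqrt (2 * \<tau>\<^sup>2)))) u
    = complex_of_real (exp (- (\<tau>\<^sup>2 * u\<^sup>2))) + \<i> * complex_of_real 0"
    unfolding char_centered_normal(1)[OF \<sigma>] by simp
  moreover have "(\<lambda>n. complex_of_real (Av n (\<lambda>g. cos (u * degree_statistic \<tau> n g)))
      + \<i> * complex_of_real (Av n (\<lambda>g. sin (u * degree_statistic \<tau> n g))))
     \<longlonglongrightarrow> complex_of_real (exp (- (\<tau>\<^sup>2 * u\<^sup>2))) + \<i> * complex_of_real 0"
    by (intro tendsto_add tendsto_mult tendsto_const tendsto_of_real degree_statistic_trig_limits)
  ultimately show "(\<lambda>n. char (?M n) u) \<longlonglongrightarrow> char (density lborel (normal_density 0 (sqrt (2 * \<tau>\<^sup>2)))) u"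
    using Lim_transform_eventually[OF _ ev] by simp
qed

end

theorem theorem1p2:
  fixes \<omega>1 \<omega>2 \<theta> \<beta> :: real
  assumes "\<theta> > 0" and "\<theta> = \<omega>1 / 4" and "\<beta> = (\<omega>1 + \<omega>2) / 2"
  shows "weak_conv_m
           (\<lambda>n. distr (measure_pmf (two_star_pmf \<omega>1 \<omega>2 n)) borel
              (\<lambda>g. sqrt (real n) *
                 (4 / (real n)\<^sup>2 * (\<Sum>i=1..n. (real (vdeg n g i) - avg_deg n g)\<^sup>2)
                  - two_star_tau \<theta> \<beta>)))
           (density lborel (normal_density 0 (sqrt (2 * (two_star_tau \<theta> \<beta>)\<^sup>2))))"
proof -
  obtain K where "two_star \<theta> \<beta> (two_star_t \<theta> \<beta>) K"
    using two_star_t_locale[OF assms(1)] by blast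
  then interpret two_star \<theta> \<beta> "two_star_t \<theta> \<beta>" K .
  have "\<tau> = two_star_tau \<theta> \<beta>" by (simp add: \<tau>_def \<tau>1_def two_star_tau_def)
  with degree_statistic_CLT[OF assms(2,3)] show ?thesis
    by (simp add: degree_statistic_def [abs_def])
qed

end
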